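(* Let $\alpha\in(0,1)$. Let the observations be generated by model $m$ with true parameter $\theta_{m,0}\in\Theta_m$, and let $m^*$ be a model number whose covariance structure is to be tested. Assume: (a) each drift $B\in\{B_{1,m},B_{2,m},B_{3,m},B_{4,m}\}$ is globally Lipschitz and belongs to $C^4_{\uparrow}$, and each process $Y\in\{\xi_m,\delta_m,\varepsilon_m,\zeta_m\}$ satisfies $\sup_t \mathbb{E}[|Y_t|^{\ell}]<\infty$ for all $\ell\ge 0$; (b) each process $Y\in\{\xi_m,\delta_m,\varepsilon_m,\zeta_m\}$ is ergodic with an invariant measure $\pi_Y$: for every $\pi_Y$-integrable $g$, $\frac1T\int_0^T g(Y_t)\,dt\to\int g\,d\pi_Y$ in probability as $T\to\infty$; (c) for $\mu\in\{m,m^*\}$ and all $\theta_\mu\in\Theta_\mu$: $\Sigma_{\delta\delta,\mu}>0$, $\Sigma_{\varepsilon\varepsilon,\mu}>0$, $\Psi_\mu$ is non-singular, and $\operatorname{rank}\Lambda_{x_1,\mu}=k_{1,\mu}$; (d) the minimizer $\bar\theta_{m^*}$ of $\mathbb{U}_{m^*}$ over $\Theta_{m^*}$ is unique: for $\theta\in\Theta_{m^*}$, $\mathbb{U}_{m^*}(\theta)=\mathbb{U}_{m^*}(\bar\theta_{m^*})$ implies $\theta=\bar\theta_{m^*}$; (e) the alternative $H_1$ holds: $\Sigma_m(\theta_{m,0})\neq\Sigma_{m^*}(\theta)$ for all $\theta\in\Theta_{m^*}$. Then, as $n\to\infty$ with $h_n\to0$ and $nh_n\to\infty$, $$\mathbb{P}\bigl(\mathbb{T}_{m^*,n}>\chi^2_{\bar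 p-q_{m^*}}(\alpha)\bigr)\longrightarrow1,$$ where $\chi^2_r(\alpha)$ is the upper $\alpha$ point of the chi-squared distribution with $r$ degrees of freedom.
   Context: Notation. $p=p_1+p_2$, $\bar p=p(p+1)/2$. $|\cdot|$ is the Euclidean norm; $A>0$ means positive definite. For symmetric $A\in\mathbb{R}^{p\times p}$, $\operatorname{vec}A$ and $\operatorname{vech}A$ are the vectorization and half-vectorization, $\mathbb{D}_p$ is the $p^2\times\bar p$ duplication matrix ($\operatorname{vec}A=\mathbb{D}_p\operatorname{vech}A$). $C^4_{\uparrow}(\mathbb{R}^d)$ is the set of functions on $\mathbb{R}^d$ that are four times continuously differentiable and which, together with all these derivatives, are of polynomial growth. Model ($m$ is a model number). $p_1,p_2\ge1$, $k_{1,m}\le p_1$, $k_{2,m}\le p_2$ are fixed integers independent of $n$; $p_1,p_2$ do not depend on the model number. The observable process is $X_t=(X_{1,t}^\top,X_{2,t}^\top)^\top\in\mathbb{R}^{p_1+p_2}$ with $$X_{1,t}=\Lambda_{x_1,m}\xi_{m,t}+\delta_{m,t},\quad X_{2,t}=\Lambda_{x_2,m}\eta_{m,t}+\varepsilon_{m,t},\quad \eta_{m,t}=B_{0,m}\eta_{m,t}+\Gamma_m\xi_{m,t}+\zeta_{m,t},$$ where $\Lambda_{x_1,m}\in\mathbb{R}^{p_1\times k_{1,m}}$, $\Lambda_{x_2,m}\in\mathbb{R}^{p_2\times k_{2,m}}$, $\Gamma_m\in\mathbb{R}^{k_{2,m}\times k_{1,m}}$, $B_{0,m}\in\mathbb{R}^{k_{2,m}\times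 k_{2,m}}$ (zero diagonal) are constant, and $\Psi_m=\mathbb{I}_{k_{2,m}}-B_{0,m}$. The latent processes (dimensions $k_{1,m},p_1,p_2,k_{2,m}$) solve $$d\xi_{m,t}=B_{1,m}(\xi_{m,t})dt+S_{1,m}dW_{1,t},\quad d\delta_{m,t}=B_{2,m}(\delta_{m,t})dt+S_{2,m}dW_{2,t},$$ $$d\varepsilon_{m,t}=B_{3,m}(\varepsilon_{m,t})dt+S_{3,m}dW_{3,t},\quad d\zeta_{m,t}=B_{4,m}(\zeta_{m,t})dt+S_{4,m}dW_{4,t},$$ with deterministic initial values, constant matrices $S_{i,m}$, and independent standard Wiener processes $W_1,\dots,W_4$ of dimensions $r_1,\dots,r_4$. Put $\Sigma_{\xi\xi,m}=S_{1,m}S_{1,m}^\top$, $\Sigma_{\delta\delta,m}=S_{2,m}S_{2,m}^\top$, $\Sigma_{\varepsilon\varepsilon,m}=S_{3,m}S_{3,m}^\top$, $\Sigma_{\zeta\zeta,m}=S_{4,m}S_{4,m}^\top$. Parameter. $\theta_m\in\Theta_m$, with $\Theta_m\subset\mathbb{R}^{q_m}$ convex and compact, collects the unknown, non-duplicated entries of $\Lambda_{x_1,m},\Lambda_{x_2,m},\Gamma_m,\Psi_m,\Sigma_{\xi\xi,m},\Sigma_{\delta\delta,m},\Sigma_{\varepsilon\varepsilon,m},\Sigma_{\zeta\zeta,m}$ (all other entries are known constants or equal to other entries), so these matrices are functions of $\theta_m$. The covariance structure is $$\Sigma_m(\theta_m)=\begin{pmatrix}\Sigma_{X_1X_1,m}&\Sigma_{X_1X_2,m}\\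 \Sigma_{X_1X_2,m}^\top&\Sigma_{X_2X_2,m}\end{pmatrix},$$ $\Sigma_{X_1X_1,m}=\Lambda_{x_1,m}\Sigma_{\xi\xi,m}\Lambda_{x_1,m}^\top+\Sigma_{\delta\delta,m}$, $\Sigma_{X_1X_2,m}=\Lambda_{x_1,m}\Sigma_{\xi\xi,m}\Gamma_m^\top\Psi_m^{-1\top}\Lambda_{x_2,m}^\top$, $\Sigma_{X_2X_2,m}=\Lambda_{x_2,m}\Psi_m^{-1}(\Gamma_m\Sigma_{\xi\xi,m}\Gamma_m^\top+\Sigma_{\zeta\zeta,m})\Psi_m^{-1\top}\Lambda_{x_2,m}^\top+\Sigma_{\varepsilon\varepsilon,m}$. The model $m^*$ has its own dimensions $k_{1,m^*},k_{2,m^*}$, matrices, parameter set $\Theta_{m^*}\subset\mathbb{R}^{q_{m^*}}$ (convex compact) and covariance structure $\Sigma_{m^*}(\theta_{m^*})$, defined in the same way with $m$ replaced by $m^*$. Observations. $X_{t_i^n}$ with $t_i^n=ih_n$, $0\le i\le n$, $T=nh_n$, and $Q_{XX}=\frac1T\sum_{i=1}^n(X_{t_i^n}-X_{t_{i-1}^n})(X_{t_i^n}-X_{t_{i-1}^n})^\top$. Further definitions. For positive definite $X,Y\in\mathbb{R}^{p\times p}$, $F(X,Y)=\log\det Y-\log\det X+\operatorname{tr}\{Y^{-1}X\}-p$ and $$V(X,Y)=\mathbb{D}_p^\top\int_0^1\!\!\int_0^1\lambda_2\,(Y+\lambda_1\lambda_2(X-Y))^{-1}\otimes(Y+\lambda_1\lambda_2(X-Y))^{-1}\,d\lambda_1d\lambda_2\,\mathbb{D}_p,$$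 so that $F(X,Y)=(\operatorname{vech}X-\operatorname{vech}Y)^\top V(X,Y)(\operatorname{vech}X-\operatorname{vech}Y)$. Set $\tilde V(Q_{XX},\Sigma)=V(Q_{XX},\Sigma)$ if $Q_{XX}$ is non-singular and $\mathbb{I}_{\bar p}$ otherwise, and $$\mathbb{F}_{m^*,n}(\theta)=(\operatorname{vech}Q_{XX}-\operatorname{vech}\Sigma_{m^*}(\theta))^\top\tilde V(Q_{XX},\Sigma_{m^*}(\theta))(\operatorname{vech}Q_{XX}-\operatorname{vech}\Sigma_{m^*}(\theta)),\quad\theta\in\Theta_{m^*}.$$ The estimator $\hat\theta_{m^*,n}\in\Theta_{m^*}$ satisfies $\mathbb{F}_{m^*,n}(\hat\theta_{m^*,n})=\inf_{\theta\in\Theta_{m^*}}\mathbb{F}_{m^*,n}(\theta)$, and $\mathbb{T}_{m^*,n}=n\,\mathbb{F}_{m^*,n}(\hat\theta_{m^*,n})$. Finally $\mathbb{U}_{m^*}(\theta)=F(\Sigma_m(\theta_{m,0}),\Sigma_{m^*}(\theta))$ and $\bar\theta_{m^*}\in\Theta_{m^*}$ satisfies $\mathbb{U}_{m^*}(\bar\theta_{m^*})=\inf_{\theta\in\Theta_{m^*}}\mathbb{U}_{m^*}(\theta)$. *)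

theory Defs
  imports "HOL-Probability.Probability" "HOL-Library.Uprod"
begin

section \<open>Matrices\<close>

definition pos_def :: "real^'n^'n \<Rightarrow> bool" where
  "pos_def A \<longleftrightarrow> transpose A = A \<and> (\<forall>x. x \<noteq> 0 \<longrightarrow> 0 < x \<bullet> (A *v x))"

definition outer_prod :: "real^'m \<Rightarrow> real^'n \<Rightarrow> real^'n^'m" where
  "outer_prod u v = (\<chi> i j. u $ i * v $ j)"

text \<open>\<open>A = S S\<^sup>T\<close> for a matrix \<open>S\<close> with columns \<open>s 0, \<dots>, s (r - 1)\<close>; the number \<open>r\<close> of columns
  (the dimension of the driving noise) is left free.\<close>

definition is_diffusion_matrix :: "real^'n^'n \<Rightarrow> bool" where
  "is_diffusion_matrix A \<longleftrightarrow> (\<exists>r (s :: nat \<Rightarrow> real^'n). A = (\<Sum>j<r. outer_prod (s j) (s j)))"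

definition kron :: "real^'b^'a \<Rightarrow> real^'d^'c \<Rightarrow> real^('b \<times> 'd)^('a \<times> 'c)" where
  "kron A B = (\<chi> r c. A $ fst r $ fst c * B $ snd r $ snd c)"

text \<open>Half-vectorization: the coordinates are indexed by unordered pairs \<open>{i, j}\<close>, of which there
  are \<open>p (p + 1) / 2\<close>, instead of the positions \<open>i \<ge> j\<close> of a lower triangle, as index types carry no
  order. For each pair one of the two mirror entries is taken; they agree when \<open>A\<close> is symmetric.\<close>

instance uprod :: (finite) finite
  by standard simp

lemma card_uprod: "CARD('p::finite uprod) = CARD('p) * (CARD('p) + 1) div 2"
  by (rule card_UNIV_uprod)

definition vec_of :: "real^'n^'m \<Rightarrow> real^('n \<times> 'm)" where
  "vec_of A = (\<chi> c. A $ snd c $ fst c)"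

definition vech :: "real^'p^'p \<Rightarrow> real^('p uprod)" where
  "vech A = (\<chi> u. SOME x. \<exists>i j. u = Upair i j \<and> x = A $ i $ j)"

definition duplication :: "real^('p::finite uprod)^('p \<times> 'p)" where
  "duplication = (\<chi> c u. if u = Upair (fst c) (snd c) then 1 else 0)"

lemma vech_symmetric:
  assumes "transpose A = A"
  shows "vech A $ Upair i j = A $ i $ j"
proof -
  have sym: "A $ k $ l = A $ l $ k" for k l
    by (metis assms transpose_def vec_lambda_beta)
  show ?thesis
    unfolding vech_def vec_lambda_beta
    by (rule some_equality) (use sym in auto)
qed

lemma vec_of_eq_duplication_vech:
  assumes "transpose A = A"
  shows "vec_of A = duplication *v vech A"
proof -
  have sym: "A $ k $ l = A $ l $ k" for k l
    by (metis assms transpose_def vec_lambda_beta)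
  have "(duplication *v vech A) $ c = A $ snd c $ fst c" for c
  proof -
    have "(duplication *v vech A) $ c =
        (\<Sum>u\<in>UNIV. if u = Upair (fst c) (snd c) then vech A $ u else 0)"
      unfolding matrix_vector_mult_def duplication_def vec_lambda_beta
      by (rule sum.cong) auto
    also have "\<dots> = vech A $ Upair (fst c) (snd c)"
      by simp
    finally show ?thesis
      using vech_symmetric[OF assms] sym by metis
  qed
  then show ?thesis
    by (simp add: vec_eq_iff vec_of_def)
qed

section \<open>Discrepancy functions\<close>

definition F_disc :: "real^'p^'p \<Rightarrow> real^'p^'p \<Rightarrow> real" where
  "F_disc X Y = ln (det Y) - ln (det X) + trace (matrix_inv Y ** X) - real CARD('p)"

definition V_mat :: "real^'p^'p \<Rightarrow> real^'p^'p \<Rightarrow> real^('p uprod)^('p uprod)" where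
  "V_mat X Y =
     transpose duplication **
     integral {0..1} (\<lambda>l2. integral {0..1} (\<lambda>l1.
       l2 *\<^sub>R kron (matrix_inv (Y + (l1 * l2) *\<^sub>R (X - Y)))
                 (matrix_inv (Y + (l1 * l2) *\<^sub>R (X - Y))))) **
     duplication"

definition V_tilde :: "real^'p^'p \<Rightarrow> real^'p^'p \<Rightarrow> real^('p uprod)^('p uprod)" where
  "V_tilde Q S = (if invertible Q then V_mat Q S else mat 1)"

definition contrast :: "real^'p^'p \<Rightarrow> real^'p^'p \<Rightarrow> real" where
  "contrast Q S = (vech Q - vech S) \<bullet> (V_tilde Q S *v (vech Q - vech S))"

section \<open>Structural equation models\<close>

record ('q::finite, 'k1::finite, 'k2::finite, 'p1::finite, 'p2::finite) sem_model =
  Params :: "(real^'q) set"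
  Lam1 :: "real^'q \<Rightarrow> real^'k1^'p1"
  Lam2 :: "real^'q \<Rightarrow> real^'k2^'p2"
  Gam :: "real^'q \<Rightarrow> real^'k1^'k2"
  B0 :: "real^'q \<Rightarrow> real^'k2^'k2"
  Sxi :: "real^'q \<Rightarrow> real^'k1^'k1"
  Sdel :: "real^'q \<Rightarrow> real^'p1^'p1"
  Seps :: "real^'q \<Rightarrow> real^'p2^'p2"
  Szeta :: "real^'q \<Rightarrow> real^'k2^'k2"

definition Psi :: "('q::finite, 'k1::finite, 'k2::finite, 'p1::finite, 'p2::finite) sem_model \<Rightarrow> real^'q \<Rightarrow> real^'k2^'k2" where
  "Psi m \<theta> = mat 1 - B0 m \<theta>"

text \<open>Every entry is a known constant or one of the coordinates of the parameter; the same coordinate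
  may appear in several entries.\<close>

definition entries_param :: "(real^'q \<Rightarrow> real^'b^'a) \<Rightarrow> bool" where
  "entries_param f \<longleftrightarrow>
     (\<forall>i j. (\<exists>c. \<forall>\<theta>. f \<theta> $ i $ j = c) \<or> (\<exists>l. \<forall>\<theta>. f \<theta> $ i $ j = \<theta> $ l))"

definition has_entry :: "'q \<Rightarrow> (real^'q \<Rightarrow> real^'b^'a) \<Rightarrow> bool" where
  "has_entry l f \<longleftrightarrow> (\<exists>i j. \<forall>\<theta>. f \<theta> $ i $ j = \<theta> $ l)"

definition wf_model :: "('q::finite, 'k1::finite, 'k2::finite, 'p1::finite, 'p2::finite) sem_model \<Rightarrow> bool" where
  "wf_model m \<longleftrightarrow>
     CARD('k1) \<le> CARD('p1) \<and> CARD('k2) \<le> CARD('p2) \<and>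
     convex (Params m) \<and> compact (Params m) \<and>
     entries_param (Lam1 m) \<and> entries_param (Lam2 m) \<and>
     entries_param (Gam m) \<and> entries_param (Psi m) \<and>
     entries_param (Sxi m) \<and> entries_param (Sdel m) \<and>
     entries_param (Seps m) \<and> entries_param (Szeta m) \<and>
     (\<forall>l. has_entry l (Lam1 m) \<or> has_entry l (Lam2 m) \<or>
          has_entry l (Gam m) \<or> has_entry l (Psi m) \<or>
          has_entry l (Sxi m) \<or> has_entry l (Sdel m) \<or>
          has_entry l (Seps m) \<or> has_entry l (Szeta m)) \<and>
     (\<forall>\<theta>\<in>Params m.
        (\<forall>i. B0 m \<theta> $ i $ i = 0) \<and>
        is_diffusion_matrix (Sxi m \<theta>) \<and> is_diffusion_matrix (Sdel m \<theta>) \<and>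
        is_diffusion_matrix (Seps m \<theta>) \<and> is_diffusion_matrix (Szeta m \<theta>))"

definition Sigma11 :: "('q::finite, 'k1::finite, 'k2::finite, 'p1::finite, 'p2::finite) sem_model \<Rightarrow> real^'q \<Rightarrow> real^'p1^'p1" where
  "Sigma11 m \<theta> = Lam1 m \<theta> ** Sxi m \<theta> ** transpose (Lam1 m \<theta>) + Sdel m \<theta>"

definition Sigma12 :: "('q::finite, 'k1::finite, 'k2::finite, 'p1::finite, 'p2::finite) sem_model \<Rightarrow> real^'q \<Rightarrow> real^'p2^'p1" where
  "Sigma12 m \<theta> = Lam1 m \<theta> ** Sxi m \<theta> ** transpose (Gam m \<theta>)
     ** transpose (matrix_inv (Psi m \<theta>)) ** transpose (Lam2 m \<theta>)"

definition Sigma22 :: "('q::finite, 'k1::finite, 'k2::finite, 'p1::finite, 'p2::finite) sem_model \<Rightarrow> real^'q \<Rightarrow> real^'p2^'p2" where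
  "Sigma22 m \<theta> = Lam2 m \<theta> ** matrix_inv (Psi m \<theta>)
     ** (Gam m \<theta> ** Sxi m \<theta> ** transpose (Gam m \<theta>) + Szeta m \<theta>)
     ** transpose (matrix_inv (Psi m \<theta>)) ** transpose (Lam2 m \<theta>) + Seps m \<theta>"

definition Sigma_cov ::
  "('q::finite, 'k1::finite, 'k2::finite, 'p1::finite, 'p2::finite) sem_model \<Rightarrow> real^'q \<Rightarrow> real^('p1 + 'p2)^('p1 + 'p2)" where
  "Sigma_cov m \<theta> = (\<chi> a b. case a of
      Inl i \<Rightarrow> (case b of Inl j \<Rightarrow> Sigma11 m \<theta> $ i $ j | Inr j \<Rightarrow> Sigma12 m \<theta> $ i $ j)
    | Inr i \<Rightarrow> (case b of Inl j \<Rightarrow> transpose (Sigma12 m \<theta>) $ i $ j | Inr j \<Rightarrow> Sigma22 m \<theta> $ i $ j))"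

definition sem_nondegenerate :: "('q::finite, 'k1::finite, 'k2::finite, 'p1::finite, 'p2::finite) sem_model \<Rightarrow> bool" where
  "sem_nondegenerate m \<longleftrightarrow> (\<forall>\<theta>\<in>Params m.
     pos_def (Sdel m \<theta>) \<and> pos_def (Seps m \<theta>) \<and> invertible (Psi m \<theta>) \<and>
     rank (Lam1 m \<theta>) = CARD('k1))"

section \<open>Drift functions\<close>

definition poly_growth :: "(real^'d \<Rightarrow> real) \<Rightarrow> bool" where
  "poly_growth f \<longleftrightarrow> (\<exists>C N. \<forall>x. \<bar>f x\<bar> \<le> C * (1 + norm x) ^ N)"

text \<open>\<open>C_up k f\<close>: \<open>f\<close> is \<open>k\<close> times continuously differentiable and all its partial derivatives of
  order at most \<open>k\<close> are of polynomial growth. A function is \<open>C\<^sup>k\<^sup>+\<^sup>1\<close> iff it is differentiable with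
  partial derivatives of class \<open>C\<^sup>k\<close>.\<close>

primrec C_up :: "nat \<Rightarrow> (real^'d \<Rightarrow> real) \<Rightarrow> bool" where
  "C_up 0 f \<longleftrightarrow> continuous_on UNIV f \<and> poly_growth f"
| "C_up (Suc k) f \<longleftrightarrow> f differentiable_on UNIV \<and> poly_growth f \<and>
     (\<forall>i. C_up k (\<lambda>x. frechet_derivative f (at x) (axis i 1)))"

definition regular_drift :: "(real^'d \<Rightarrow> real^'d) \<Rightarrow> bool" where
  "regular_drift B \<longleftrightarrow> (\<exists>L. L-lipschitz_on UNIV B) \<and> (\<forall>j. C_up 4 (\<lambda>x. B x $ j))"

section \<open>Stochastic processes\<close>

text \<open>Processes are indexed by \<open>t \<ge> 0\<close>; their values at negative times are never used.\<close>

definition standard_wiener :: "'a measure \<Rightarrow> (real \<Rightarrow> 'a \<Rightarrow> real^'r) \<Rightarrow> bool" where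
  "standard_wiener M W \<longleftrightarrow>
     (\<forall>t\<ge>0. W t \<in> borel_measurable M) \<and>
     (AE \<omega> in M. W 0 \<omega> = 0) \<and>
     (\<forall>\<omega>\<in>space M. continuous_on {0..} (\<lambda>t. W t \<omega>)) \<and>
     (\<forall>(n::nat) t. 0 \<le> t 0 \<longrightarrow> (\<forall>i<n. t i \<le> t (Suc i)) \<longrightarrow>
        prob_space.indep_vars M (\<lambda>_. borel) (\<lambda>i \<omega>. W (t (Suc i)) \<omega> - W (t i) \<omega>) {..<n}) \<and>
     (\<forall>s t. 0 \<le> s \<longrightarrow> s < t \<longrightarrow>
        prob_space.indep_vars M (\<lambda>_. borel) (\<lambda>j \<omega>. (W t \<omega> - W s \<omega>) $ j) UNIV \<and>
        (\<forall>j. distributed M lborel (\<lambda>\<omega>. (W t \<omega> - W s \<omega>) $ j) (normal_density 0 (sqrt (t - s)))))"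

definition process_events :: "'a measure \<Rightarrow> (real \<Rightarrow> 'a \<Rightarrow> real^'r) \<Rightarrow> 'a set set" where
  "process_events M W =
     sigma_sets (space M) (\<Union>t\<in>{0..}. {W t -` A \<inter> space M | A. A \<in> sets borel})"

definition indep_processes4 ::
  "'a measure \<Rightarrow> (real \<Rightarrow> 'a \<Rightarrow> real^'r1) \<Rightarrow> (real \<Rightarrow> 'a \<Rightarrow> real^'r2) \<Rightarrow>
   (real \<Rightarrow> 'a \<Rightarrow> real^'r3) \<Rightarrow> (real \<Rightarrow> 'a \<Rightarrow> real^'r4) \<Rightarrow> bool" where
  "indep_processes4 M W1 W2 W3 W4 \<longleftrightarrow>
     prob_space.indep_sets M
       (\<lambda>i::nat. [process_events M W1, process_events M W2,
                  process_events M W3, process_events M W4] ! i) {..<4}"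

text \<open>Solutions of \<open>dY = B(Y) dt + S dW\<close>, \<open>Y\<^sub>0 = y0\<close>, with deterministic \<open>y0\<close>. The noise is additive,
  so the equation is a pathwise integral equation. No filtration is needed: for Lipschitz \<open>B\<close> the
  equation determines the path of \<open>Y\<close> from that of \<open>W\<close>, so \<open>Y\<close> is automatically adapted.\<close>

definition sde_solution ::
  "'a measure \<Rightarrow> (real \<Rightarrow> 'a \<Rightarrow> real^'r) \<Rightarrow> (real^'d \<Rightarrow> real^'d) \<Rightarrow> real^'r^'d \<Rightarrow> real^'d \<Rightarrow>
   (real \<Rightarrow> 'a \<Rightarrow> real^'d) \<Rightarrow> bool" where
  "sde_solution M W B S y0 Y \<longleftrightarrow>
     (\<forall>t\<ge>0. Y t \<in> borel_measurable M) \<and>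
     (\<forall>\<omega>\<in>space M. continuous_on {0..} (\<lambda>t. Y t \<omega>)) \<and>
     (AE \<omega> in M. \<forall>t\<ge>0. Y t \<omega> = y0 + integral {0..t} (\<lambda>s. B (Y s \<omega>)) + S *v W t \<omega>)"

definition bounded_moments :: "'a measure \<Rightarrow> (real \<Rightarrow> 'a \<Rightarrow> real^'d) \<Rightarrow> bool" where
  "bounded_moments M Y \<longleftrightarrow>
     (\<forall>l::real. 0 \<le> l \<longrightarrow> (SUP t\<in>{0..}. \<integral>\<^sup>+\<omega>. ennreal (norm (Y t \<omega>) powr l) \<partial>M) < \<infinity>)"

definition conv_in_prob :: "'a measure \<Rightarrow> ('i \<Rightarrow> 'a \<Rightarrow> real) \<Rightarrow> real \<Rightarrow> 'i filter \<Rightarrow> bool" where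
  "conv_in_prob M Z c F \<longleftrightarrow>
     (\<forall>\<epsilon>>0. ((\<lambda>T. measure M {\<omega>\<in>space M. \<bar>Z T \<omega> - c\<bar> > \<epsilon>}) \<longlongrightarrow> 0) F)"

text \<open>\<open>\<pi> P\<^sub>t = \<pi>\<close> for the transition kernels \<open>P\<^sub>t(x, A) = P(Y\<^sup>x\<^sub>t \<in> A)\<close> of the diffusion, where \<open>Y\<^sup>x\<close> is
  the solution started at \<open>x\<close>, unique up to indistinguishability for Lipschitz \<open>B\<close>.\<close>

definition invariant_measure ::
  "'a measure \<Rightarrow> (real \<Rightarrow> 'a \<Rightarrow> real^'r) \<Rightarrow> (real^'d \<Rightarrow> real^'d) \<Rightarrow> real^'r^'d \<Rightarrow>
   (real^'d) measure \<Rightarrow> bool" where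
  "invariant_measure M W B S \<pi> \<longleftrightarrow>
     prob_space \<pi> \<and> sets \<pi> = sets borel \<and>
     (\<forall>Y. (\<forall>x. sde_solution M W B S x (Y x)) \<longrightarrow>
       (\<forall>t\<ge>0. \<forall>A\<in>sets borel.
          (\<integral>\<^sup>+x. emeasure M {\<omega>\<in>space M. Y x t \<omega> \<in> A} \<partial>\<pi>) = emeasure \<pi> A))"

definition ergodic_solution ::
  "'a measure \<Rightarrow> (real \<Rightarrow> 'a \<Rightarrow> real^'r) \<Rightarrow> (real^'d \<Rightarrow> real^'d) \<Rightarrow> real^'r^'d \<Rightarrow>
   (real \<Rightarrow> 'a \<Rightarrow> real^'d) \<Rightarrow> bool" where
  "ergodic_solution M W B S Y \<longleftrightarrow>
     (\<exists>\<pi>. invariant_measure M W B S \<pi> \<and>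
       (\<forall>g :: real^'d \<Rightarrow> real. integrable \<pi> g \<longrightarrow>
          conv_in_prob M (\<lambda>T \<omega>. 1 / T * (LINT t:{0..T}|lborel. g (Y t \<omega>)))
            (\<integral>x. g x \<partial>\<pi>) at_top))"

section \<open>Observations and test\<close>

definition realized_cov ::
  "(real \<Rightarrow> 'a \<Rightarrow> real^'p) \<Rightarrow> (nat \<Rightarrow> real) \<Rightarrow> nat \<Rightarrow> 'a \<Rightarrow> real^'p^'p" where
  "realized_cov X h n \<omega> = (1 / (real n * h n)) *\<^sub>R
     (\<Sum>i=1..n. outer_prod (X (real i * h n) \<omega> - X (real (i - 1) * h n) \<omega>)
                          (X (real i * h n) \<omega> - X (real (i - 1) * h n) \<omega>))"

text \<open>Law of the sum of squares of \<open>r\<close> independent standard normal variables; the point mass at \<open>0\<close>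
  for \<open>r = 0\<close>.\<close>

definition chi2 :: "nat \<Rightarrow> real measure" where
  "chi2 r = distr (PiM {..<r} (\<lambda>_. density lborel (\<lambda>x. ennreal (std_normal_density x)))) borel
     (\<lambda>x. \<Sum>i<r. (x i)\<^sup>2)"

text \<open>For \<open>r \<ge> 1\<close> this is the unique \<open>c\<close> with \<open>measure (chi2 r) {c<..} = \<alpha>\<close>, since the tail function is
  continuous everywhere and strictly decreasing on \<open>{0..}\<close>.\<close>

definition chi2_upper :: "nat \<Rightarrow> real \<Rightarrow> real" where
  "chi2_upper r \<alpha> = Inf {c. measure (chi2 r) {c<..} \<le> \<alpha>}"

end

theory Submission
  imports Defs
begin

text \<open>
  Write \<open>\<Sigma>\<^sub>0\<close> for the true covariance structure, \<open>K\<close> for the set of all covariance structures of the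
  tested model and \<open>Q\<^sub>n\<close> for the realized covariance. The minimal contrast stays away from \<open>0\<close> under
  the alternative, so that \<open>n\<close> times it exceeds every fixed critical value. Two facts carry this.

  The realized covariance converges in mean to \<open>\<Sigma>\<^sub>0\<close> (\<open>realized_cov_consistent\<close>). The observable
  process is a fixed linear image of the four latent diffusions, and \<open>\<Sigma>\<^sub>0\<close> is the corresponding sum of
  the four diffusion matrices (\<open>Sigma_cov_decomposition\<close>). An increment of a latent process is a
  Gaussian vector with second moments of order \<open>h\<close>, plus a drift integral with second
  moments of order \<open>h\<^sup>2\<close>. After division by \<open>n h\<close> only the products of Gaussian
  parts survive, and these obey a weak law of large numbers (\<open>L1_lim_wiener_self\<close>,
  \<open>L1_lim_wiener_cross\<close>, \<open>L1_lim_realized_covariation\<close>).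

  The contrast controls the distance: \<open>contrast Q S \<ge> c \<bar>Q - S\<bar>\<^sup>2\<close> with a single \<open>c > 0\<close> for all \<open>Q\<close>, \<open>S\<close> in
  a bounded set (\<open>contrast_ge\<close>). Indeed the contrast is a weighted average of \<open>tr (P D P D)\<close>, where
  \<open>D = Q - S\<close> and \<open>P\<close> is the inverse of a matrix on the segment from \<open>S\<close> to \<open>Q\<close>, and on a bounded set
  the eigenvalues of such inverses are bounded below. Since \<open>K\<close> is compact and does not contain
  \<open>\<Sigma>\<^sub>0\<close>, the contrast between any \<open>Q\<close> close to \<open>\<Sigma>\<^sub>0\<close> and any element of \<open>K\<close> is at least a fixed positive
  number (\<open>contrast_bounded_away\<close>).

  The probability in the conclusion is meaningful because the value of the contrast at the estimator
  is an infimum over a compact parameter set, which by continuity is an infimum over a countable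
  dense subset and hence measurable (\<open>borel_measurable_INF_contrast\<close>); the estimator itself may be
  any selection of minimizers.
\<close>

section \<open>Positive semidefinite matrices\<close>

definition psd :: "real^'n^'n \<Rightarrow> bool" where
  "psd A \<longleftrightarrow> transpose A = A \<and> (\<forall>x. 0 \<le> x \<bullet> (A *v x))"

lemma inner_matrix_vector_transpose:
  fixes A :: "real^'n^'m"
  shows "x \<bullet> (A *v y) = (transpose A *v x) \<bullet> y"
  by (simp add: dot_lmul_matrix)

text \<open>The norm of a matrix is the Frobenius norm here, so this is the Cauchy-Schwarz inequality for
  each row.\<close>

lemma norm_matrix_vector_mult_le:
  fixes A :: "real^'n^'m"
  shows "norm (A *v x) \<le> norm A * norm x"
proof -
  have "(norm (A *v x))\<^sup>2 = (\<Sum>i\<in>UNIV. (A $ i \<bullet> x)\<^sup>2)"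
    unfolding power2_norm_eq_inner by (simp add: inner_vec_def matrix_vector_mult_def power2_eq_square)
  also have "\<dots> \<le> (\<Sum>i\<in>UNIV. (norm (A $ i))\<^sup>2 * (norm x)\<^sup>2)"
    by (intro sum_mono) (metis Cauchy_Schwarz_ineq power2_norm_eq_inner)
  also have "\<dots> = (norm A * norm x)\<^sup>2"
    by (simp add: sum_distrib_right[symmetric] power_mult_distrib norm_vec_def L2_set_def sum_nonneg)
  finally show ?thesis
    by (rule power2_le_imp_le) simp
qed

lemma matrix_vector_mult_axis_nth:
  fixes A :: "real^'n^'m"
  shows "(A *v axis j 1) $ i = A $ i $ j"
  by (simp add: matrix_vector_mult_basis column_def)

lemma matrix_eq_zero_iff_mult_axis:
  fixes A :: "real^'n^'m"
  shows "A = 0 \<longleftrightarrow> (\<forall>j. A *v axis j 1 = 0)"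
  by (auto simp: vec_eq_iff matrix_vector_mult_axis_nth)

lemma outer_prod_mult_vec:
  fixes u :: "real^'m" and v w :: "real^'n"
  shows "outer_prod u v *v w = (v \<bullet> w) *\<^sub>R u"
  by (simp add: vec_eq_iff outer_prod_def matrix_vector_mult_def inner_vec_def sum_distrib_left
      mult_ac)

lemma scaleR_matrix_vector: "(c *\<^sub>R (A::real^'n^'m)) *v x = c *\<^sub>R (A *v x)"
  by (simp add: vec_eq_iff matrix_vector_mult_def sum_distrib_left mult.assoc)

lemma sum_matrix_vector: "(\<Sum>i\<in>I. A i :: real^'n^'m) *v x = (\<Sum>i\<in>I. A i *v x)"
  by (induction I rule: infinite_finite_induct) (auto simp: matrix_vector_mult_add_rdistrib)

lemma transpose_add: "transpose (A + B) = transpose A + transpose (B::real^'n^'m)"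
  by (simp add: vec_eq_iff transpose_def)

lemma transpose_diff: "transpose (A - B) = transpose A - transpose (B::real^'n^'m)"
  by (simp add: vec_eq_iff transpose_def)

lemma transpose_scaleR: "transpose (c *\<^sub>R A) = c *\<^sub>R transpose (A::real^'n^'m)"
  by (simp add: vec_eq_iff transpose_def)

lemma transpose_sum: "transpose (\<Sum>i\<in>I. A i :: real^'n^'m) = (\<Sum>i\<in>I. transpose (A i))"
  by (simp add: vec_eq_iff transpose_def)

lemma transpose_zero: "transpose (0 :: real^'n^'m) = 0"
  by (simp add: vec_eq_iff transpose_def)

lemma transpose_outer_prod: "transpose (outer_prod u v) = outer_prod v u"
  by (simp add: vec_eq_iff transpose_def outer_prod_def)

lemma psd_Cauchy_Schwarz:
  assumes "psd A"
  shows "(x \<bullet> (A *v y))\<^sup>2 \<le> (x \<bullet> (A *v x)) * (y \<bullet> (A *v y))"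
proof -
  have sym: "y \<bullet> (A *v x) = x \<bullet> (A *v y)" for x y
    using assms unfolding psd_def by (metis inner_commute inner_matrix_vector_transpose)
  define a b c where "a = x \<bullet> (A *v x)" and "b = x \<bullet> (A *v y)" and "c = y \<bullet> (A *v y)"
  \<comment> \<open>The form of \<open>A\<close> on the plane spanned by \<open>x\<close> and \<open>y\<close>.\<close>
  have q: "0 \<le> a * s\<^sup>2 + 2 * b * s * t + c * t\<^sup>2" for s t
  proof -
    have "0 \<le> (s *\<^sub>R x + t *\<^sub>R y) \<bullet> (A *v (s *\<^sub>R x + t *\<^sub>R y))"
      using assms by (simp add: psd_def)
    also have "\<dots> = a * s\<^sup>2 + 2 * b * s * t + c * t\<^sup>2"
      by (simp add: a_def b_def c_def matrix_vector_right_distrib matrix_vector_mult_scaleR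
          inner_add_left inner_add_right sym[of y x] power2_eq_square algebra_simps)
    finally show ?thesis .
  qed
  have ac: "0 \<le> a" "0 \<le> c" using q[of 1 0] q[of 0 1] by auto
  show ?thesis
  proof (cases "c = 0")
    case True
    have "b = 0"
    proof (rule ccontr)
      assume "b \<noteq> 0"
      \<comment> \<open>The form is degenerate in the direction \<open>y\<close>; this point makes its value negative.\<close>
      have "0 \<le> a * b\<^sup>2 + 2 * b * b * (- (a + 1) / 2)"
        using q[of b "- (a + 1) / 2"] True by simp
      also have "\<dots> = - b\<^sup>2" by (simp add: power2_eq_square field_simps)
      finally show False using \<open>b \<noteq> 0\<close> by simp
    qed
    then show ?thesis using True by (simp add: a_def b_def c_def)
  next
    case False
    have "0 \<le> c * (a * c - b\<^sup>2)"
      using q[of c "- b"] by (simp add: power2_eq_square algebra_simps)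
    then show ?thesis using False ac
      by (simp add: zero_le_mult_iff a_def b_def c_def)
  qed
qed

lemma psd_mult_vec_eq_0:
  assumes "psd A" "x \<bullet> (A *v x) = 0"
  shows "A *v x = 0"
  using psd_Cauchy_Schwarz[OF assms(1), of "A *v x" x] assms(2) by simp

text \<open>Cholesky elimination: if \<open>v\<close> is a nonzero column of \<open>A\<close> and \<open>a\<close> its diagonal entry, then
  \<open>A - v v\<^sup>T / a\<close> is again semidefinite by Cauchy-Schwarz, and one more of its columns vanishes. The
  resulting sum of outer products serves as a square root of \<open>A\<close>.\<close>

theorem psd_imp_is_diffusion_matrix:
  assumes "psd A"
  shows "is_diffusion_matrix A"
  using assms
proof (induction "card {j. A *v axis j 1 \<noteq> 0}" arbitrary: A rule: less_induct)
  case less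
  show ?case
  proof (cases "A = 0")
    case True
    then have "A = (\<Sum>j<0::nat. outer_prod (undefined j) (undefined j))" by simp
    then show ?thesis unfolding is_diffusion_matrix_def by blast
  next
    case False
    then obtain i where i: "A *v axis i 1 \<noteq> 0"
      using matrix_eq_zero_iff_mult_axis by blast
    define v where "v = A *v axis i 1"
    define a where "a = axis i 1 \<bullet> v"
    have sym: "x \<bullet> (A *v y) = (A *v x) \<bullet> y" for x y
      using less.prems unfolding psd_def by (metis inner_matrix_vector_transpose)
    have "0 \<le> a" using less.prems by (simp add: psd_def a_def v_def)
    moreover have "a \<noteq> 0"
      using psd_mult_vec_eq_0[OF less.prems] i by (auto simp: a_def v_def)
    ultimately have a: "0 < a" by simp
    define B where "B = A - (1 / a) *\<^sub>R outer_prod v v"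
    have Bx: "B *v x = A *v x - ((v \<bullet> x) / a) *\<^sub>R v" for x
      by (simp add: B_def matrix_vector_mult_diff_rdistrib scaleR_matrix_vector outer_prod_mult_vec)
    have "psd B"
      unfolding psd_def
    proof
      show "transpose B = B"
        using less.prems
        by (simp add: B_def psd_def transpose_diff transpose_scaleR transpose_outer_prod)
      show "\<forall>x. 0 \<le> x \<bullet> (B *v x)"
      proof
        fix x
        have "(x \<bullet> v)\<^sup>2 \<le> (x \<bullet> (A *v x)) * a"
          using psd_Cauchy_Schwarz[OF less.prems, of x "axis i 1"] by (simp add: v_def a_def)
        then show "0 \<le> x \<bullet> (B *v x)"
          using a by (simp add: Bx inner_diff_right inner_commute field_simps power2_eq_square)
      qed
    qed
    moreover have "card {j. B *v axis j 1 \<noteq> 0} < card {j. A *v axis j 1 \<noteq> 0}"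
    proof (rule psubset_card_mono)
      have "B *v axis j 1 = 0" if "A *v axis j 1 = 0" for j
        using that sym[of "axis i 1" "axis j 1"] by (simp add: Bx v_def)
      moreover have "B *v axis i 1 = 0"
        using a by (simp add: Bx v_def[symmetric]) (simp add: a_def inner_commute)
      ultimately show "{j. B *v axis j 1 \<noteq> 0} \<subset> {j. A *v axis j 1 \<noteq> 0}"
        using i by blast
    qed simp
    ultimately have "is_diffusion_matrix B" using less.hyps by blast
    then obtain r s where B: "B = (\<Sum>j<r::nat. outer_prod (s j) (s j))"
      unfolding is_diffusion_matrix_def by blast
    \<comment> \<open>Restore the outer product that was subtracted from \<open>A\<close>.\<close>
    define s' where "s' = s(r := (1 / sqrt a) *\<^sub>R v)"
    have "outer_prod ((1 / sqrt a) *\<^sub>R v) ((1 / sqrt a) *\<^sub>R v) = (1 / a) *\<^sub>R outer_prod v v"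
      using a by (simp add: vec_eq_iff outer_prod_def)
    moreover have "(\<Sum>j<r. outer_prod (s' j) (s' j)) = B"
      unfolding B by (rule sum.cong) (auto simp: s'_def)
    ultimately have "A = (\<Sum>j<Suc r. outer_prod (s' j) (s' j))"
      by (simp add: s'_def B_def)
    then show ?thesis unfolding is_diffusion_matrix_def by blast
  qed
qed

lemma is_diffusion_matrix_imp_psd:
  assumes "is_diffusion_matrix A"
  shows "psd A"
proof -
  obtain r s where A: "A = (\<Sum>j<r::nat. outer_prod (s j) (s j))"
    using assms unfolding is_diffusion_matrix_def by blast
  have "x \<bullet> (A *v x) = (\<Sum>j<r. (s j \<bullet> x)\<^sup>2)" for x
    by (simp add: A sum_matrix_vector outer_prod_mult_vec inner_sum_right power2_eq_square
        inner_commute)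
  then show ?thesis
    by (simp add: psd_def sum_nonneg) (simp add: A transpose_sum transpose_outer_prod)
qed

lemma inner_outer_sandwich:
  "D \<bullet> (outer_prod u u ** D ** outer_prod w w) = (u \<bullet> (D *v w))\<^sup>2"
  for D :: "real^'n^'m"
proof -
  have "outer_prod u u ** D ** outer_prod w w = (u \<bullet> (D *v w)) *\<^sub>R outer_prod u w"
  proof -
    have "(outer_prod u u ** D ** outer_prod w w) *v x = ((u \<bullet> (D *v w)) *\<^sub>R outer_prod u w) *v x" for x
      by (simp add: matrix_vector_mul_assoc[symmetric] outer_prod_mult_vec scaleR_matrix_vector
          matrix_vector_mult_scaleR mult.commute)
    then show ?thesis by (simp add: matrix_eq)
  qed
  moreover have "D \<bullet> outer_prod u w = u \<bullet> (D *v w)"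
    by (simp add: inner_vec_def outer_prod_def matrix_vector_mult_def sum_distrib_left mult_ac)
  ultimately show ?thesis by (simp add: power2_eq_square)
qed

lemma matrix_add_rdistrib: "((A::real^'n^'m) + B) ** C = A ** C + B ** C"
  by (simp add: vec_eq_iff matrix_matrix_mult_def sum.distrib algebra_simps)

lemma matrix_mult_sum_left: "(\<Sum>i\<in>I. A i :: real^'n^'m) ** B = (\<Sum>i\<in>I. A i ** B)"
  by (induction I rule: infinite_finite_induct) (auto simp: matrix_add_rdistrib)

lemma matrix_mult_sum_right: "(B::real^'n^'m) ** (\<Sum>i\<in>I. A i) = (\<Sum>i\<in>I. B ** A i)"
  by (induction I rule: infinite_finite_induct) (auto simp: matrix_add_ldistrib)

text \<open>Expanding \<open>P\<close> and \<open>R\<close> into outer products turns the trace of \<open>D\<^sup>T P D R\<close> into a sum of squares.\<close>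

lemma inner_sandwich_nonneg:
  assumes "psd P" "psd R"
  shows "0 \<le> D \<bullet> (P ** D ** R)"
proof -
  obtain r s where P: "P = (\<Sum>j<r::nat. outer_prod (s j) (s j))"
    using psd_imp_is_diffusion_matrix[OF assms(1)] unfolding is_diffusion_matrix_def by blast
  obtain r' s' where R: "R = (\<Sum>j<r'::nat. outer_prod (s' j) (s' j))"
    using psd_imp_is_diffusion_matrix[OF assms(2)] unfolding is_diffusion_matrix_def by blast
  show ?thesis
    by (simp add: P R matrix_mult_sum_left matrix_mult_sum_right inner_sum_right
        inner_outer_sandwich sum_nonneg)
qed

lemma scaleR_matrix_mult_left: "(c *\<^sub>R (A::real^'n^'m)) ** B = c *\<^sub>R (A ** B)"
  by (simp add: vec_eq_iff matrix_matrix_mult_def sum_distrib_left mult_ac)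

lemma scaleR_matrix_mult_right: "(A::real^'n^'m) ** (c *\<^sub>R B) = c *\<^sub>R (A ** B)"
  by (simp add: vec_eq_iff matrix_matrix_mult_def sum_distrib_left mult_ac)

text \<open>Insert \<open>P = R + e I\<close> on both sides of \<open>D\<close>: the two mixed terms and the term with \<open>R\<close> twice are
  nonnegative, and the term \<open>e\<^sup>2 \<bar>D\<bar>\<^sup>2\<close> remains.\<close>

lemma inner_sandwich_ge:
  assumes P: "psd (P - e *\<^sub>R mat 1)" and e: "0 \<le> e"
  shows "e\<^sup>2 * (norm D)\<^sup>2 \<le> D \<bullet> (P ** D ** P)"
proof -
  define R where "R = P - e *\<^sub>R mat 1"
  have PR: "P = R + e *\<^sub>R mat 1" by (simp add: R_def)
  have one: "psd (mat 1 :: real^'n^'n)" by (simp add: psd_def transpose_mat)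
  have R: "psd R" using P by (simp add: R_def)
  have "D \<bullet> (P ** D ** P) = D \<bullet> (R ** D ** R) + e * (D \<bullet> (mat 1 ** D ** R))
     + e * (D \<bullet> (R ** D ** mat 1)) + e\<^sup>2 * (D \<bullet> D)"
    by (simp add: PR matrix_add_ldistrib matrix_add_rdistrib scaleR_matrix_mult_left
       scaleR_matrix_mult_right inner_add_right power2_eq_square algebra_simps)
  moreover have "0 \<le> D \<bullet> (R ** D ** R)" "0 \<le> e * (D \<bullet> (mat 1 ** D ** R))"
      "0 \<le> e * (D \<bullet> (R ** D ** mat 1))"
    using inner_sandwich_nonneg R one e by (auto intro!: mult_nonneg_nonneg simp del: matrix_mul_lid matrix_mul_rid)
  ultimately show ?thesis by (simp add: power2_norm_eq_inner)
qed

lemma pos_def_imp_psd: "pos_def A \<Longrightarrow> psd A"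
  unfolding pos_def_def psd_def by (metis inner_zero_left less_eq_real_def)

lemma pos_def_imp_invertible:
  assumes "pos_def A"
  shows "invertible A"
proof -
  have "x = 0" if "A *v x = 0" for x
    using assms that unfolding pos_def_def by (metis inner_zero_right less_irrefl)
  then show ?thesis
    using invertible_left_inverse matrix_left_invertible_ker by blast
qed

lemma psd_invertible_imp_pos_def:
  assumes "psd A" "invertible A"
  shows "pos_def A"
  unfolding pos_def_def
proof (intro conjI allI impI)
  show "transpose A = A" using assms(1) by (simp add: psd_def)
  fix x :: "real^'a" assume "x \<noteq> 0"
  then have "A *v x \<noteq> 0"
    using assms(2) invertible_left_inverse matrix_left_invertible_ker by blast
  then have "x \<bullet> (A *v x) \<noteq> 0" using psd_mult_vec_eq_0[OF assms(1)] by blast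
  then show "0 < x \<bullet> (A *v x)" using assms(1) unfolding psd_def
    by (metis less_eq_real_def)
qed

lemma pos_def_convex_combination:
  assumes "pos_def A" "pos_def B" "0 \<le> s" "s \<le> 1"
  shows "pos_def (B + s *\<^sub>R (A - B))"
  unfolding pos_def_def
proof (intro conjI allI impI)
  show "transpose (B + s *\<^sub>R (A - B)) = B + s *\<^sub>R (A - B)"
    using assms by (simp add: pos_def_def transpose_add transpose_diff transpose_scaleR)
  fix x :: "real^'a" assume "x \<noteq> 0"
  then have pos: "0 < x \<bullet> (A *v x)" "0 < x \<bullet> (B *v x)"
    using assms by (auto simp: pos_def_def)
  have "x \<bullet> ((B + s *\<^sub>R (A - B)) *v x) = (1 - s) * (x \<bullet> (B *v x)) + s * (x \<bullet> (A *v x))"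
    by (simp add: matrix_vector_mult_add_rdistrib matrix_vector_mult_diff_rdistrib
        scaleR_matrix_vector inner_add_right inner_diff_right algebra_simps)
  also have "\<dots> > 0"
    using assms(3,4) pos by (cases "s = 0")
      (auto intro!: add_nonneg_pos mult_nonneg_nonneg mult_pos_pos)
  finally show "0 < x \<bullet> ((B + s *\<^sub>R (A - B)) *v x)" .
qed

lemma matrix_inv_mult:
  assumes "invertible (A :: real^'n^'n)"
  shows "A ** matrix_inv A = mat 1" "matrix_inv A ** A = mat 1"
  using someI_ex[of "\<lambda>A'. A ** A' = mat 1 \<and> A' ** A = mat 1"] assms
  unfolding matrix_inv_def invertible_def by auto

lemma transpose_matrix_inv:
  assumes "invertible (A :: real^'n^'n)" "transpose A = A"
  shows "transpose (matrix_inv A) = matrix_inv A"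
proof -
  have "transpose (matrix_inv A) ** A = mat 1"
    using arg_cong[OF matrix_inv_mult(1)[OF assms(1)], of transpose] assms(2)
    by (simp add: matrix_transpose_mul transpose_mat)
  then show ?thesis
    by (metis assms(1) matrix_inv_mult(1) matrix_mul_assoc matrix_mul_lid matrix_mul_rid)
qed

text \<open>The eigenvalues of \<open>A\<close> are at most \<open>R\<close>, those of its inverse at least \<open>1 / R\<close>. Without eigenvalues:
  for \<open>x = A y\<close>, Cauchy-Schwarz for the form of \<open>A\<close> bounds \<open>\<bar>x\<bar>\<^sup>4 = (A y \<bullet> A y)\<^sup>2\<close> by
  \<open>(x \<bullet> A x) (y \<bullet> x)\<close>, and the first factor is at most \<open>R \<bar>x\<bar>\<^sup>2\<close>.\<close>

lemma psd_matrix_inv_minus: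
  assumes A: "pos_def A" and R: "0 < R" "norm A \<le> R"
  shows "psd (matrix_inv A - (1 / R) *\<^sub>R mat 1)"
  unfolding psd_def
proof (intro conjI allI)
  have inv: "invertible A" using A by (rule pos_def_imp_invertible)
  have sym: "transpose A = A" using A by (simp add: pos_def_def)
  show "transpose (matrix_inv A - (1 / R) *\<^sub>R mat 1) = matrix_inv A - (1 / R) *\<^sub>R mat 1"
    using transpose_matrix_inv[OF inv sym] by (simp add: transpose_diff transpose_scaleR transpose_mat)
  fix x
  define y where "y = matrix_inv A *v x"
  have x: "x = A *v y" by (simp add: y_def matrix_vector_mul_assoc matrix_inv_mult[OF inv])
  have "((norm x)\<^sup>2)\<^sup>2 = ((A *v y) \<bullet> (A *v y))\<^sup>2"
    by (simp add: x power2_norm_eq_inner)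
  also have "\<dots> \<le> ((A *v y) \<bullet> (A *v (A *v y))) * (y \<bullet> (A *v y))"
    using psd_Cauchy_Schwarz[OF pos_def_imp_psd[OF A]] .
  also have "\<dots> \<le> (R * (norm x)\<^sup>2) * (y \<bullet> x)"
  proof (rule mult_mono)
    have "(A *v y) \<bullet> (A *v (A *v y)) \<le> norm x * norm (A *v x)"
      unfolding x by (rule norm_cauchy_schwarz)
    also have "\<dots> \<le> norm x * (R * norm x)"
      using order_trans[OF norm_matrix_vector_mult_le[of A x] mult_right_mono[OF R(2), of "norm x"]]
      by (intro mult_left_mono) auto
    finally show "(A *v y) \<bullet> (A *v (A *v y)) \<le> R * (norm x)\<^sup>2"
      by (simp add: power2_eq_square mult_ac)
  qed (use R pos_def_imp_psd[OF A] in \<open>auto simp: x psd_def\<close>)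
  finally have "(norm x)\<^sup>2 * (norm x)\<^sup>2 \<le> (norm x)\<^sup>2 * (R * (y \<bullet> x))"
    by (simp add: power2_eq_square mult_ac)
  then have "(norm x)\<^sup>2 \<le> R * (y \<bullet> x)"
    using mult_left_le_imp_le[of "(norm x)\<^sup>2" "(norm x)\<^sup>2" "R * (y \<bullet> x)"]
    by (cases "x = 0") auto
  then show "0 \<le> x \<bullet> ((matrix_inv A - (1 / R) *\<^sub>R mat 1) *v x)"
    using R by (simp add: matrix_vector_mult_diff_rdistrib scaleR_matrix_vector y_def[symmetric]
       inner_diff_right power2_norm_eq_inner inner_commute field_simps)
qed

text \<open>Cramer's rule exhibits the inverse as a continuous function of the entries.\<close>

lemma matrix_inv_component:
  assumes "invertible (A :: real^'n^'n)"
  shows "matrix_inv A $ k $ l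
    = det (\<chi> i j. if j = k then (axis l 1 :: real^'n) $ i else A $ i $ j) / det A"
proof -
  have eq: "A *v (matrix_inv A *v axis l 1) = axis l 1"
    by (simp add: matrix_vector_mul_assoc matrix_inv_mult[OF assms])
  then show ?thesis
    using cramer_lemma[of k A "matrix_inv A *v axis l 1", unfolded eq] assms
    by (simp add: invertible_det_nz matrix_vector_mult_axis_nth)
qed

lemma continuous_on_matrixI:
  fixes f :: "'a::topological_space \<Rightarrow> real^'n^'m"
  assumes "\<And>i j. continuous_on S (\<lambda>x. f x $ i $ j)"
  shows "continuous_on S f"
proof -
  have "continuous_on S (\<lambda>x. \<chi> i j. f x $ i $ j)"
    by (intro continuous_on_vec_lambda assms)
  then show ?thesis by (simp add: vec_lambda_eta)
qed

lemma continuous_on_det: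
  fixes f :: "'a::topological_space \<Rightarrow> real^'n^'n"
  assumes "continuous_on S f"
  shows "continuous_on S (\<lambda>x. det (f x))"
  unfolding det_def by (intro continuous_intros assms)

lemma continuous_on_matrix_inv:
  fixes f :: "'a::topological_space \<Rightarrow> real^'n^'n"
  assumes f: "continuous_on S f" and inv: "\<And>x. x \<in> S \<Longrightarrow> invertible (f x)"
  shows "continuous_on S (\<lambda>x. matrix_inv (f x))"
proof (rule continuous_on_matrixI)
  fix k l
  have "continuous_on S (\<lambda>x. det (\<chi> i j. if j = k then (axis l 1 :: real^'n) $ i else f x $ i $ j)
     / det (f x))"
  proof (intro continuous_on_divide continuous_on_det f continuous_on_vec_lambda)
    fix i j
    show "continuous_on S (\<lambda>x. if j = k then (axis l 1 :: real^'n) $ i else f x $ i $ j)"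
      by (cases "j = k") (auto intro!: continuous_intros f)
  qed (use inv in \<open>auto simp: invertible_det_nz\<close>)
  then show "continuous_on S (\<lambda>x. matrix_inv (f x) $ k $ l)"
    by (subst continuous_on_cong[OF refl matrix_inv_component[OF inv]]) auto
qed

lemma continuous_on_matrix_mult:
  fixes f :: "'a::topological_space \<Rightarrow> real^'n^'m" and g :: "'a \<Rightarrow> real^'l^'n"
  assumes "continuous_on S f" "continuous_on S g"
  shows "continuous_on S (\<lambda>x. f x ** g x)"
  unfolding matrix_matrix_mult_def by (intro continuous_intros assms continuous_on_vec_lambda)

lemma continuous_on_transpose:
  fixes f :: "'a::topological_space \<Rightarrow> real^'n^'m"
  assumes "continuous_on S f"
  shows "continuous_on S (\<lambda>x. transpose (f x))"
  unfolding transpose_def by (intro continuous_intros assms continuous_on_vec_lambda)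

section \<open>The contrast as an integrated quadratic form\<close>

lemma matrix_component_inner: "(A :: real^'n^'m) \<bullet> B = (\<Sum>i\<in>UNIV. \<Sum>j\<in>UNIV. A $ i $ j * B $ i $ j)"
  by (simp add: inner_vec_def)

lemma inner_vec_of: "vec_of A \<bullet> vec_of B = A \<bullet> (B :: real^'n^'m)"
proof -
  have "vec_of A \<bullet> vec_of B = (\<Sum>(j, i)\<in>UNIV \<times> UNIV. A $ i $ j * B $ i $ j)"
    by (simp add: inner_vec_def vec_of_def case_prod_beta)
  also have "\<dots> = (\<Sum>j\<in>UNIV. \<Sum>i\<in>UNIV. A $ i $ j * B $ i $ j)"
    by (rule sum.cartesian_product[symmetric])
  also have "\<dots> = A \<bullet> B"
    unfolding matrix_component_inner by (rule sum.swap)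
  finally show ?thesis .
qed

lemma norm_vec_of: "norm (vec_of A) = norm A"
  by (simp add: norm_eq_sqrt_inner inner_vec_of)

text \<open>The classical identity \<open>(A \<otimes> B) vec D = vec (B D A\<^sup>T)\<close>.\<close>

lemma kron_mult_vec_of:
  fixes A :: "real^'b^'a" and B :: "real^'d^'c" and D :: "real^'b^'d"
  shows "kron A B *v vec_of D = vec_of (B ** D ** transpose A)"
proof (simp only: vec_eq_iff, rule allI)
  fix r :: "'a \<times> 'c"
  have "(kron A B *v vec_of D) $ r
    = (\<Sum>(k, l)\<in>UNIV \<times> UNIV. A $ fst r $ k * B $ snd r $ l * D $ l $ k)"
    by (simp add: matrix_vector_mult_def kron_def vec_of_def case_prod_beta)
  also have "\<dots> = (\<Sum>k\<in>UNIV. \<Sum>l\<in>UNIV. A $ fst r $ k * B $ snd r $ l * D $ l $ k)"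
    by (rule sum.cartesian_product[symmetric])
  also have "\<dots> = vec_of (B ** D ** transpose A) $ r"
    by (simp add: vec_of_def matrix_matrix_mult_def transpose_def sum_distrib_left
        sum_distrib_right mult_ac)
  finally show "(kron A B *v vec_of D) $ r = vec_of (B ** D ** transpose A) $ r" .
qed

lemma vech_diff:
  assumes "transpose A = A" "transpose B = (B :: real^'n^'n)"
  shows "vech A - vech B = vech (A - B)"
proof -
  have "(vech A - vech B) $ u = vech (A - B) $ u" for u
    using assms by (cases u) (simp add: vech_symmetric transpose_diff)
  then show ?thesis by (simp add: vec_eq_iff)
qed

lemma continuous_on_vech: "continuous_on {A :: real^'n^'n. transpose A = A} vech"
proof -
  have "continuous_on {A :: real^'n^'n. transpose A = A} (\<lambda>A. vech A $ u)" for u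
  proof (cases u)
    case (Upair i j)
    have "continuous_on {A :: real^'n^'n. transpose A = A} (\<lambda>A. A $ i $ j)"
      by (intro continuous_intros)
    then show ?thesis
      using Upair by (subst continuous_on_cong[OF refl, of _ _ "\<lambda>A. A $ i $ j"])
        (auto simp: vech_symmetric)
  qed
  then have "continuous_on {A :: real^'n^'n. transpose A = A} (\<lambda>A. \<chi> u. vech A $ u)"
    by (intro continuous_on_vec_lambda)
  then show ?thesis by (simp add: vec_lambda_eta)
qed

text \<open>Passing to \<open>vech\<close> loses at most a constant factor, as \<open>vec\<close> preserves the norm and is recovered
  from \<open>vech\<close> by the duplication matrix.\<close>

lemma norm_le_norm_vech:
  assumes "transpose A = (A :: real^'n^'n)"
  shows "norm A \<le> norm (duplication :: real^('n uprod)^('n \<times> 'n)) * norm (vech A)"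
  using norm_matrix_vector_mult_le[of duplication "vech A"]
  by (simp add: vec_of_eq_duplication_vech[OF assms, symmetric] norm_vec_of)

lemma bounded_linear_iterated_integral:
  fixes f :: "real \<Rightarrow> real \<Rightarrow> 'a::banach"
  assumes f: "continuous_on ({a..b} \<times> {c..d}) (\<lambda>(s, t). f s t)" and h: "bounded_linear h"
  shows "h (integral {a..b} (\<lambda>s. integral {c..d} (\<lambda>t. f s t)))
       = integral {a..b} (\<lambda>s. integral {c..d} (\<lambda>t. h (f s t)))"
proof -
  have "continuous_on {a..b} (\<lambda>s. integral {c..d} (f s))"
    using integral_continuous_on_param[of "{a..b}" c d f] f by (simp add: box_real)
  then have "(\<lambda>s. integral {c..d} (f s)) integrable_on {a..b}"
    by (rule integrable_continuous_interval)
  from integral_linear[OF this h]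
  have "h (integral {a..b} (\<lambda>s. integral {c..d} (f s)))
      = integral {a..b} (\<lambda>s. h (integral {c..d} (f s)))"
    by (simp add: o_def)
  also have "\<dots> = integral {a..b} (\<lambda>s. integral {c..d} (\<lambda>t. h (f s t)))"
  proof (rule integral_cong)
    fix s assume s: "s \<in> {a..b}"
    have "continuous_on {c..d} (\<lambda>t. (\<lambda>(s, t). f s t) (s, t))"
      by (rule continuous_on_compose2[OF f]) (use s in \<open>auto intro!: continuous_intros\<close>)
    then have "f s integrable_on {c..d}"
      by (intro integrable_continuous_interval) simp
    from integral_linear[OF this h]
    show "h (integral {c..d} (f s)) = integral {c..d} (\<lambda>t. h (f s t))"
      by (simp add: o_def)
  qed
  finally show ?thesis .
qed

lemma contrast_eq_inner_vec_of:
  assumes Q: "pos_def Q" and S: "pos_def S"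
  shows "contrast Q S =
    vec_of (Q - S) \<bullet>
      (integral {0..1} (\<lambda>l2. integral {0..1} (\<lambda>l1.
         l2 *\<^sub>R kron (matrix_inv (S + (l1 * l2) *\<^sub>R (Q - S)))
                   (matrix_inv (S + (l1 * l2) *\<^sub>R (Q - S))))) *v vec_of (Q - S))"
proof -
  have sym: "transpose Q = Q" "transpose S = S" "transpose (Q - S) = Q - S"
    using Q S by (auto simp: pos_def_def transpose_diff)
  have "v \<bullet> ((transpose duplication ** N ** duplication) *v v)
      = (duplication *v v) \<bullet> (N *v (duplication *v v))" for v and N :: "real^('a \<times> 'a)^('a \<times> 'a)"
    unfolding matrix_vector_mul_assoc[symmetric]
    by (subst inner_matrix_vector_transpose) (simp only: transpose_transpose)
  then show ?thesis
    unfolding contrast_def V_tilde_def V_mat_def vech_diff[OF sym(1,2)]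
    by (simp only: pos_def_imp_invertible[OF Q] if_True vec_of_eq_duplication_vech[OF sym(3)])
qed

lemma pos_def_path:
  assumes "pos_def Q" "pos_def S" "s \<in> {0..1}" "t \<in> {0..1}"
  shows "pos_def (S + (s * t) *\<^sub>R (Q - S))"
  by (rule pos_def_convex_combination) (use assms in \<open>auto intro: mult_le_one\<close>)

text \<open>For symmetric matrices this is the trace of \<open>P D P D\<close>, where \<open>D = Q - S\<close> and \<open>P\<close> is the
  inverse at the point \<open>s\<close> of the segment from \<open>S\<close> to \<open>Q\<close>.\<close>

definition sandwich :: "real^'n^'n \<Rightarrow> real^'n^'n \<Rightarrow> real \<Rightarrow> real" where
  "sandwich Q S s =
     (Q - S) \<bullet> (matrix_inv (S + s *\<^sub>R (Q - S)) ** (Q - S) ** matrix_inv (S + s *\<^sub>R (Q - S)))"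

text \<open>The duplication matrix turns \<open>vech\<close> into \<open>vec\<close>, the Kronecker square of \<open>P\<close> acts as \<open>D \<mapsto> P D P\<close>, and
  evaluating the quadratic form is linear in the matrix and so commutes with both integrals.\<close>

lemma contrast_eq_integral:
  assumes Q: "pos_def Q" and S: "pos_def S"
  shows "contrast Q S =
    integral {0..1} (\<lambda>l2. integral {0..1} (\<lambda>l1. l2 * sandwich Q S (l1 * l2)))"
proof -
  let ?P = "\<lambda>l2 l1. matrix_inv (S + (l1 * l2) *\<^sub>R (Q - S))"
  let ?f = "\<lambda>l2 l1. l2 *\<^sub>R kron (?P l2 l1) (?P l2 l1)"
  let ?v = "vec_of (Q - S)"
  have inv: "invertible (S + (s * t) *\<^sub>R (Q - S))" "transpose (S + (s * t) *\<^sub>R (Q - S)) = S + (s * t) *\<^sub>R (Q - S)"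
    if "s \<in> {0..1}" "t \<in> {0..1}" for s t
    using pos_def_imp_invertible[OF pos_def_path[OF assms that]] pos_def_path[OF assms that]
    unfolding pos_def_def by auto
  have "continuous_on ({0..1} \<times> {0..1}) (\<lambda>(l2, l1). ?P l2 l1)"
    unfolding case_prod_beta
    by (intro continuous_on_matrix_inv continuous_intros inv) auto
  then have "continuous_on ({0..1} \<times> {0..1}) (\<lambda>(l2, l1). ?f l2 l1)"
    unfolding case_prod_beta
    by (intro continuous_on_matrixI) (auto simp: kron_def intro!: continuous_intros)
  moreover have "bounded_linear (\<lambda>M. ?v \<bullet> (M *v ?v))"
    by (auto intro!: linear_conv_bounded_linear[THEN iffD1] linearI
      simp: matrix_vector_mult_add_rdistrib inner_add_right scaleR_matrix_vector)
  ultimately have "contrast Q S = integral {0..1} (\<lambda>l2. integral {0..1} (\<lambda>l1. ?v \<bullet> (?f l2 l1 *v ?v)))"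
    unfolding contrast_eq_inner_vec_of[OF assms] by (rule bounded_linear_iterated_integral)
  also have "\<dots> = integral {0..1} (\<lambda>l2. integral {0..1} (\<lambda>l1. l2 * sandwich Q S (l1 * l2)))"
    by (intro integral_cong)
      (simp add: scaleR_matrix_vector kron_mult_vec_of inner_vec_of sandwich_def
         transpose_matrix_inv[OF inv])
  finally show ?thesis .
qed

lemma continuous_on_sandwich:
  fixes q s :: "'a::topological_space \<Rightarrow> real^'n^'n"
  assumes "continuous_on U q" "continuous_on U s" "continuous_on U t"
    and "\<And>x. x \<in> U \<Longrightarrow> pos_def (q x)" "\<And>x. x \<in> U \<Longrightarrow> pos_def (s x)"
    and "\<And>x. x \<in> U \<Longrightarrow> 0 \<le> t x" "\<And>x. x \<in> U \<Longrightarrow> t x \<le> 1"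
  shows "continuous_on U (\<lambda>x. sandwich (q x) (s x) (t x))"
  unfolding sandwich_def
  by (intro continuous_intros continuous_on_matrix_mult continuous_on_matrix_inv assms
      pos_def_imp_invertible pos_def_convex_combination)

lemma continuous_on_contrast_pos_def:
  "continuous_on ({Q. pos_def Q} \<times> {S. pos_def S}) (\<lambda>(Q, S). contrast Q (S :: real^'n^'n))"
proof -
  let ?U = "{Q. pos_def (Q :: real^'n^'n)} \<times> {S. pos_def (S :: real^'n^'n)}"
  have "continuous_on ((?U \<times> {0..1}) \<times> cbox 0 1)
     (\<lambda>(z, l1). snd z * sandwich (fst (fst z)) (snd (fst z)) (l1 * snd z))"
    unfolding case_prod_beta
    by (intro continuous_intros continuous_on_sandwich) (auto intro: mult_le_one)
  then have "continuous_on (?U \<times> {0..1})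
     (\<lambda>z. integral (cbox 0 1) (\<lambda>l1. snd z * sandwich (fst (fst z)) (snd (fst z)) (l1 * snd z)))"
    by (rule integral_continuous_on_param)
  then have "continuous_on (?U \<times> cbox 0 1)
     (\<lambda>(z, l2). integral {0..1} (\<lambda>l1. l2 * sandwich (fst z) (snd z) (l1 * l2)))"
    by (simp add: case_prod_beta box_real)
  then have "continuous_on ?U (\<lambda>z. integral (cbox 0 1) (\<lambda>l2. integral {0..1} (\<lambda>l1. l2 * sandwich (fst z) (snd z) (l1 * l2))))"
    by (rule integral_continuous_on_param)
  then show ?thesis
    by (rule continuous_on_eq) (auto simp: contrast_eq_integral box_real)
qed

lemma contrast_singular:
  assumes "\<not> invertible Q"
  shows "contrast Q S = (norm (vech Q - vech S))\<^sup>2"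
  using assms by (simp add: contrast_def V_tilde_def power2_norm_eq_inner)

lemma continuous_on_contrast_singular:
  "continuous_on ({Q. psd Q \<and> \<not> invertible Q} \<times> {S. pos_def S}) (\<lambda>(Q, S). contrast Q (S :: real^'n^'n))"
proof -
  let ?U = "{Q :: real^'n^'n. psd Q \<and> \<not> invertible Q} \<times> {S. pos_def (S :: real^'n^'n)}"
  have "continuous_on ?U (\<lambda>z. (norm (vech (fst z) - vech (snd z)))\<^sup>2)"
    by (intro continuous_intros continuous_on_compose2[OF continuous_on_vech])
       (auto simp: psd_def pos_def_def)
  then show ?thesis
    by (rule continuous_on_eq) (auto simp: contrast_singular)
qed

text \<open>As a function of its first argument the contrast jumps where that argument becomes singular; as a
  function of the second it is continuous in either case.\<close>

lemma continuous_on_contrast: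
  assumes "psd (Q :: real^'n^'n)"
  shows "continuous_on {S. pos_def S} (contrast Q)"
proof (cases "invertible Q")
  case True
  then have "pos_def Q" using assms psd_invertible_imp_pos_def by blast
  then have "continuous_on {S. pos_def S} (\<lambda>S. (\<lambda>(Q, S). contrast Q S) (Q, S))"
    by (intro continuous_on_compose2[OF continuous_on_contrast_pos_def]) (auto intro!: continuous_intros)
  then show ?thesis by simp
next
  case False
  then have "continuous_on {S. pos_def S} (\<lambda>S. (\<lambda>(Q, S). contrast Q S) (Q, S))"
    using assms by (intro continuous_on_compose2[OF continuous_on_contrast_singular]) (auto intro!: continuous_intros)
  then show ?thesis by simp
qed

lemma closed_psd: "closed {A :: real^'n^'n. psd A}"
  unfolding psd_def
  by (intro closed_Collect_conj closed_Collect_all closed_Collect_eq closed_Collect_le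
      continuous_intros continuous_on_transpose linear_continuous_on
      linear_conv_bounded_linear[THEN iffD1])
     (auto intro!: linearI simp: matrix_vector_mult_add_rdistrib scaleR_matrix_vector)

lemma open_invertible: "open {A :: real^'n^'n. invertible A}"
  unfolding invertible_det_nz by (intro open_Collect_neq continuous_on_det continuous_intros)

text \<open>The regular and the singular semidefinite matrices are two Borel sets, and the contrast is continuous
  on each of them.\<close>

lemma borel_measurable_contrast:
  fixes S :: "real^'n^'n" and Z :: "'a \<Rightarrow> real^'n^'n"
  assumes S: "pos_def S" and Z: "Z \<in> borel_measurable M" "\<And>\<omega>. \<omega> \<in> space M \<Longrightarrow> psd (Z \<omega>)"
  shows "(\<lambda>\<omega>. contrast (Z \<omega>) S) \<in> borel_measurable M"
proof -
  let ?P = "{Q :: real^'n^'n. pos_def Q}" and ?N = "{Q :: real^'n^'n. psd Q \<and> \<not> invertible Q}"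
  have iff: "pos_def Q \<longleftrightarrow> psd Q \<and> invertible Q" for Q :: "real^'n^'n"
    using psd_invertible_imp_pos_def pos_def_imp_psd pos_def_imp_invertible by blast
  then have P: "?P = {Q. psd Q} \<inter> {Q. invertible Q}" by auto
  have N: "?N = {Q. psd Q} - {Q. invertible Q}" by auto
  have sets: "?P \<in> sets borel" "?N \<in> sets borel"
    unfolding P N using borel_closed[OF closed_psd] borel_open[OF open_invertible] by auto
  have c: "continuous_on ?P (\<lambda>Q. (\<lambda>(Q, S). contrast Q S) (Q, S))"
      "continuous_on ?N (\<lambda>Q. (\<lambda>(Q, S). contrast Q S) (Q, S))"
    using S by (intro continuous_on_compose2[OF continuous_on_contrast_pos_def]
       continuous_on_compose2[OF continuous_on_contrast_singular]; auto intro!: continuous_intros)+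
  have meas: "(\<lambda>Q. indicator ?P Q *\<^sub>R contrast Q S + indicator ?N Q *\<^sub>R contrast Q S) \<in> borel_measurable borel"
    using c sets by (intro borel_measurable_add borel_measurable_continuous_on_indicator) auto
  have "(\<lambda>\<omega>. indicator ?P (Z \<omega>) *\<^sub>R contrast (Z \<omega>) S + indicator ?N (Z \<omega>) *\<^sub>R contrast (Z \<omega>) S) \<in> borel_measurable M"
    using measurable_compose[OF Z(1) meas] .
  also have "?this \<longleftrightarrow> ?thesis"
    using Z(2) by (intro measurable_cong) (simp add: iff indicator_def)
  finally show ?thesis .
qed

text \<open>By convexity of the norm the whole segment lies in the ball of radius \<open>R\<close>, so the integrand is at
  least \<open>\<bar>Q - S\<bar>\<^sup>2 / R\<^sup>2\<close>; the weight \<open>l2\<close> has integral \<open>1 / 2\<close>.\<close>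

lemma contrast_ge_pos_def:
  assumes Q: "pos_def Q" and S: "pos_def S" and R: "0 < R" "norm Q \<le> R" "norm S \<le> R"
  shows "(norm (Q - S))\<^sup>2 / (2 * R\<^sup>2) \<le> contrast Q S"
proof -
  define c where "c = (norm (Q - S))\<^sup>2 / R\<^sup>2"
  have ge: "c \<le> sandwich Q S s" if "0 \<le> s" "s \<le> 1" for s
  proof -
    let ?A = "S + s *\<^sub>R (Q - S)"
    have A: "pos_def ?A" by (intro pos_def_convex_combination Q S that)
    have "?A = (1 - s) *\<^sub>R S + s *\<^sub>R Q" by (simp add: algebra_simps)
    then have "norm ?A \<le> (1 - s) * norm S + s * norm Q"
      using that norm_triangle_ineq[of "(1 - s) *\<^sub>R S" "s *\<^sub>R Q"] by simp
    also have "\<dots> \<le> (1 - s) * R + s * R"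
      using that R by (intro add_mono mult_left_mono) auto
    finally have "norm ?A \<le> R" by (simp add: algebra_simps)
    then show ?thesis
      using inner_sandwich_ge[OF psd_matrix_inv_minus[OF A R(1)], of "Q - S"] R(1)
      by (simp add: sandwich_def c_def power_divide)
  qed
  have cont: "continuous_on ({0..1} \<times> {0..1}) (\<lambda>z. fst z * sandwich Q S (snd z * fst z))"
    by (intro continuous_intros continuous_on_sandwich Q S) (auto intro: mult_le_one)
  have "((\<lambda>l2. l2 * c) has_integral (1 / 2 * c)) {0..1::real}"
    using ident_has_integral[of 0 "1::real"] by (intro has_integral_mult_left) simp
  then have half: "integral {0..1} (\<lambda>l2::real. l2 * c) = c / 2"
    by (simp add: integral_unique)
  have "integral {0..1} (\<lambda>l2. l2 * c) \<le> integral {0..1} (\<lambda>l2. integral {0..1} (\<lambda>l1. l2 * sandwich Q S (l1 * l2)))"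
  proof (rule integral_le)
    show "(\<lambda>l2. l2 * c) integrable_on {0..1::real}"
      by (intro integrable_continuous_interval continuous_intros)
    show "(\<lambda>l2. integral {0..1} (\<lambda>l1. l2 * sandwich Q S (l1 * l2))) integrable_on {0..1}"
      using integral_continuous_on_param[of "{0..1}" 0 1 "\<lambda>l2 l1. l2 * sandwich Q S (l1 * l2)"] cont
      by (intro integrable_continuous_interval) (simp add: box_real case_prod_beta)
    fix l2 :: real assume l2: "l2 \<in> {0..1}"
    have "continuous_on {0..1} (\<lambda>l1. (\<lambda>z. fst z * sandwich Q S (snd z * fst z)) (l2, l1))"
      by (rule continuous_on_compose2[OF cont]) (use l2 in \<open>auto intro!: continuous_intros\<close>)
    then have "integral {0..1} (\<lambda>l1::real. l2 * c) \<le> integral {0..1} (\<lambda>l1. l2 * sandwich Q S (l1 * l2))"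
      using l2 by (intro integral_le integrable_continuous_interval mult_left_mono ge)
        (auto intro: mult_le_one)
    then show "l2 * c \<le> integral {0..1} (\<lambda>l1. l2 * sandwich Q S (l1 * l2))" by simp
  qed
  then show ?thesis
    unfolding contrast_eq_integral[OF Q S] half by (simp add: c_def mult.commute)
qed

text \<open>In the singular case the contrast is \<open>\<bar>vech Q - vech S\<bar>\<^sup>2\<close>, which is comparable to \<open>\<bar>Q - S\<bar>\<^sup>2\<close>; the
  constant \<open>c\<close> is the worse of the two cases.\<close>

lemma contrast_ge:
  assumes R: "0 < R"
  obtains c where "0 < c"
    "\<And>Q S :: real^'n^'n. psd Q \<Longrightarrow> pos_def S \<Longrightarrow> norm Q \<le> R \<Longrightarrow> norm S \<le> R \<Longrightarrow>
       c * (norm (Q - S))\<^sup>2 \<le> contrast Q S"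
proof
  define d where "d = norm (duplication :: real^('n uprod)^('n \<times> 'n)) + 1"
  define c where "c = min (1 / (2 * R\<^sup>2)) (1 / d\<^sup>2)"
  have d: "0 < d" by (simp add: d_def add_nonneg_pos)
  show "0 < c" using R d by (simp add: c_def)
  fix Q S :: "real^'n^'n"
  assume Q: "psd Q" "norm Q \<le> R" and S: "pos_def S" "norm S \<le> R"
  show "c * (norm (Q - S))\<^sup>2 \<le> contrast Q S"
  proof (cases "invertible Q")
    case True
    have "c * (norm (Q - S))\<^sup>2 \<le> 1 / (2 * R\<^sup>2) * (norm (Q - S))\<^sup>2"
      by (intro mult_right_mono) (auto simp: c_def)
    also have "\<dots> \<le> contrast Q S"
      using contrast_ge_pos_def[OF psd_invertible_imp_pos_def[OF Q(1) True] S(1) R Q(2) S(2)] by simp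
    finally show ?thesis .
  next
    case False
    have sym: "transpose Q = Q" "transpose S = S" "transpose (Q - S) = Q - S"
      using Q S by (auto simp: psd_def pos_def_def transpose_diff)
    have "norm (Q - S) \<le> d * norm (vech Q - vech S)"
      using norm_le_norm_vech[OF sym(3)] 
      by (simp add: vech_diff[OF sym(1,2)] d_def distrib_right add_increasing2)
    then have "(norm (Q - S))\<^sup>2 \<le> d\<^sup>2 * (norm (vech Q - vech S))\<^sup>2"
      by (metis norm_ge_zero power_mono power_mult_distrib)
    then have "1 / d\<^sup>2 * (norm (Q - S))\<^sup>2 \<le> contrast Q S"
      using d by (simp add: contrast_singular[OF False] field_simps)
    moreover have "c * (norm (Q - S))\<^sup>2 \<le> 1 / d\<^sup>2 * (norm (Q - S))\<^sup>2"
      by (intro mult_right_mono) (auto simp: c_def)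
    ultimately show ?thesis by linarith
  qed
qed

lemma contrast_nonneg:
  assumes "psd Q" "pos_def S"
  shows "0 \<le> contrast Q (S :: real^'n^'n)"
proof -
  have R: "0 < norm Q + norm S + 1" by (simp add: add_nonneg_pos)
  obtain c where c: "0 < c" and ge: "\<And>Q' S' :: real^'n^'n. psd Q' \<Longrightarrow> pos_def S' \<Longrightarrow>
      norm Q' \<le> norm Q + norm S + 1 \<Longrightarrow> norm S' \<le> norm Q + norm S + 1 \<Longrightarrow>
      c * (norm (Q' - S'))\<^sup>2 \<le> contrast Q' S'"
    by (rule contrast_ge[OF R]) (rule that, assumption, assumption)
  have "0 \<le> c * (norm (Q - S))\<^sup>2" using c by simp
  also have "\<dots> \<le> contrast Q S" by (rule ge) (use assms in auto)
  finally show ?thesis .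
qed

section \<open>The covariance structure\<close>

definition stack :: "real^'k^'m \<Rightarrow> real^'k^'n \<Rightarrow> real^'k^('m + 'n)" where
  "stack A B = (\<chi> a. case a of Inl i \<Rightarrow> A $ i | Inr j \<Rightarrow> B $ j)"

lemma stack_nth [simp]: "stack A B $ Inl i = A $ i" "stack A B $ Inr j = B $ j"
  by (simp_all add: stack_def)

lemma stack_vector_mult_nth:
  "(stack A B *v x) $ Inl i = (A *v x) $ i" "(stack A B *v x) $ Inr j = (B *v x) $ j"
  by (simp_all add: matrix_vector_mult_def)

lemma sandwich_stack_nth:
  fixes A :: "real^'k^'m" and B :: "real^'k^'n" and N :: "real^'k^'k"
  shows "(stack A B ** N ** transpose (stack A B)) $ Inl i $ Inl i' = (A ** N ** transpose A) $ i $ i'"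
    "(stack A B ** N ** transpose (stack A B)) $ Inl i $ Inr j = (A ** N ** transpose B) $ i $ j"
    "(stack A B ** N ** transpose (stack A B)) $ Inr j $ Inl i = (B ** N ** transpose A) $ j $ i"
    "(stack A B ** N ** transpose (stack A B)) $ Inr j $ Inr j' = (B ** N ** transpose B) $ j $ j'"
  by (simp_all add: matrix_matrix_mult_def transpose_def)

lemma transpose_stack_vector_mult:
  "transpose (stack A B) *v x = transpose A *v (\<chi> i. x $ Inl i) + transpose B *v (\<chi> j. x $ Inr j)"
  by (simp add: vec_eq_iff matrix_vector_mult_def transpose_def UNIV_Plus_UNIV[symmetric] sum.Plus
      del: UNIV_Plus_UNIV)

text \<open>The coefficient matrices of the four latent processes in the reduced form of the model, in which
  \<open>\<eta> = \<Psi>\<^sup>-\<^sup>1 (\<Gamma> \<xi> + \<zeta>)\<close> has been eliminated.\<close>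

definition load_xi :: "('q::finite, 'k1::finite, 'k2::finite, 'p1::finite, 'p2::finite) sem_model \<Rightarrow> real^'q \<Rightarrow> real^'k1^('p1 + 'p2)" where
  "load_xi m \<theta> = stack (Lam1 m \<theta>) (Lam2 m \<theta> ** matrix_inv (Psi m \<theta>) ** Gam m \<theta>)"

definition load_zeta :: "('q::finite, 'k1::finite, 'k2::finite, 'p1::finite, 'p2::finite) sem_model \<Rightarrow> real^'q \<Rightarrow> real^'k2^('p1 + 'p2)" where
  "load_zeta m \<theta> = stack 0 (Lam2 m \<theta> ** matrix_inv (Psi m \<theta>))"

definition load_delta :: "real^'p1::finite^('p1 + 'p2::finite)" where
  "load_delta = stack (mat 1) 0"

definition load_eps :: "real^'p2::finite^('p1::finite + 'p2)" where
  "load_eps = stack 0 (mat 1)"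

lemma matrix_mult_zero_left: "(0 :: real^'n^'m) ** A = 0"
  by (simp add: vec_eq_iff matrix_matrix_mult_def)

lemma matrix_mult_zero_right: "(A :: real^'n^'m) ** 0 = 0"
  by (simp add: vec_eq_iff matrix_matrix_mult_def)

text \<open>Independent latent processes contribute additively to the covariance of the observable, each
  through its coefficient matrix. All properties of the covariance structure are read off this
  form instead of its blocks.\<close>

lemma Sigma_cov_decomposition:
  assumes "transpose (Sxi m \<theta>) = Sxi m \<theta>"
  shows "Sigma_cov m \<theta> =
    load_xi m \<theta> ** Sxi m \<theta> ** transpose (load_xi m \<theta>)
    + load_delta ** Sdel m \<theta> ** transpose load_delta
    + load_eps ** Seps m \<theta> ** transpose load_eps
    + load_zeta m \<theta> ** Szeta m \<theta> ** transpose (load_zeta m \<theta>)"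
    (is "_ = ?R")
proof -
  have "Sigma_cov m \<theta> $ a $ b = ?R $ a $ b" for a b
    using assms
    by (cases a; cases b)
      (simp_all add: Sigma_cov_def Sigma11_def Sigma12_def Sigma22_def load_xi_def load_zeta_def
        load_delta_def load_eps_def sandwich_stack_nth transpose_zero transpose_mat
        matrix_mult_zero_left matrix_mult_zero_right matrix_transpose_mul transpose_transpose
        matrix_mul_assoc matrix_add_ldistrib matrix_add_rdistrib)
  then show ?thesis by (simp add: vec_eq_iff)
qed

lemma inner_sandwich_vec:
  fixes C :: "real^'k^'n"
  shows "x \<bullet> ((C ** N ** transpose C) *v x) = (transpose C *v x) \<bullet> (N *v (transpose C *v x))"
  unfolding matrix_vector_mul_assoc[symmetric] by (rule inner_matrix_vector_transpose)

lemma psd_sandwich: "psd N \<Longrightarrow> psd (C ** N ** transpose C)"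
  unfolding psd_def inner_sandwich_vec
  by (simp add: matrix_transpose_mul transpose_transpose matrix_mul_assoc)

lemma psd_add: "psd A \<Longrightarrow> psd B \<Longrightarrow> psd (A + B)"
  by (simp add: psd_def transpose_add matrix_vector_mult_add_rdistrib inner_add_right)

lemma wf_model_diffusion_psd:
  assumes "wf_model m" "\<theta> \<in> Params m"
  shows "psd (Sxi m \<theta>)" "psd (Sdel m \<theta>)" "psd (Seps m \<theta>)" "psd (Szeta m \<theta>)"
  using assms unfolding wf_model_def by (auto intro: is_diffusion_matrix_imp_psd)

text \<open>All four summands are semidefinite, and those of \<open>\<delta>\<close> and \<open>\<epsilon>\<close> together are definite already: they see
  the two blocks of a vector separately.\<close>

lemma pos_def_Sigma_cov:
  assumes wf: "wf_model m" and nd: "sem_nondegenerate m" and \<theta>: "\<theta> \<in> Params m"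
  shows "pos_def (Sigma_cov m \<theta>)"
proof -
  note psd = wf_model_diffusion_psd[OF wf \<theta>]
  have sym: "transpose (Sxi m \<theta>) = Sxi m \<theta>" using psd(1) by (simp add: psd_def)
  note dec = Sigma_cov_decomposition[OF sym]
  have pd: "pos_def (Sdel m \<theta>)" "pos_def (Seps m \<theta>)"
    using nd \<theta> by (auto simp: sem_nondegenerate_def)
  have S: "psd (Sigma_cov m \<theta>)"
    unfolding dec by (intro psd_add psd_sandwich psd)
  show ?thesis
    unfolding pos_def_def
  proof (intro conjI allI impI)
    show "transpose (Sigma_cov m \<theta>) = Sigma_cov m \<theta>" using S by (simp add: psd_def)
    fix x :: "real^('d + 'e)" assume x: "x \<noteq> 0"
    define l where "l = transpose (load_delta :: real^'d^('d + 'e)) *v x"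
    define r where "r = transpose (load_eps :: real^'e^('d + 'e)) *v x"
    have l: "l $ i = x $ Inl i" for i
      by (simp add: l_def load_delta_def transpose_stack_vector_mult transpose_mat transpose_zero del: transpose_matrix_vector)
    have r: "r $ i = x $ Inr i" for i
      by (simp add: r_def load_eps_def transpose_stack_vector_mult transpose_mat transpose_zero del: transpose_matrix_vector)
    obtain a where "x $ a \<noteq> 0" using x by (auto simp: vec_eq_iff)
    then have "l \<noteq> 0 \<or> r \<noteq> 0"
      using l r by (cases a) (auto simp: vec_eq_iff)
    moreover have "0 \<le> l \<bullet> (Sdel m \<theta> *v l)" "0 \<le> r \<bullet> (Seps m \<theta> *v r)"
      using psd by (auto simp: psd_def)
    moreover have "l \<noteq> 0 \<Longrightarrow> 0 < l \<bullet> (Sdel m \<theta> *v l)" "r \<noteq> 0 \<Longrightarrow> 0 < r \<bullet> (Seps m \<theta> *v r)"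
      using pd by (auto simp: pos_def_def)
    ultimately have "0 < l \<bullet> (Sdel m \<theta> *v l) + r \<bullet> (Seps m \<theta> *v r)"
      by (auto intro: add_pos_nonneg add_nonneg_pos)
    moreover have "x \<bullet> (Sigma_cov m \<theta> *v x) =
       x \<bullet> ((load_xi m \<theta> ** Sxi m \<theta> ** transpose (load_xi m \<theta>)) *v x)
       + (l \<bullet> (Sdel m \<theta> *v l) + r \<bullet> (Seps m \<theta> *v r))
       + x \<bullet> ((load_zeta m \<theta> ** Szeta m \<theta> ** transpose (load_zeta m \<theta>)) *v x)"
      unfolding dec matrix_vector_mult_add_rdistrib inner_add_right l_def r_def
        inner_sandwich_vec[symmetric] by simp
    moreover have "0 \<le> x \<bullet> ((load_xi m \<theta> ** Sxi m \<theta> ** transpose (load_xi m \<theta>)) *v x)"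
      "0 \<le> x \<bullet> ((load_zeta m \<theta> ** Szeta m \<theta> ** transpose (load_zeta m \<theta>)) *v x)"
      using psd_sandwich psd unfolding psd_def by blast+
    ultimately show "0 < x \<bullet> (Sigma_cov m \<theta> *v x)" by linarith
  qed
qed

lemma entries_param_imp_continuous_on:
  fixes f :: "real^'q::finite \<Rightarrow> real^'b^'a"
  assumes "entries_param f"
  shows "continuous_on S f"
proof (rule continuous_on_matrixI)
  fix i j
  consider c where "\<And>\<theta>. f \<theta> $ i $ j = c" | l where "\<And>\<theta>. f \<theta> $ i $ j = \<theta> $ l"
    using assms unfolding entries_param_def by metis
  then show "continuous_on S (\<lambda>\<theta>. f \<theta> $ i $ j)"
    by cases (auto intro!: continuous_intros)
qed

lemma continuous_on_stack:
  assumes "continuous_on S f" "continuous_on S g"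
  shows "continuous_on S (\<lambda>x. stack (f x) (g x))"
proof (rule continuous_on_matrixI)
  fix a j
  show "continuous_on S (\<lambda>x. stack (f x) (g x) $ a $ j)"
    by (cases a) (auto intro!: continuous_intros assms)
qed

lemma continuous_on_Sigma_cov:
  assumes wf: "wf_model m" and nd: "sem_nondegenerate m"
  shows "continuous_on (Params m) (Sigma_cov m)"
proof -
  have [continuous_intros]: "continuous_on (Params m) (Lam1 m)" "continuous_on (Params m) (Lam2 m)"
      "continuous_on (Params m) (Gam m)" "continuous_on (Params m) (Psi m)"
      "continuous_on (Params m) (Sxi m)" "continuous_on (Params m) (Sdel m)"
      "continuous_on (Params m) (Seps m)" "continuous_on (Params m) (Szeta m)"
    using wf unfolding wf_model_def by (auto intro: entries_param_imp_continuous_on)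
  have inv: "\<theta> \<in> Params m \<Longrightarrow> invertible (Psi m \<theta>)" for \<theta>
    using nd by (auto simp: sem_nondegenerate_def)
  have "continuous_on (Params m) (\<lambda>\<theta>. 
    load_xi m \<theta> ** Sxi m \<theta> ** transpose (load_xi m \<theta>)
    + load_delta ** Sdel m \<theta> ** transpose load_delta
    + load_eps ** Seps m \<theta> ** transpose load_eps
    + load_zeta m \<theta> ** Szeta m \<theta> ** transpose (load_zeta m \<theta>))"
    unfolding load_xi_def load_zeta_def
    by (intro continuous_intros continuous_on_matrix_mult continuous_on_stack
       continuous_on_transpose continuous_on_matrix_inv inv)
  then show ?thesis
    by (rule continuous_on_eq)
      (use wf_model_diffusion_psd(1)[OF wf] in \<open>auto simp: psd_def Sigma_cov_decomposition\<close>)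
qed

section \<open>Convergence in mean of averaged outer products\<close>

lemma norm_outer_prod: "norm (outer_prod u v) = norm u * norm v"
proof -
  have "outer_prod u v \<bullet> outer_prod u v = (u \<bullet> u) * (v \<bullet> v)"
    unfolding inner_vec_def outer_prod_def sum_product by (simp add: inner_vec_def mult_ac)
  then show ?thesis by (simp add: norm_eq_sqrt_inner real_sqrt_mult)
qed

lemma continuous_on_outer_prod:
  fixes f :: "'a::topological_space \<Rightarrow> real^'m" and g :: "'a \<Rightarrow> real^'n"
  assumes "continuous_on S f" "continuous_on S g"
  shows "continuous_on S (\<lambda>x. outer_prod (f x) (g x))"
  by (rule continuous_on_matrixI) (auto simp: outer_prod_def intro!: continuous_intros assms)

lemma borel_measurable_outer_prod [measurable (raw)]:
  fixes f :: "'a \<Rightarrow> real^'m" and g :: "'a \<Rightarrow> real^'n"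
  assumes "f \<in> borel_measurable M" "g \<in> borel_measurable M"
  shows "(\<lambda>x. outer_prod (f x) (g x)) \<in> borel_measurable M"
  using assms
  by (rule borel_measurable_continuous_Pair) (intro continuous_on_outer_prod continuous_intros)

lemma borel_measurable_matrix_vector_mult [measurable (raw)]:
  fixes f :: "'a \<Rightarrow> real^'n" and A :: "real^'n^'m"
  assumes "f \<in> borel_measurable M"
  shows "(\<lambda>x. A *v f x) \<in> borel_measurable M"
  by (rule borel_measurable_continuous_on[OF _ assms])
    (intro linear_continuous_on linear_conv_bounded_linear[THEN iffD1] matrix_vector_mul_linear)

lemma borel_measurable_vec_nth_real [measurable (raw)]:
  fixes f :: "'a \<Rightarrow> real^'n"
  assumes "f \<in> borel_measurable M"
  shows "(\<lambda>x. f x $ i) \<in> borel_measurable M"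
  by (rule borel_measurable_continuous_on[OF _ assms]) (intro continuous_intros)

text \<open>Convergence in mean. Taking the nonnegative integral keeps the definition meaningful before any
  integrability is known.\<close>

definition L1_lim :: "'a measure \<Rightarrow> (nat \<Rightarrow> 'a \<Rightarrow> 'b::{real_normed_vector, second_countable_topology}) \<Rightarrow> 'b \<Rightarrow> bool" where
  "L1_lim M Z c \<longleftrightarrow> (\<forall>n. Z n \<in> borel_measurable M) \<and>
     (\<lambda>n. \<integral>\<^sup>+\<omega>. ennreal (norm (Z n \<omega> - c)) \<partial>M) \<longlonglongrightarrow> 0"

lemma ennreal_tendsto_zero_le:
  fixes f g :: "nat \<Rightarrow> ennreal"
  assumes "g \<longlonglongrightarrow> 0" "\<And>n. 0 < n \<Longrightarrow> f n \<le> g n"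
  shows "f \<longlonglongrightarrow> 0"
proof (rule tendsto_sandwich[OF _ _ tendsto_const assms(1)])
  show "\<forall>\<^sub>F n in sequentially. f n \<le> g n"
    using eventually_gt_at_top[of 0] by eventually_elim (rule assms(2))
qed simp

lemma L1_limI:
  assumes "\<And>n. Z n \<in> borel_measurable M"
    and "\<And>n. 0 < n \<Longrightarrow> (\<integral>\<^sup>+\<omega>. ennreal (norm (Z n \<omega> - c)) \<partial>M) \<le> ennreal (b n)"
    and "b \<longlonglongrightarrow> 0"
  shows "L1_lim M Z c"
  unfolding L1_lim_def
proof (intro conjI allI assms)
  have "(\<lambda>n. ennreal (b n)) \<longlonglongrightarrow> 0"
    using tendsto_ennrealI[OF assms(3)] by simp
  then show "(\<lambda>n. \<integral>\<^sup>+\<omega>. ennreal (norm (Z n \<omega> - c)) \<partial>M) \<longlonglongrightarrow> 0"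
    by (rule ennreal_tendsto_zero_le) (rule assms(2))
qed

lemma L1_lim_add:
  assumes "L1_lim M Y c" "L1_lim M Z d"
  shows "L1_lim M (\<lambda>n \<omega>. Y n \<omega> + Z n \<omega>) (c + d)"
proof -
  have [measurable]: "Y n \<in> borel_measurable M" "Z n \<in> borel_measurable M" for n
    using assms by (auto simp: L1_lim_def)
  have le: "(\<integral>\<^sup>+\<omega>. ennreal (norm (Y n \<omega> + Z n \<omega> - (c + d))) \<partial>M)
      \<le> (\<integral>\<^sup>+\<omega>. ennreal (norm (Y n \<omega> - c)) \<partial>M) + (\<integral>\<^sup>+\<omega>. ennreal (norm (Z n \<omega> - d)) \<partial>M)" for n
  proof -
    have "(\<integral>\<^sup>+\<omega>. ennreal (norm (Y n \<omega> + Z n \<omega> - (c + d))) \<partial>M)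
      \<le> (\<integral>\<^sup>+\<omega>. ennreal (norm (Y n \<omega> - c)) + ennreal (norm (Z n \<omega> - d)) \<partial>M)"
      by (intro nn_integral_mono)
        (simp add: add_diff_add norm_triangle_ineq flip: ennreal_plus)
    also have "\<dots> = (\<integral>\<^sup>+\<omega>. ennreal (norm (Y n \<omega> - c)) \<partial>M) + (\<integral>\<^sup>+\<omega>. ennreal (norm (Z n \<omega> - d)) \<partial>M)"
      by (intro nn_integral_add) auto
    finally show ?thesis .
  qed
  have "(\<lambda>n. (\<integral>\<^sup>+\<omega>. ennreal (norm (Y n \<omega> - c)) \<partial>M) + (\<integral>\<^sup>+\<omega>. ennreal (norm (Z n \<omega> - d)) \<partial>M)) \<longlonglongrightarrow> 0 + 0"
    using assms by (intro tendsto_add) (auto simp: L1_lim_def)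
  then have "(\<lambda>n. \<integral>\<^sup>+\<omega>. ennreal (norm (Y n \<omega> + Z n \<omega> - (c + d))) \<partial>M) \<longlonglongrightarrow> 0"
    by (intro ennreal_tendsto_zero_le[OF _ le]) simp
  then show ?thesis by (auto simp: L1_lim_def)
qed

lemma L1_lim_bounded_linear:
  assumes f: "bounded_linear f" and Z: "L1_lim M Z c"
  shows "L1_lim M (\<lambda>n \<omega>. f (Z n \<omega>)) (f c)"
proof -
  obtain K where K: "0 \<le> K" "\<And>x. norm (f x) \<le> norm x * K"
    using bounded_linear.nonneg_bounded[OF f] by blast
  have [measurable]: "Z n \<in> borel_measurable M" for n
    using Z by (auto simp: L1_lim_def)
  have meas: "(\<lambda>\<omega>. f (Z n \<omega>)) \<in> borel_measurable M" for n
    by (rule borel_measurable_continuous_on[OF linear_continuous_on[OF f]]) simp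
  have le: "(\<integral>\<^sup>+\<omega>. ennreal (norm (f (Z n \<omega>) - f c)) \<partial>M)
      \<le> ennreal K * (\<integral>\<^sup>+\<omega>. ennreal (norm (Z n \<omega> - c)) \<partial>M)" for n
  proof -
    have "(\<integral>\<^sup>+\<omega>. ennreal (norm (f (Z n \<omega>) - f c)) \<partial>M)
      \<le> (\<integral>\<^sup>+\<omega>. ennreal K * ennreal (norm (Z n \<omega> - c)) \<partial>M)"
      using K by (intro nn_integral_mono)
        (simp add: linear_diff[OF bounded_linear.linear[OF f], symmetric] mult.commute flip: ennreal_mult)
    then show ?thesis by (simp add: nn_integral_cmult)
  qed
  have "(\<lambda>n. ennreal K * (\<integral>\<^sup>+\<omega>. ennreal (norm (Z n \<omega> - c)) \<partial>M)) \<longlonglongrightarrow> ennreal K * 0"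
    using Z by (intro ennreal_tendsto_cmult) (auto simp: L1_lim_def)
  then have "(\<lambda>n. \<integral>\<^sup>+\<omega>. ennreal (norm (f (Z n \<omega>) - f c)) \<partial>M) \<longlonglongrightarrow> 0"
    by (intro ennreal_tendsto_zero_le[OF _ le]) simp
  then show ?thesis using meas by (simp add: L1_lim_def)
qed

lemma L1_lim_sum:
  assumes "finite I" "\<And>i. i \<in> I \<Longrightarrow> L1_lim M (Z i) (c i)"
  shows "L1_lim M (\<lambda>n \<omega>. \<Sum>i\<in>I. Z i n \<omega>) (\<Sum>i\<in>I. c i)"
  using assms
proof (induction I rule: finite_induct)
  case empty
  show ?case by (simp add: L1_lim_def)
next
  case (insert i I)
  then show ?case by (simp add: L1_lim_add)
qed

lemma bounded_linear_matrix_unit: "bounded_linear (\<lambda>x. \<chi> k l. if k = i \<and> l = j then (x::real) else 0)"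
  by (auto intro!: linear_conv_bounded_linear[THEN iffD1] linearI simp: vec_eq_iff)

lemma matrix_eq_sum_units:
  fixes A :: "real^'n^'m"
  shows "A = (\<Sum>i\<in>UNIV. \<Sum>j\<in>UNIV. \<chi> k l. if k = i \<and> l = j then A $ i $ j else 0)"
proof -
  have "(\<Sum>i\<in>UNIV. \<Sum>j\<in>UNIV. if k = i \<and> l = j then A $ i $ j else 0) = A $ k $ l" for k l
  proof -
    have "(\<Sum>i\<in>UNIV. \<Sum>j\<in>UNIV. if k = i \<and> l = j then A $ i $ j else 0)
      = (\<Sum>i\<in>UNIV. if k = i then A $ i $ l else 0)"
      by (intro sum.cong) auto
    then show ?thesis by simp
  qed
  then show ?thesis by (simp add: vec_eq_iff)
qed

text \<open>A matrix is the sum of its entries times matrix units, and convergence in mean is preserved by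
  bounded linear maps and sums.\<close>

lemma L1_lim_matrixI:
  fixes Z :: "nat \<Rightarrow> 'a \<Rightarrow> real^'n^'m"
  assumes "\<And>i j. L1_lim M (\<lambda>n \<omega>. Z n \<omega> $ i $ j) (c $ i $ j)"
  shows "L1_lim M Z c"
proof -
  have "L1_lim M (\<lambda>n \<omega>. \<Sum>i\<in>UNIV. \<Sum>j\<in>UNIV. \<chi> k l. if k = i \<and> l = j then Z n \<omega> $ i $ j else 0)
     (\<Sum>i\<in>UNIV. \<Sum>j\<in>UNIV. \<chi> k l. if k = i \<and> l = j then c $ i $ j else 0)"
    by (intro L1_lim_sum L1_lim_bounded_linear[OF bounded_linear_matrix_unit] assms) auto
  then show ?thesis by (simp add: matrix_eq_sum_units[symmetric])
qed

text \<open>Markov's inequality.\<close>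

lemma L1_lim_imp_prob:
  assumes Z: "L1_lim M Z c" and e: "0 < e" and M: "prob_space M"
  shows "(\<lambda>n. measure M {\<omega> \<in> space M. norm (Z n \<omega> - c) \<le> e}) \<longlonglongrightarrow> 1"
proof -
  interpret prob_space M by fact
  have [measurable]: "Z n \<in> borel_measurable M" for n
    using Z by (auto simp: L1_lim_def)
  have le: "emeasure M {\<omega> \<in> space M. norm (Z n \<omega> - c) \<ge> e}
     \<le> ennreal (1 / e) * (\<integral>\<^sup>+\<omega>. ennreal (norm (Z n \<omega> - c)) \<partial>M)" for n
  proof -
    have "{\<omega> \<in> space M. norm (Z n \<omega> - c) \<ge> e}
      = {\<omega> \<in> space M. 1 \<le> ennreal (1 / e) * ennreal (norm (Z n \<omega> - c))}"
      using e by (auto simp: ennreal_mult[symmetric] field_simps)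
    then show ?thesis
      using nn_integral_Markov_inequality[of "\<lambda>\<omega>. ennreal (norm (Z n \<omega> - c))" "space M" M "ennreal (1 / e)"]
      by simp
  qed
  have "(\<lambda>n. ennreal (1 / e) * (\<integral>\<^sup>+\<omega>. ennreal (norm (Z n \<omega> - c)) \<partial>M)) \<longlonglongrightarrow> ennreal (1 / e) * 0"
    using Z by (intro ennreal_tendsto_cmult) (auto simp: L1_lim_def)
  then have "(\<lambda>n. emeasure M {\<omega> \<in> space M. norm (Z n \<omega> - c) \<ge> e}) \<longlonglongrightarrow> 0"
    by (intro ennreal_tendsto_zero_le[OF _ le]) simp
  then have "(\<lambda>n. measure M {\<omega> \<in> space M. norm (Z n \<omega> - c) \<ge> e}) \<longlonglongrightarrow> 0"
    unfolding emeasure_eq_measure using tendsto_ennreal_iff[of _ _ 0] by (auto simp: ennreal_0[symmetric] simp del: ennreal_0)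
  then have lim: "(\<lambda>n. 1 - measure M {\<omega> \<in> space M. norm (Z n \<omega> - c) \<ge> e}) \<longlonglongrightarrow> 1 - 0"
    by (intro tendsto_intros)
  have ge: "1 - measure M {\<omega> \<in> space M. norm (Z n \<omega> - c) \<ge> e} \<le> measure M {\<omega> \<in> space M. norm (Z n \<omega> - c) \<le> e}" for n
  proof -
    have "1 - measure M {\<omega> \<in> space M. norm (Z n \<omega> - c) \<ge> e} = measure M (space M - {\<omega> \<in> space M. norm (Z n \<omega> - c) \<ge> e})"
      by (rule prob_compl[symmetric]) simp
    also have "\<dots> \<le> measure M {\<omega> \<in> space M. norm (Z n \<omega> - c) \<le> e}"
      by (intro finite_measure_mono) auto
    finally show ?thesis .
  qed
  show ?thesis
    by (rule tendsto_sandwich[OF _ _ _ tendsto_const, of "\<lambda>n. 1 - measure M {\<omega> \<in> space M. norm (Z n \<omega> - c) \<ge> e}"])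
      (use lim ge in \<open>auto intro: always_eventually\<close>)
qed

text \<open>For increments \<open>u\<close>, \<open>v\<close> of two processes over a grid of mesh \<open>h n\<close> this is their realized
  covariation per unit of time. Keeping the two arguments separate makes it bilinear.\<close>

definition mean_outer :: "(nat \<Rightarrow> real) \<Rightarrow> (nat \<Rightarrow> nat \<Rightarrow> 'a \<Rightarrow> real^'m) \<Rightarrow> (nat \<Rightarrow> nat \<Rightarrow> 'a \<Rightarrow> real^'n) \<Rightarrow> nat \<Rightarrow> 'a \<Rightarrow> real^'n^'m" where
  "mean_outer h u v n \<omega> = (1 / (real n * h n)) *\<^sub>R (\<Sum>i<n. outer_prod (u n i \<omega>) (v n i \<omega>))"

lemma outer_prod_add_left: "outer_prod (x + y) z = outer_prod x z + outer_prod y z"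
  by (simp add: vec_eq_iff outer_prod_def algebra_simps)

lemma mean_outer_add_left:
  "mean_outer h (\<lambda>n i \<omega>. u n i \<omega> + u' n i \<omega>) v n \<omega> = mean_outer h u v n \<omega> + mean_outer h u' v n \<omega>"
  by (simp add: mean_outer_def outer_prod_add_left sum.distrib scaleR_right_distrib)

lemma outer_prod_mult_left: "outer_prod (A *v x) y = A ** outer_prod x y"
  by (simp add: vec_eq_iff outer_prod_def matrix_vector_mult_def matrix_matrix_mult_def
      sum_distrib_right mult.assoc)

lemma mean_outer_mult_left:
  "mean_outer h (\<lambda>n i \<omega>. A *v u n i \<omega>) v n \<omega> = A ** mean_outer h u v n \<omega>"
  by (simp add: mean_outer_def outer_prod_mult_left scaleR_matrix_mult_right matrix_mult_sum_right)

lemma mean_outer_transpose: "mean_outer h v u n \<omega> = transpose (mean_outer h u v n \<omega>)"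
  by (simp add: mean_outer_def transpose_scaleR transpose_sum transpose_outer_prod)

lemma bounded_linear_transpose: "bounded_linear (transpose :: real^'n^'m \<Rightarrow> real^'m^'n)"
  by (auto intro!: linear_conv_bounded_linear[THEN iffD1] linearI simp: transpose_add transpose_scaleR)

lemma bounded_linear_matrix_mult_left: "bounded_linear (\<lambda>X :: real^'k^'n. (A :: real^'n^'m) ** X)"
  by (auto intro!: linear_conv_bounded_linear[THEN iffD1] linearI
      simp: matrix_add_ldistrib scaleR_matrix_mult_right)

lemma L1_lim_mean_outer_swap:
  assumes "L1_lim M (mean_outer h u v) G"
  shows "L1_lim M (mean_outer h v u) (transpose G)"
  using L1_lim_bounded_linear[OF bounded_linear_transpose assms]
  by (simp add: mean_outer_transpose[of h v u, abs_def])

lemma L1_lim_mean_outer_add_left: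
  assumes "L1_lim M (mean_outer h u v) G" "L1_lim M (mean_outer h u' v) G'"
  shows "L1_lim M (mean_outer h (\<lambda>n i \<omega>. u n i \<omega> + u' n i \<omega>) v) (G + G')"
  using L1_lim_add[OF assms] by (simp add: mean_outer_add_left[of h u u' v, abs_def])

lemma L1_lim_mean_outer_mult_left:
  assumes "L1_lim M (mean_outer h u v) G"
  shows "L1_lim M (mean_outer h (\<lambda>n i \<omega>. A *v u n i \<omega>) v) (A ** G)"
  using L1_lim_bounded_linear[OF bounded_linear_matrix_mult_left assms]
  by (simp add: mean_outer_mult_left[of h A u v, abs_def])

lemma L1_lim_mean_outer_add_right:
  assumes "L1_lim M (mean_outer h u v) G" "L1_lim M (mean_outer h u v') G'"
  shows "L1_lim M (mean_outer h u (\<lambda>n i \<omega>. v n i \<omega> + v' n i \<omega>)) (G + G')"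
  using L1_lim_mean_outer_swap[OF L1_lim_mean_outer_add_left[OF assms[THEN L1_lim_mean_outer_swap]]]
  by (simp add: transpose_add transpose_transpose)

lemma L1_lim_mean_outer_mult_right:
  assumes "L1_lim M (mean_outer h u v) G"
  shows "L1_lim M (mean_outer h u (\<lambda>n i \<omega>. A *v v n i \<omega>)) (G ** transpose A)"
  using L1_lim_mean_outer_swap[OF L1_lim_mean_outer_mult_left[OF assms[THEN L1_lim_mean_outer_swap]]]
  by (simp add: matrix_transpose_mul transpose_transpose)

text \<open>By \<open>\<bar>u\<bar> \<bar>v\<bar> \<le> \<bar>u\<bar>\<^sup>2 / s + s \<bar>v\<bar>\<^sup>2\<close> with \<open>s\<^sup>2 = h\<close>, each of the \<open>n\<close> products has mean of order \<open>h s\<close>,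
  so the average is of order \<open>s\<close>.\<close>

lemma L1_lim_mean_outer_negligible:
  fixes u :: "nat \<Rightarrow> nat \<Rightarrow> 'a \<Rightarrow> real^'m" and v :: "nat \<Rightarrow> nat \<Rightarrow> 'a \<Rightarrow> real^'n"
  assumes h: "\<And>n. 0 < h n" "h \<longlonglongrightarrow> 0"
    and meas [measurable]: "\<And>n i. u n i \<in> borel_measurable M" "\<And>n i. v n i \<in> borel_measurable M"
    and K: "0 \<le> K" "\<And>n i. (\<integral>\<^sup>+\<omega>. ennreal ((norm (u n i \<omega>))\<^sup>2) \<partial>M) \<le> ennreal (K * (h n)\<^sup>2)"
    and L: "0 \<le> L" "\<And>n i. (\<integral>\<^sup>+\<omega>. ennreal ((norm (v n i \<omega>))\<^sup>2) \<partial>M) \<le> ennreal (L * h n)"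
  shows "L1_lim M (mean_outer h u v) 0"
proof (rule L1_limI)
  show "mean_outer h u v n \<in> borel_measurable M" for n
    unfolding mean_outer_def by measurable
  show "(\<lambda>n. (K + L) * sqrt (h n)) \<longlonglongrightarrow> 0"
    using tendsto_mult_right_zero[OF tendsto_real_sqrt[OF h(2), simplified]] .
  fix n :: nat assume n: "0 < n"
  define s where "s = sqrt (h n)"
  have s: "0 < s" "h n = s * s" using h(1)[of n] by (auto simp: s_def)
  have term_le: "(\<integral>\<^sup>+\<omega>. ennreal (norm (u n i \<omega>) * norm (v n i \<omega>)) \<partial>M) \<le> ennreal ((K + L) * s ^ 3)" for i
  proof -
    have amgm: "x * y \<le> (1 / s) * x\<^sup>2 + s * y\<^sup>2" for x y :: real
    proof -
      have "0 \<le> (x - s * y)\<^sup>2 + x\<^sup>2 + s\<^sup>2 * y\<^sup>2" by simp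
      then have "s * (x * y) \<le> s * ((1 / s) * x\<^sup>2 + s * y\<^sup>2)"
        using s(1) by (simp add: power2_eq_square algebra_simps)
      then show ?thesis using s(1) by (simp only: mult_le_cancel_left_pos)
    qed
    have "(\<integral>\<^sup>+\<omega>. ennreal (norm (u n i \<omega>) * norm (v n i \<omega>)) \<partial>M)
      \<le> (\<integral>\<^sup>+\<omega>. ennreal (1 / s) * ennreal ((norm (u n i \<omega>))\<^sup>2) + ennreal s * ennreal ((norm (v n i \<omega>))\<^sup>2) \<partial>M)"
      using amgm s(1) by (intro nn_integral_mono) (simp flip: ennreal_mult ennreal_plus)
    also have "\<dots> = ennreal (1 / s) * (\<integral>\<^sup>+\<omega>. ennreal ((norm (u n i \<omega>))\<^sup>2) \<partial>M)
        + ennreal s * (\<integral>\<^sup>+\<omega>. ennreal ((norm (v n i \<omega>))\<^sup>2) \<partial>M)"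
      by (simp add: nn_integral_add nn_integral_cmult)
    also have "\<dots> \<le> ennreal (1 / s) * ennreal (K * (h n)\<^sup>2) + ennreal s * ennreal (L * h n)"
      by (intro add_mono mult_left_mono K L) auto
    also have "\<dots> = ennreal ((K + L) * s ^ 3)"
      using s K(1) L(1)
      by (simp add: ennreal_mult[symmetric] ennreal_plus[symmetric] power2_eq_square
          power3_eq_cube field_simps del: ennreal_plus)
    finally show ?thesis .
  qed
  define c where "c = 1 / (real n * h n)"
  have c: "0 \<le> c" using h(1)[of n] by (simp add: c_def)
  have "(\<integral>\<^sup>+\<omega>. ennreal (norm (mean_outer h u v n \<omega> - 0)) \<partial>M)
    \<le> (\<integral>\<^sup>+\<omega>. ennreal c * (\<Sum>i<n. ennreal (norm (u n i \<omega>) * norm (v n i \<omega>))) \<partial>M)"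
  proof (rule nn_integral_mono)
    fix \<omega>
    have "norm (mean_outer h u v n \<omega>) = c * norm (\<Sum>i<n. outer_prod (u n i \<omega>) (v n i \<omega>))"
      using c by (simp add: mean_outer_def c_def[symmetric])
    also have "\<dots> \<le> c * (\<Sum>i<n. norm (outer_prod (u n i \<omega>) (v n i \<omega>)))"
      by (intro mult_left_mono norm_sum c)
    finally show "ennreal (norm (mean_outer h u v n \<omega> - 0)) \<le> ennreal c * (\<Sum>i<n. ennreal (norm (u n i \<omega>) * norm (v n i \<omega>)))"
      using c by (simp add: norm_outer_prod ennreal_mult[symmetric] sum_nonneg)
  qed
  also have "\<dots> = ennreal c * (\<Sum>i<n. \<integral>\<^sup>+\<omega>. ennreal (norm (u n i \<omega>) * norm (v n i \<omega>)) \<partial>M)"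
    by (simp add: nn_integral_cmult nn_integral_sum del: sum_ennreal)
  also have "\<dots> \<le> ennreal c * (\<Sum>i<n. ennreal ((K + L) * s ^ 3))"
    by (intro mult_left_mono sum_mono term_le) auto
  also have "\<dots> = ennreal (c * (real n * ((K + L) * s ^ 3)))"
    using c K(1) L(1) s(1) by (simp add: ennreal_mult[symmetric] ennreal_of_nat_eq_real_of_nat)
  also have "c * (real n * ((K + L) * s ^ 3)) = (K + L) * sqrt (h n)"
    using n s(1) unfolding c_def s_def[symmetric] s(2) by (simp add: power3_eq_cube)
  finally show "(\<integral>\<^sup>+\<omega>. ennreal (norm (mean_outer h u v n \<omega> - 0)) \<partial>M) \<le> ennreal ((K + L) * sqrt (h n))" .
qed

section \<open>Quadratic covariation of Wiener increments\<close>

lemma abs_mult_le_sum_squares: "\<bar>x * y\<bar> \<le> x\<^sup>2 + y\<^sup>2" for x y :: real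
proof -
  have "2 * (\<bar>x\<bar> * \<bar>y\<bar>) \<le> x\<^sup>2 + y\<^sup>2"
    using sum_squares_bound[of "\<bar>x\<bar>" "\<bar>y\<bar>"] by (simp add: mult.assoc)
  moreover have "0 \<le> \<bar>x\<bar> * \<bar>y\<bar>" by simp
  ultimately show ?thesis unfolding abs_mult by linarith
qed

text \<open>The centred sum \<open>Y\<close> has second moment at most \<open>n C\<close>. The passage from the second to the first moment
  uses \<open>\<bar>Y / n\<bar> \<le> Y\<^sup>2 / s\<^sup>3 + 1 / s\<close> with \<open>s\<^sup>2 = n\<close>.\<close>

lemma (in prob_space) L1_weak_law:
  fixes Z :: "nat \<Rightarrow> 'a \<Rightarrow> real"
  assumes n: "0 < n"
    and meas: "\<And>i. i < n \<Longrightarrow> Z i \<in> borel_measurable M"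
    and sq: "\<And>i. i < n \<Longrightarrow> integrable M (\<lambda>\<omega>. (Z i \<omega>)\<^sup>2)" "\<And>i. i < n \<Longrightarrow> expectation (\<lambda>\<omega>. (Z i \<omega>)\<^sup>2) \<le> C"
    and mean: "\<And>i. i < n \<Longrightarrow> expectation (Z i) = \<mu>"
    and uncorrelated: "\<And>i j. i < n \<Longrightarrow> j < n \<Longrightarrow> i \<noteq> j \<Longrightarrow> expectation (\<lambda>\<omega>. Z i \<omega> * Z j \<omega>) = \<mu>\<^sup>2"
  shows "(\<integral>\<^sup>+\<omega>. ennreal (norm ((\<Sum>i<n. Z i \<omega>) / real n - \<mu>)) \<partial>M) \<le> ennreal ((C + 1) / sqrt (real n))"
proof -
  have int1: "integrable M (Z i)" if "i < n" for i
    by (rule square_integrable_imp_integrable) (use that meas sq in auto)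
  have int2: "integrable M (\<lambda>\<omega>. Z i \<omega> * Z j \<omega>)" if "i < n" "j < n" for i j
  proof (rule Bochner_Integration.integrable_bound)
    show "integrable M (\<lambda>\<omega>. (Z i \<omega>)\<^sup>2 + (Z j \<omega>)\<^sup>2)"
      using that sq by auto
    show "(\<lambda>\<omega>. Z i \<omega> * Z j \<omega>) \<in> borel_measurable M"
      using that meas by auto
    show "AE \<omega> in M. norm (Z i \<omega> * Z j \<omega>) \<le> norm ((Z i \<omega>)\<^sup>2 + (Z j \<omega>)\<^sup>2)"
      using abs_mult_le_sum_squares by simp
  qed
  define Y where "Y \<omega> = (\<Sum>i<n. Z i \<omega> - \<mu>)" for \<omega>
  have Y: "(\<Sum>i<n. Z i \<omega>) / real n - \<mu> = Y \<omega> / real n" for \<omega>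
    using n by (simp add: Y_def sum_subtractf field_simps)
  have Ysq: "(Y \<omega>)\<^sup>2 = (\<Sum>i<n. \<Sum>j<n. Z i \<omega> * Z j \<omega> - \<mu> * Z i \<omega> - \<mu> * Z j \<omega> + \<mu>\<^sup>2)" for \<omega>
    by (simp add: Y_def power2_eq_square sum_product algebra_simps)
  have intT: "integrable M (\<lambda>\<omega>. Z i \<omega> * Z j \<omega> - \<mu> * Z i \<omega> - \<mu> * Z j \<omega> + \<mu>\<^sup>2)" if "i < n" "j < n" for i j
    using int1 int2 that by simp
  have ET: "expectation (\<lambda>\<omega>. Z i \<omega> * Z j \<omega> - \<mu> * Z i \<omega> - \<mu> * Z j \<omega> + \<mu>\<^sup>2)
      = expectation (\<lambda>\<omega>. Z i \<omega> * Z j \<omega>) - \<mu>\<^sup>2" if "i < n" "j < n" for i j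
    using int1 int2 that by (simp add: mean power2_eq_square prob_space)
  have intY: "integrable M (\<lambda>\<omega>. (Y \<omega>)\<^sup>2)"
    unfolding Ysq by (intro Bochner_Integration.integrable_sum intT) auto
  have "expectation (\<lambda>\<omega>. (Y \<omega>)\<^sup>2)
      = (\<Sum>i<n. expectation (\<lambda>\<omega>. \<Sum>j<n. Z i \<omega> * Z j \<omega> - \<mu> * Z i \<omega> - \<mu> * Z j \<omega> + \<mu>\<^sup>2))"
    unfolding Ysq
    by (intro Bochner_Integration.integral_sum Bochner_Integration.integrable_sum intT) auto
  also have "\<dots> = (\<Sum>i<n. \<Sum>j<n. expectation (\<lambda>\<omega>. Z i \<omega> * Z j \<omega> - \<mu> * Z i \<omega> - \<mu> * Z j \<omega> + \<mu>\<^sup>2))"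
    by (intro sum.cong refl Bochner_Integration.integral_sum intT) auto
  also have "\<dots> = (\<Sum>i<n. \<Sum>j<n. expectation (\<lambda>\<omega>. Z i \<omega> * Z j \<omega>) - \<mu>\<^sup>2)"
    by (intro sum.cong refl ET) auto
  also have "\<dots> \<le> (\<Sum>i<n. \<Sum>j<n. if i = j then C else 0)"
  proof (intro sum_mono)
    fix i j assume ij: "i \<in> {..<n}" "j \<in> {..<n}"
    show "expectation (\<lambda>\<omega>. Z i \<omega> * Z j \<omega>) - \<mu>\<^sup>2 \<le> (if i = j then C else 0)"
    proof (cases "i = j")
      case True
      then have "expectation (\<lambda>\<omega>. Z i \<omega> * Z j \<omega>) \<le> C"
        using sq(2)[of i] ij by (simp add: power2_eq_square)
      then show ?thesis using True by (smt (verit) zero_le_power2)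
    qed (use uncorrelated ij in auto)
  qed
  also have "\<dots> = real n * C" by simp
  finally have EY: "expectation (\<lambda>\<omega>. (Y \<omega>)\<^sup>2) \<le> real n * C" .
  define s where "s = sqrt (real n)"
  have s: "0 < s" "real n = s * s" using n by (auto simp: s_def)
  have amgm: "\<bar>y / real n\<bar> \<le> y\<^sup>2 / s ^ 3 + 1 / s" for y
  proof -
    have "2 * (s * \<bar>y\<bar>) \<le> y\<^sup>2 + s\<^sup>2"
      using sum_squares_bound[of s "\<bar>y\<bar>"] by (simp add: mult.assoc add.commute)
    moreover have "0 \<le> s * \<bar>y\<bar>" using s(1) by simp
    ultimately have "s * \<bar>y\<bar> \<le> y\<^sup>2 + s\<^sup>2" by linarith
    then show ?thesis using s
      by (simp add: field_simps power3_eq_cube power2_eq_square)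
  qed
  have "(\<integral>\<^sup>+\<omega>. ennreal (norm ((\<Sum>i<n. Z i \<omega>) / real n - \<mu>)) \<partial>M)
      \<le> (\<integral>\<^sup>+\<omega>. ennreal ((Y \<omega>)\<^sup>2 / s ^ 3 + 1 / s) \<partial>M)"
    unfolding Y using amgm by (intro nn_integral_mono ennreal_leI) simp
  also have "\<dots> = ennreal (expectation (\<lambda>\<omega>. (Y \<omega>)\<^sup>2 / s ^ 3 + 1 / s))"
    using s intY by (intro nn_integral_eq_integral) auto
  also have "expectation (\<lambda>\<omega>. (Y \<omega>)\<^sup>2 / s ^ 3 + 1 / s) = expectation (\<lambda>\<omega>. (Y \<omega>)\<^sup>2) / s ^ 3 + 1 / s"
    using intY by (simp add: prob_space)
  also have "\<dots> \<le> (s * s * C) / s ^ 3 + 1 / s"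
    using EY s by (intro add_right_mono divide_right_mono) auto
  also have "\<dots> = (C + 1) / s"
    using s by (simp add: power3_eq_cube field_simps)
  finally show ?thesis by (simp add: s_def ennreal_leI)
qed

lemma (in prob_space) normal_moments:
  assumes D: "distributed M lborel X (normal_density 0 (sqrt v))" and v: "0 < v"
  shows "integrable M (\<lambda>\<omega>. X \<omega> ^ k)" "expectation X = 0" "expectation (\<lambda>\<omega>. (X \<omega>)\<^sup>2) = v"
    "expectation (\<lambda>\<omega>. X \<omega> ^ 4) = 3 * v\<^sup>2"
proof -
  have s: "0 < sqrt v" using v by simp
  have int: "(\<integral>x. normal_density 0 (sqrt v) x * x ^ j \<partial>lborel) = expectation (\<lambda>\<omega>. X \<omega> ^ j)" for j
    by (rule distributed_integral[OF D]) auto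
  show "integrable M (\<lambda>\<omega>. X \<omega> ^ k)"
    using integrable_normal_moment[OF s, of 0 k] distributed_integrable[OF D, of "\<lambda>x. x ^ k"] by simp
  show "expectation X = 0"
    using int[of 1] integral_normal_moment_odd[OF s, of 0 0] by simp
  show "expectation (\<lambda>\<omega>. (X \<omega>)\<^sup>2) = v"
    using int[of 2] integral_normal_moment_even[OF s, of 0 1] v by simp
  show "expectation (\<lambda>\<omega>. X \<omega> ^ 4) = 3 * v\<^sup>2"
    using int[of 4] integral_normal_moment_even[OF s, of 0 2] v
    by (simp add: fact_numeral power2_eq_square power_divide field_simps)
qed

text \<open>The weak law for normalized products of Gaussian increments: the fourth moments bound the second
  moments of the products by \<open>3\<close>. It applies both to two coordinates of one Wiener process and to
  coordinates of two independent ones, which differ only in how the mixed moments are computed.\<close>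

lemma (in prob_space) L1_lim_gaussian_products:
  fixes g g' :: "nat \<Rightarrow> nat \<Rightarrow> 'a \<Rightarrow> real"
  assumes h: "\<And>n. 0 < h n"
    and meas: "\<And>n i. g n i \<in> borel_measurable M" "\<And>n i. g' n i \<in> borel_measurable M"
    and D: "\<And>n i. distributed M lborel (g n i) (normal_density 0 (sqrt (h n)))"
      "\<And>n i. distributed M lborel (g' n i) (normal_density 0 (sqrt (h n)))"
    and mean: "\<And>n i. expectation (\<lambda>\<omega>. g n i \<omega> * g' n i \<omega>) = \<mu> * h n"
    and uncorrelated: "\<And>n i j. i \<noteq> j \<Longrightarrow>
      expectation (\<lambda>\<omega>. (g n i \<omega> * g' n i \<omega>) * (g n j \<omega> * g' n j \<omega>)) = (\<mu> * h n)\<^sup>2"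
  shows "L1_lim M (\<lambda>n \<omega>. (\<Sum>i<n. g n i \<omega> * g' n i \<omega>) / (real n * h n)) \<mu>"
proof (rule L1_limI)
  note [measurable] = meas
  show "(\<lambda>\<omega>. (\<Sum>i<n. g n i \<omega> * g' n i \<omega>) / (real n * h n)) \<in> borel_measurable M" for n
    by measurable
  show "(\<lambda>n. (3 + 1) / sqrt (real n)) \<longlonglongrightarrow> 0"
    by (intro tendsto_divide_0[OF tendsto_const] filterlim_at_top_imp_at_infinity
        filterlim_compose[OF sqrt_at_top] filterlim_real_sequentially)
  fix n :: nat assume n: "0 < n"
  define Z where "Z i \<omega> = g n i \<omega> * g' n i \<omega> / h n" for i \<omega>
  have Zsq: "(Z i \<omega>)\<^sup>2 \<le> (g n i \<omega> ^ 4 + g' n i \<omega> ^ 4) / (2 * (h n)\<^sup>2)" for i \<omega>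
  proof -
    have "2 * ((g n i \<omega>)\<^sup>2 * (g' n i \<omega>)\<^sup>2) \<le> g n i \<omega> ^ 4 + g' n i \<omega> ^ 4"
      using sum_squares_bound[of "(g n i \<omega>)\<^sup>2" "(g' n i \<omega>)\<^sup>2"] by (simp add: mult.assoc flip: power_mult)
    then show ?thesis
      using h[of n] by (simp add: Z_def power_mult_distrib power_divide field_simps)
  qed
  have int4: "integrable M (\<lambda>\<omega>. (g n i \<omega> ^ 4 + g' n i \<omega> ^ 4) / (2 * (h n)\<^sup>2))" for i
    using normal_moments(1)[OF D(1) h] normal_moments(1)[OF D(2) h] by simp
  have intZ: "integrable M (\<lambda>\<omega>. (Z i \<omega>)\<^sup>2)" for i
    by (rule Bochner_Integration.integrable_bound[OF int4[of i]])
      (use order_trans[OF Zsq abs_ge_self] in \<open>auto simp: Z_def\<close>)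
  have "(\<integral>\<^sup>+\<omega>. ennreal (norm ((\<Sum>i<n. Z i \<omega>) / real n - \<mu>)) \<partial>M) \<le> ennreal ((3 + 1) / sqrt (real n))"
  proof (rule L1_weak_law[OF n])
    show "Z i \<in> borel_measurable M" for i unfolding Z_def by measurable
    show "integrable M (\<lambda>\<omega>. (Z i \<omega>)\<^sup>2)" for i by (rule intZ)
    show "expectation (\<lambda>\<omega>. (Z i \<omega>)\<^sup>2) \<le> 3" for i
    proof -
      have "expectation (\<lambda>\<omega>. (Z i \<omega>)\<^sup>2) \<le> expectation (\<lambda>\<omega>. (g n i \<omega> ^ 4 + g' n i \<omega> ^ 4) / (2 * (h n)\<^sup>2))"
        by (intro integral_mono intZ int4 Zsq)
      also have "\<dots> = 3"
        using normal_moments(1)[OF D(1) h, of n i 4] normal_moments(1)[OF D(2) h, of n i 4] h[of n]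
        by (simp add: normal_moments(4)[OF D(1) h] normal_moments(4)[OF D(2) h])
      finally show ?thesis .
    qed
    show "expectation (Z i) = \<mu>" for i
      unfolding Z_def[abs_def] using mean[of n i] h[of n] by simp
    show "expectation (\<lambda>\<omega>. Z i \<omega> * Z j \<omega>) = \<mu>\<^sup>2" if "i \<noteq> j" for i j
      unfolding Z_def using uncorrelated[OF that, of n] h[of n]
      by (simp add: power2_eq_square)
  qed
  moreover have "(\<Sum>i<n. Z i \<omega>) / real n = (\<Sum>i<n. g n i \<omega> * g' n i \<omega>) / (real n * h n)" for \<omega>
    using h[of n] by (simp add: Z_def sum_divide_distrib[symmetric] mult.commute)
  ultimately show "(\<integral>\<^sup>+\<omega>. ennreal (norm ((\<Sum>i<n. g n i \<omega> * g' n i \<omega>) / (real n * h n) - \<mu>)) \<partial>M) \<le> ennreal ((3 + 1) / sqrt (real n))"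
    by simp
qed

definition incr :: "(nat \<Rightarrow> real) \<Rightarrow> (real \<Rightarrow> 'a \<Rightarrow> 'b::real_vector) \<Rightarrow> nat \<Rightarrow> nat \<Rightarrow> 'a \<Rightarrow> 'b" where
  "incr h U n i \<omega> = U (real (Suc i) * h n) \<omega> - U (real i * h n) \<omega>"

context prob_space begin

lemma borel_measurable_incr:
  fixes U :: "real \<Rightarrow> 'a \<Rightarrow> real^'d"
  assumes "\<And>t. 0 \<le> t \<Longrightarrow> U t \<in> borel_measurable N" "\<And>n. 0 < h n"
  shows "incr h U n i \<in> borel_measurable N"
  unfolding incr_def[abs_def] using assms by (intro borel_measurable_diff) (simp_all add: less_imp_le)

lemma wiener_incr_measurable:
  assumes "standard_wiener M W" "\<And>n. 0 < h n"
  shows "incr h W n i \<in> borel_measurable M"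
  by (intro borel_measurable_incr) (use assms in \<open>auto simp: standard_wiener_def\<close>)

lemma wiener_incr_distributed:
  assumes W: "standard_wiener M W" and h: "\<And>n. 0 < h n"
  shows "distributed M lborel (\<lambda>\<omega>. incr h W n i \<omega> $ k) (normal_density 0 (sqrt (h n)))"
proof -
  have "real (Suc i) * h n - real i * h n = h n" by (simp add: algebra_simps)
  moreover have t: "0 \<le> real i * h n" "real i * h n < real (Suc i) * h n"
    using h[of n] by auto
  \<comment> \<open>The last clause of the definition, on a single increment.\<close>
  moreover note W[unfolded standard_wiener_def, THEN conjunct2, THEN conjunct2, THEN conjunct2,
      THEN conjunct2, rule_format, OF t, THEN conjunct2, rule_format, of k]
  ultimately show ?thesis by (simp only: incr_def)
qed

lemma wiener_incr_coords_indep: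
  assumes W: "standard_wiener M W" and h: "\<And>n. 0 < h n"
  shows "indep_vars (\<lambda>_. borel) (\<lambda>k \<omega>. incr h W n i \<omega> $ k) UNIV"
proof -
  have t: "0 \<le> real i * h n" "real i * h n < real (Suc i) * h n"
    using h[of n] by auto
  note W[unfolded standard_wiener_def, THEN conjunct2, THEN conjunct2, THEN conjunct2,
      THEN conjunct2, rule_format, OF t, THEN conjunct1]
  then show ?thesis by (simp only: incr_def)
qed

lemma wiener_incr_indep:
  assumes W: "standard_wiener M W" and h: "\<And>n. 0 < h n"
  shows "indep_vars (\<lambda>_. borel) (incr h W n) {..<N}"
proof -
  let ?t = "\<lambda>i. real i * h n"
  have t: "0 \<le> ?t 0" "\<And>i. i < N \<Longrightarrow> ?t i \<le> ?t (Suc i)" using h[of n] by auto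
  \<comment> \<open>The clause on the independence of successive increments.\<close>
  note W[unfolded standard_wiener_def, THEN conjunct2, THEN conjunct2, THEN conjunct2,
      THEN conjunct1, rule_format, OF t]
  then show ?thesis by (simp only: incr_def[abs_def])
qed

lemma expectation_indep_pair:
  fixes Z :: "'i \<Rightarrow> 'a \<Rightarrow> real"
  assumes ind: "indep_vars (\<lambda>_. borel) Z I" and ij: "i \<in> I" "j \<in> I" "i \<noteq> j"
    and int: "integrable M (Z i)" "integrable M (Z j)"
  shows "expectation (\<lambda>\<omega>. Z i \<omega> * Z j \<omega>) = expectation (Z i) * expectation (Z j)"
proof -
  have "indep_vars (\<lambda>_. borel) Z {i, j}"
    using indep_vars_subset[OF ind, of "{i, j}"] ij by simp
  from indep_vars_lebesgue_integral[OF _ this] show ?thesis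
    using ij int by auto
qed

lemma integrable_mult_normal:
  assumes "distributed M lborel X (normal_density 0 (sqrt v))" "distributed M lborel Y (normal_density 0 (sqrt v))" "0 < v"
  shows "integrable M (\<lambda>\<omega>. X \<omega> * Y \<omega>)"
proof (rule Bochner_Integration.integrable_bound)
  show "integrable M (\<lambda>\<omega>. (X \<omega>)\<^sup>2 + (Y \<omega>)\<^sup>2)"
    using normal_moments(1)[OF assms(1,3)] normal_moments(1)[OF assms(2,3)] by simp
  show "(\<lambda>\<omega>. X \<omega> * Y \<omega>) \<in> borel_measurable M"
    using assms(1,2)[THEN distributed_measurable] by simp
  show "AE \<omega> in M. norm (X \<omega> * Y \<omega>) \<le> norm ((X \<omega>)\<^sup>2 + (Y \<omega>)\<^sup>2)"
    using abs_mult_le_sum_squares by simp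
qed

lemma mean_outer_nth: "mean_outer h u v n \<omega> $ k $ l = (\<Sum>i<n. u n i \<omega> $ k * v n i \<omega> $ l) / (real n * h n)"
  by (simp add: mean_outer_def outer_prod_def)

lemma L1_lim_wiener_self:
  fixes W :: "real \<Rightarrow> 'a \<Rightarrow> real^'r"
  assumes W: "standard_wiener M W" and h: "\<And>n. 0 < h n"
  shows "L1_lim M (mean_outer h (incr h W) (incr h W)) (mat 1)"
proof (rule L1_lim_matrixI)
  fix k l :: 'r
  note D = wiener_incr_distributed[OF W h]
  note [measurable] = wiener_incr_measurable[OF W h]
  define \<mu> :: real where "\<mu> = mat 1 $ k $ l"
  have int: "integrable M (\<lambda>\<omega>. incr h W n i \<omega> $ k * incr h W n i \<omega> $ l)" for n i
    by (rule integrable_mult_normal[OF D D h])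
  have mean: "expectation (\<lambda>\<omega>. incr h W n i \<omega> $ k * incr h W n i \<omega> $ l) = \<mu> * h n" for n i
  proof (cases "k = l")
    case True
    then show ?thesis
      using normal_moments(3)[OF D h] by (simp add: \<mu>_def mat_def power2_eq_square)
  next
    case False
    have "integrable M (\<lambda>\<omega>. incr h W n i \<omega> $ k)" for k
      using normal_moments(1)[OF D h, where k = 1] by simp
    then show ?thesis
      using expectation_indep_pair[OF wiener_incr_coords_indep[OF W h, where n = n and i = i], of k l] False
        normal_moments(2)[OF D h]
      by (simp add: \<mu>_def mat_def)
  qed
  have "L1_lim M (\<lambda>n \<omega>. (\<Sum>i<n. incr h W n i \<omega> $ k * incr h W n i \<omega> $ l) / (real n * h n)) \<mu>"
  proof (rule L1_lim_gaussian_products[OF h _ _ D D mean])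
    fix n and i j :: nat assume ij: "i \<noteq> j"
    define N where "N = Suc (max i j)"
    have "indep_vars (\<lambda>_. borel) (\<lambda>i \<omega>. incr h W n i \<omega> $ k * incr h W n i \<omega> $ l) {..<N}"
      by (rule indep_vars_compose2[OF wiener_incr_indep[OF W h], where Y = "\<lambda>_ x. x $ k * x $ l"]) measurable
    from expectation_indep_pair[OF this, of i j] ij int mean
    show "expectation (\<lambda>\<omega>. (incr h W n i \<omega> $ k * incr h W n i \<omega> $ l) * (incr h W n j \<omega> $ k * incr h W n j \<omega> $ l))
       = (\<mu> * h n)\<^sup>2"
      by (auto simp: N_def power2_eq_square)
  qed measurable
  then show "L1_lim M (\<lambda>n \<omega>. mean_outer h (incr h W) (incr h W) n \<omega> $ k $ l) (mat 1 $ k $ l)"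
    by (simp add: mean_outer_nth \<mu>_def)
qed

text \<open>The events of a process as a measurable space, so that functions of the path can be shown to be
  measurable with respect to it.\<close>

definition process_algebra :: "(real \<Rightarrow> 'a \<Rightarrow> real^'r) \<Rightarrow> 'a measure" where
  "process_algebra W = sigma (space M) (\<Union>t\<in>{0..}. {W t -` A \<inter> space M | A. A \<in> sets borel})"

lemma sets_process_algebra: "sets (process_algebra W) = process_events M W"
  unfolding process_algebra_def process_events_def by (rule sets_measure_of) auto

lemma space_process_algebra: "space (process_algebra W) = space M"
  unfolding process_algebra_def by (rule space_measure_of) auto

lemma measurable_process_algebra:
  assumes "0 \<le> t"
  shows "W t \<in> borel_measurable (process_algebra W)"
proof (rule measurableI)
  fix A :: "(real^'b) set" assume "A \<in> sets borel"
  then show "W t -` A \<inter> space (process_algebra W) \<in> sets (process_algebra W)"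
    unfolding sets_process_algebra process_events_def space_process_algebra
    using assms by (intro sigma_sets.Basic) auto
qed simp

lemma sigma_sets_vimage_process_algebra:
  fixes Y :: "'a \<Rightarrow> real"
  assumes "Y \<in> borel_measurable (process_algebra W)"
  shows "sigma_sets (space M) {Y -` A \<inter> space M | A. A \<in> sets borel} \<subseteq> process_events M W"
proof -
  have "{Y -` A \<inter> space M | A. A \<in> sets borel} \<subseteq> sets (process_algebra W)"
    using measurable_sets[OF assms] by (auto simp: space_process_algebra)
  then show ?thesis
    using sets.sigma_sets_subset[of _ "process_algebra W"]
    by (simp add: space_process_algebra sets_process_algebra)
qed

lemma indep_var_process_events:
  fixes U V :: "'a \<Rightarrow> real"
  assumes ind: "indep_set (process_events M W) (process_events M W')"
    and U: "U \<in> borel_measurable (process_algebra W)"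
    and V: "V \<in> borel_measurable (process_algebra W')"
  shows "indep_var borel U borel V"
proof -
  have ev: "process_events M W \<subseteq> events" "process_events M W' \<subseteq> events"
    using indep_setD_ev1[OF ind] indep_setD_ev2[OF ind] by auto
  have "U \<in> borel_measurable M" "V \<in> borel_measurable M"
    using measurable_sets[OF U] measurable_sets[OF V] ev
    by (auto intro!: measurableI simp: space_process_algebra sets_process_algebra)
  moreover have "indep_set (sigma_sets (space M) {U -` A \<inter> space M | A. A \<in> sets borel})
      (sigma_sets (space M) {V -` A \<inter> space M | A. A \<in> sets borel})"
    using ind sigma_sets_vimage_process_algebra[OF U] sigma_sets_vimage_process_algebra[OF V]
    unfolding indep_sets2_eq by blast
  ultimately show ?thesis by (simp add: indep_var_eq)
qed

text \<open>For \<open>i \<noteq> j\<close> the mixed moment factors through the independence of the two processes, and the factor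
  belonging to \<open>W\<close> alone vanishes by the independence of its increments.\<close>

lemma L1_lim_wiener_cross:
  fixes W :: "real \<Rightarrow> 'a \<Rightarrow> real^'r" and W' :: "real \<Rightarrow> 'a \<Rightarrow> real^'s"
  assumes W: "standard_wiener M W" and W': "standard_wiener M W'"
    and ind: "indep_set (process_events M W) (process_events M W')"
    and h: "\<And>n. 0 < h n"
  shows "L1_lim M (mean_outer h (incr h W) (incr h W')) 0"
proof (rule L1_lim_matrixI)
  fix k :: 'r and l :: 's
  note D = wiener_incr_distributed[OF W h] and D' = wiener_incr_distributed[OF W' h]
  note [measurable] = wiener_incr_measurable[OF W h] wiener_incr_measurable[OF W' h]
  have alg: "incr h W n i \<in> borel_measurable (process_algebra W)" "incr h W' n i \<in> borel_measurable (process_algebra W')" for n i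
    by (intro borel_measurable_incr measurable_process_algebra h; simp)+
  have int1: "integrable M (\<lambda>\<omega>. incr h W n i \<omega> $ k)" "integrable M (\<lambda>\<omega>. incr h W' n i \<omega> $ l)" for n i
    using normal_moments(1)[OF D h, where k = 1] normal_moments(1)[OF D' h, where k = 1] by simp_all
  have mean: "expectation (\<lambda>\<omega>. incr h W n i \<omega> $ k * incr h W' n i \<omega> $ l) = 0 * h n" for n i
  proof -
    have "indep_var borel (\<lambda>\<omega>. incr h W n i \<omega> $ k) borel (\<lambda>\<omega>. incr h W' n i \<omega> $ l)"
      by (intro indep_var_process_events[OF ind] borel_measurable_vec_nth_real alg)
    from indep_var_lebesgue_integral[OF this int1] show ?thesis
      using normal_moments(2)[OF D h] by simp
  qed
  have "L1_lim M (\<lambda>n \<omega>. (\<Sum>i<n. incr h W n i \<omega> $ k * incr h W' n i \<omega> $ l) / (real n * h n)) 0"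
  proof (rule L1_lim_gaussian_products[OF h _ _ D D' mean])
    fix n and i j :: nat assume ij: "i \<noteq> j"
    define N where "N = Suc (max i j)"
    have "indep_vars (\<lambda>_. borel) (\<lambda>i \<omega>. incr h W n i \<omega> $ k) {..<N}"
      by (rule indep_vars_compose2[OF wiener_incr_indep[OF W h], where Y = "\<lambda>_ x. x $ k"]) measurable
    from expectation_indep_pair[OF this, of i j] ij int1
    have zero: "expectation (\<lambda>\<omega>. incr h W n i \<omega> $ k * incr h W n j \<omega> $ k) = 0"
      using normal_moments(2)[OF D h] by (auto simp: N_def)
    have "indep_var borel (\<lambda>\<omega>. incr h W n i \<omega> $ k * incr h W n j \<omega> $ k)
         borel (\<lambda>\<omega>. incr h W' n i \<omega> $ l * incr h W' n j \<omega> $ l)"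
      by (intro indep_var_process_events[OF ind] borel_measurable_times borel_measurable_vec_nth_real alg)
    from indep_var_lebesgue_integral[OF this integrable_mult_normal[OF D D h] integrable_mult_normal[OF D' D' h]]
    show "expectation (\<lambda>\<omega>. (incr h W n i \<omega> $ k * incr h W' n i \<omega> $ l) * (incr h W n j \<omega> $ k * incr h W' n j \<omega> $ l))
       = (0 * h n)\<^sup>2"
      by (simp add: zero mult_ac)
  qed measurable
  then show "L1_lim M (\<lambda>n \<omega>. mean_outer h (incr h W) (incr h W') n \<omega> $ k $ l) (0 $ k $ l)"
    by (simp add: mean_outer_nth)
qed

end

section \<open>Increments of the latent diffusions\<close>

lemma integral_split_equal_parts:
  fixes f :: "real \<Rightarrow> 'b::banach"
  assumes f: "f integrable_on {a..a + real N * d}" and d: "0 \<le> d"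
  shows "integral {a..a + real N * d} f = (\<Sum>j<N. integral {a + real j * d..a + real (Suc j) * d} f)"
  using f
proof (induction N)
  case (Suc N)
  have le: "a \<le> a + real N * d" "a + real N * d \<le> a + real (Suc N) * d"
    using d by (auto simp: algebra_simps)
  have "f integrable_on {a..a + real N * d}"
    using le by (intro integrable_subinterval_real[OF Suc.prems]) auto
  then show ?case
    using Suc.IH Henstock_Kurzweil_Integration.integral_combine[OF le Suc.prems] by simp
qed simp

lemma riemann_sums_tendsto:
  fixes f :: "real \<Rightarrow> 'b::euclidean_space"
  assumes f: "continuous_on {a..a + T} f" and T: "0 \<le> T"
  shows "(\<lambda>N. (T / real N) *\<^sub>R (\<Sum>j<N. f (a + real j * (T / real N)))) \<longlonglongrightarrow> integral {a..a + T} f"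
proof (rule LIMSEQ_I)
  fix r :: real assume r: "0 < r"
  define e where "e = r / (T + 1)"
  have e: "0 < e" "T * e < r" using r T by (auto simp: e_def field_simps)
  have "uniformly_continuous_on {a..a + T} f"
    by (rule compact_uniformly_continuous[OF f]) simp
  then obtain d where d: "0 < d" "\<And>x y. x \<in> {a..a + T} \<Longrightarrow> y \<in> {a..a + T} \<Longrightarrow> dist y x < d \<Longrightarrow> dist (f y) (f x) < e"
    unfolding uniformly_continuous_on_def using e(1) by metis
  obtain N0 :: nat where N0: "T / d < real N0" using reals_Archimedean2 by blast
  have "norm ((T / real N) *\<^sub>R (\<Sum>j<N. f (a + real j * (T / real N))) - integral {a..a + T} f) < r" if N: "N0 \<le> N" for N
  proof -
    have "0 \<le> T / d" using T d by simp
    then have Npos: "0 < N" using N N0 by (cases N) auto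
    define s where "s = T / real N"
    have s: "0 \<le> s" "real N * s = T" using Npos T by (auto simp: s_def)
    have sd: "s < d"
    proof -
      have "T / d < real N" using N N0 by linarith
      then have "T < real N * d" using d(1) by (simp add: field_simps)
      then show ?thesis using Npos by (simp add: s_def field_simps)
    qed
    have intf: "f integrable_on {a..a + real N * s}"
      using f s(2) by (simp add: integrable_continuous_interval)
    have part: "norm (s *\<^sub>R f (a + real j * s) - integral {a + real j * s..a + real (Suc j) * s} f) \<le> s * e" if j: "j < N" for j
    proof -
      let ?u = "a + real j * s" and ?v = "a + real (Suc j) * s"
      have "real (Suc j) * s \<le> real N * s" using j s(1) by (intro mult_right_mono) auto
      then have sub: "{?u..?v} \<subseteq> {a..a + T}" "?u \<le> ?v" "?v - ?u = s"
        using s by (auto simp: algebra_simps)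
      have cont: "continuous_on {?u..?v} f" by (rule continuous_on_subset[OF f sub(1)])
      then have int: "f integrable_on {?u..?v}" by (rule integrable_continuous_interval)
      have "integral {?u..?v} (\<lambda>x. f ?u - f x) = integral {?u..?v} (\<lambda>x. f ?u) - integral {?u..?v} f"
        by (intro Henstock_Kurzweil_Integration.integral_diff int integrable_const_ivl)
      then have eq: "s *\<^sub>R f ?u - integral {?u..?v} f = integral {?u..?v} (\<lambda>x. f ?u - f x)"
        using sub(2,3) by simp
      have "norm (integral {?u..?v} (\<lambda>x. f ?u - f x)) \<le> e * (?v - ?u)"
      proof (rule integral_bound[OF sub(2)])
        show "continuous_on {?u..?v} (\<lambda>x. f ?u - f x)" by (intro continuous_intros cont)
        fix x assume x: "x \<in> {?u..?v}"
        have "dist (f ?u) (f x) < e"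
        proof (rule d(2))
          show "x \<in> {a..a + T}" using sub(1) x by (rule subsetD)
          have "?u \<in> {?u..?v}" using sub(2) by simp
          with sub(1) show "?u \<in> {a..a + T}" by (rule subsetD)
          show "dist ?u x < d" using x sub(3) sd by (auto simp: dist_real_def)
        qed
        then show "norm (f ?u - f x) \<le> e" by (simp add: dist_norm)
      qed
      then show ?thesis unfolding eq sub(3) by (simp add: mult.commute)
    qed
    have "integral {a..a + T} f = (\<Sum>j<N. integral {a + real j * s..a + real (Suc j) * s} f)"
      using integral_split_equal_parts[OF intf s(1)] s(2) by simp
    then have "s *\<^sub>R (\<Sum>j<N. f (a + real j * s)) - integral {a..a + T} f
        = (\<Sum>j<N. s *\<^sub>R f (a + real j * s) - integral {a + real j * s..a + real (Suc j) * s} f)"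
      by (simp add: scaleR_sum_right sum_subtractf)
    also have "norm \<dots> \<le> (\<Sum>j<N. s * e)"
      by (rule sum_norm_le) (use part in auto)
    also have "\<dots> = T * e" using s(2) by simp
    finally show ?thesis using e(2) by (simp add: s_def)
  qed
  then show "\<exists>N0. \<forall>N\<ge>N0. norm ((T / real N) *\<^sub>R (\<Sum>j<N. f (a + real j * (T / real N))) - integral {a..a + T} f) < r"
    by blast
qed

lemma norm_sum_square_le:
  fixes f :: "nat \<Rightarrow> 'b::real_normed_vector"
  shows "(norm (\<Sum>j<N. f j))\<^sup>2 \<le> real N * (\<Sum>j<N. (norm (f j))\<^sup>2)"
proof -
  have "(norm (\<Sum>j<N. f j))\<^sup>2 \<le> (\<Sum>j<N. norm (f j))\<^sup>2"
    by (intro power_mono norm_sum) simp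
  also have "\<dots> \<le> real N * (\<Sum>j<N. (norm (f j))\<^sup>2)"
    using sum_squared_le_sum_of_squares[of "\<lambda>j. norm (f j)" "{..<N}"] by (simp add: mult.commute)
  finally show ?thesis .
qed

text \<open>The pathwise integral is a limit of Riemann sums, whose second moments are bounded by convexity of
  the square; Fatou's lemma passes to the limit. The sums involve fixed times only, so measurability
  of each \<open>G t\<close> suffices.\<close>

lemma nn_integral_integral_square_le:
  fixes G :: "real \<Rightarrow> 'a \<Rightarrow> real^'d"
  assumes T: "0 \<le> T" and meas: "\<And>t. t \<in> {a..a + T} \<Longrightarrow> G t \<in> borel_measurable M"
    and cont: "\<And>\<omega>. \<omega> \<in> space M \<Longrightarrow> continuous_on {a..a + T} (\<lambda>t. G t \<omega>)"
    and K: "0 \<le> K" "\<And>t. t \<in> {a..a + T} \<Longrightarrow> (\<integral>\<^sup>+\<omega>. ennreal ((norm (G t \<omega>))\<^sup>2) \<partial>M) \<le> ennreal K"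
  shows "(\<integral>\<^sup>+\<omega>. ennreal ((norm (integral {a..a + T} (\<lambda>t. G t \<omega>)))\<^sup>2) \<partial>M) \<le> ennreal (K * T\<^sup>2)"
proof -
  define t where "t N j = a + real j * (T / real N)" for N j :: nat
  define R where "R N \<omega> = (T / real N) *\<^sub>R (\<Sum>j<N. G (t N j) \<omega>)" for N \<omega>
  have t: "t N j \<in> {a..a + T}" if "j < N" for N j
  proof -
    have "real j * T \<le> real N * T" using that T by (intro mult_right_mono) auto
    then have "real j * (T / real N) \<le> T" using that by (simp add: field_simps)
    then show ?thesis using T by (simp add: t_def)
  qed
  note tmeas [measurable] = meas[OF t]
  have Rmeas [measurable]: "R N \<in> borel_measurable M" for N
    unfolding R_def[abs_def] using tmeas by (intro borel_measurable_scaleR borel_measurable_sum) auto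
  have bound: "(\<integral>\<^sup>+\<omega>. ennreal ((norm (R N \<omega>))\<^sup>2) \<partial>M) \<le> ennreal (K * T\<^sup>2)" for N
  proof (cases "N = 0")
    case True
    then show ?thesis by (simp add: R_def)
  next
    case False
    have "(norm (R N \<omega>))\<^sup>2 \<le> (T\<^sup>2 / real N) * (\<Sum>j<N. (norm (G (t N j) \<omega>))\<^sup>2)" for \<omega>
    proof -
      have "(norm (R N \<omega>))\<^sup>2 = (T / real N)\<^sup>2 * (norm (\<Sum>j<N. G (t N j) \<omega>))\<^sup>2"
        by (simp add: R_def power_mult_distrib power_divide)
      also have "\<dots> \<le> (T / real N)\<^sup>2 * (real N * (\<Sum>j<N. (norm (G (t N j) \<omega>))\<^sup>2))"
        by (intro mult_left_mono norm_sum_square_le) simp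
      finally show ?thesis using False by (simp add: power2_eq_square)
    qed
    then have "(\<integral>\<^sup>+\<omega>. ennreal ((norm (R N \<omega>))\<^sup>2) \<partial>M)
        \<le> (\<integral>\<^sup>+\<omega>. ennreal (T\<^sup>2 / real N) * (\<Sum>j<N. ennreal ((norm (G (t N j) \<omega>))\<^sup>2)) \<partial>M)"
      by (intro nn_integral_mono) (simp add: sum_nonneg flip: ennreal_mult)
    also have "\<dots> = ennreal (T\<^sup>2 / real N) * (\<Sum>j<N. \<integral>\<^sup>+\<omega>. ennreal ((norm (G (t N j) \<omega>))\<^sup>2) \<partial>M)"
      by (subst nn_integral_cmult; (subst nn_integral_sum)?) (use tmeas in \<open>auto intro!: borel_measurable_sum simp del: sum_ennreal\<close>)
    also have "\<dots> \<le> ennreal (T\<^sup>2 / real N) * (\<Sum>j<N. ennreal K)"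
      by (intro mult_left_mono sum_mono K t) auto
    also have "\<dots> = ennreal (K * T\<^sup>2)"
      using False K(1) by (simp add: ennreal_mult[symmetric] ennreal_of_nat_eq_real_of_nat mult.commute)
    finally show ?thesis .
  qed
  have "(\<integral>\<^sup>+\<omega>. ennreal ((norm (integral {a..a + T} (\<lambda>t. G t \<omega>)))\<^sup>2) \<partial>M)
     = (\<integral>\<^sup>+\<omega>. liminf (\<lambda>N. ennreal ((norm (R N \<omega>))\<^sup>2)) \<partial>M)"
  proof (rule nn_integral_cong)
    fix \<omega> assume "\<omega> \<in> space M"
    then have "(\<lambda>N. R N \<omega>) \<longlonglongrightarrow> integral {a..a + T} (\<lambda>t. G t \<omega>)"
      unfolding R_def t_def by (intro riemann_sums_tendsto cont T)
    then have "(\<lambda>N. ennreal ((norm (R N \<omega>))\<^sup>2)) \<longlonglongrightarrow> ennreal ((norm (integral {a..a + T} (\<lambda>t. G t \<omega>)))\<^sup>2)"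
      by (intro tendsto_intros)
    then show "ennreal ((norm (integral {a..a + T} (\<lambda>t. G t \<omega>)))\<^sup>2) = liminf (\<lambda>N. ennreal ((norm (R N \<omega>))\<^sup>2))"
      by (intro lim_imp_Liminf[symmetric]) auto
  qed
  also have "\<dots> \<le> liminf (\<lambda>N. \<integral>\<^sup>+\<omega>. ennreal ((norm (R N \<omega>))\<^sup>2) \<partial>M)"
    by (rule nn_integral_liminf) measurable
  also have "\<dots> \<le> limsup (\<lambda>N. \<integral>\<^sup>+\<omega>. ennreal ((norm (R N \<omega>))\<^sup>2) \<partial>M)"
    by (rule Liminf_le_Limsup) simp
  also have "\<dots> \<le> ennreal (K * T\<^sup>2)"
    by (rule Limsup_bounded) (simp add: bound)
  finally show ?thesis .
qed

lemma bounded_moments_imp_second_moment: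
  assumes "bounded_moments M Y"
  obtains C where "0 \<le> C" "\<And>t. 0 \<le> t \<Longrightarrow> (\<integral>\<^sup>+\<omega>. ennreal ((norm (Y t \<omega>))\<^sup>2) \<partial>M) \<le> ennreal C"
proof -
  define s where "s = (SUP t\<in>{0..}. \<integral>\<^sup>+\<omega>. ennreal (norm (Y t \<omega>) powr 2) \<partial>M)"
  have "s < \<infinity>"
    unfolding s_def using assms[unfolded bounded_moments_def, rule_format, of 2] by simp
  then obtain C where C: "0 \<le> C" "s = ennreal C" by (cases s) auto
  show ?thesis
  proof (rule that[OF C(1)])
    fix t :: real assume "0 \<le> t"
    then have "(\<integral>\<^sup>+\<omega>. ennreal (norm (Y t \<omega>) powr 2) \<partial>M) \<le> s"
      unfolding s_def by (intro SUP_upper) simp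
    then show "(\<integral>\<^sup>+\<omega>. ennreal ((norm (Y t \<omega>))\<^sup>2) \<partial>M) \<le> ennreal C"
      using C by (simp add: powr_numeral)
  qed
qed

lemma lipschitz_second_moment:
  assumes B: "L-lipschitz_on UNIV B" and Y: "Y \<in> borel_measurable M" and M: "prob_space M"
    and C: "0 \<le> C" "(\<integral>\<^sup>+\<omega>. ennreal ((norm (Y \<omega>))\<^sup>2) \<partial>M) \<le> ennreal C"
  shows "(\<integral>\<^sup>+\<omega>. ennreal ((norm (B (Y \<omega>)))\<^sup>2) \<partial>M) \<le> ennreal (2 * (norm (B 0))\<^sup>2 + 2 * L\<^sup>2 * C)"
proof -
  interpret prob_space M by fact
  have "(norm (B y))\<^sup>2 \<le> 2 * (norm (B 0))\<^sup>2 + 2 * L\<^sup>2 * (norm y)\<^sup>2" for y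
  proof -
    have "norm (B y - B 0) \<le> L * norm y"
      using lipschitz_onD[OF B, of y 0] by (simp add: dist_norm)
    then have "norm (B y) \<le> norm (B 0) + L * norm y"
      using norm_triangle_sub[of "B y" "B 0"] by linarith
    then have "(norm (B y))\<^sup>2 \<le> (norm (B 0) + L * norm y)\<^sup>2"
      by (intro power_mono) auto
    also have "\<dots> \<le> 2 * (norm (B 0))\<^sup>2 + 2 * (L * norm y)\<^sup>2"
      using sum_squares_bound[of "norm (B 0)" "L * norm y"] by (simp add: power2_sum)
    finally show ?thesis by (simp add: power_mult_distrib)
  qed
  then have "(\<integral>\<^sup>+\<omega>. ennreal ((norm (B (Y \<omega>)))\<^sup>2) \<partial>M)
      \<le> (\<integral>\<^sup>+\<omega>. ennreal (2 * (norm (B 0))\<^sup>2) + ennreal (2 * L\<^sup>2) * ennreal ((norm (Y \<omega>))\<^sup>2) \<partial>M)"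
    by (intro nn_integral_mono) (simp flip: ennreal_mult ennreal_plus)
  also have "\<dots> = ennreal (2 * (norm (B 0))\<^sup>2) + ennreal (2 * L\<^sup>2) * (\<integral>\<^sup>+\<omega>. ennreal ((norm (Y \<omega>))\<^sup>2) \<partial>M)"
    using Y by (simp add: nn_integral_add nn_integral_cmult emeasure_space_1)
  also have "\<dots> \<le> ennreal (2 * (norm (B 0))\<^sup>2) + ennreal (2 * L\<^sup>2) * ennreal C"
    by (intro add_mono mult_left_mono C) auto
  also have "\<dots> = ennreal (2 * (norm (B 0))\<^sup>2 + 2 * L\<^sup>2 * C)"
    using C(1) by (simp add: ennreal_mult)
  finally show ?thesis .
qed

text \<open>What remains of an increment of \<open>Y\<close> after its Gaussian part; almost surely this is the integral of
  the drift over the interval.\<close>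

definition drift_part where
  "drift_part h S W Y n i \<omega> = incr h Y n i \<omega> - S *v incr h W n i \<omega>"

context prob_space begin

text \<open>A Lipschitz drift grows linearly, so its second moment along \<open>Y\<close> is bounded in time, and integrating
  over an interval of length \<open>h\<close> gives the factor \<open>h\<^sup>2\<close>.\<close>

lemma drift_part_second_moment:
  fixes Y :: "real \<Rightarrow> 'a \<Rightarrow> real^'d" and W :: "real \<Rightarrow> 'a \<Rightarrow> real^'r"
  assumes sde: "sde_solution M W B S y0 Y" and B: "regular_drift B" and Y: "bounded_moments M Y"
    and h: "\<And>n. 0 < h n"
  obtains K where "0 \<le> K"
    "\<And>n i. (\<integral>\<^sup>+\<omega>. ennreal ((norm (drift_part h S W Y n i \<omega>))\<^sup>2) \<partial>M) \<le> ennreal (K * (h n)\<^sup>2)"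
proof -
  obtain L where L: "L-lipschitz_on UNIV B" using B by (auto simp: regular_drift_def)
  obtain C where C: "0 \<le> C" "\<And>t. 0 \<le> t \<Longrightarrow> (\<integral>\<^sup>+\<omega>. ennreal ((norm (Y t \<omega>))\<^sup>2) \<partial>M) \<le> ennreal C"
    using bounded_moments_imp_second_moment[OF Y] by blast
  define K where "K = 2 * (norm (B 0))\<^sup>2 + 2 * L\<^sup>2 * C"
  have K: "0 \<le> K" using C(1) by (simp add: K_def)
  have meas: "\<And>t. 0 \<le> t \<Longrightarrow> Y t \<in> borel_measurable M"
    and cont: "\<And>\<omega>. \<omega> \<in> space M \<Longrightarrow> continuous_on {0..} (\<lambda>t. Y t \<omega>)"
    and eq: "AE \<omega> in M. \<forall>t\<ge>0. Y t \<omega> = y0 + integral {0..t} (\<lambda>s. B (Y s \<omega>)) + S *v W t \<omega>"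
    using sde by (auto simp: sde_solution_def)
  have Bcont: "continuous_on UNIV B" by (rule lipschitz_on_continuous_on[OF L])
  have BYcont: "continuous_on {0..} (\<lambda>t. B (Y t \<omega>))" if "\<omega> \<in> space M" for \<omega>
    by (rule continuous_on_compose2[OF Bcont cont[OF that]]) simp
  show ?thesis
  proof (rule that[OF K])
    fix n i
    define a where "a = real i * h n"
    have a: "0 \<le> a" "real (Suc i) * h n = a + h n" using h[of n] by (auto simp: a_def algebra_simps)
    have "AE \<omega> in M. drift_part h S W Y n i \<omega> = integral {a..a + h n} (\<lambda>s. B (Y s \<omega>))"
      using eq AE_space
    proof eventually_elim
      fix \<omega> assume *: "\<forall>t\<ge>0. Y t \<omega> = y0 + integral {0..t} (\<lambda>s. B (Y s \<omega>)) + S *v W t \<omega>" and \<omega>: "\<omega> \<in> space M"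
      have le: "a \<le> a + h n" using h[of n] by simp
      have "(\<lambda>s. B (Y s \<omega>)) integrable_on {0..a + h n}"
        by (intro integrable_continuous_interval continuous_on_subset[OF BYcont[OF \<omega>]]) auto
      then have "integral {0..a} (\<lambda>s. B (Y s \<omega>)) + integral {a..a + h n} (\<lambda>s. B (Y s \<omega>))
          = integral {0..a + h n} (\<lambda>s. B (Y s \<omega>))"
        by (rule Henstock_Kurzweil_Integration.integral_combine[OF a(1) le])
      then show "drift_part h S W Y n i \<omega> = integral {a..a + h n} (\<lambda>s. B (Y s \<omega>))"
        using *[rule_format, OF a(1)] *[rule_format, of "a + h n"] a(1) le
        by (simp add: drift_part_def incr_def a(2) a_def[symmetric] matrix_vector_mult_diff_distrib algebra_simps)
    qed
    then have "(\<integral>\<^sup>+\<omega>. ennreal ((norm (drift_part h S W Y n i \<omega>))\<^sup>2) \<partial>M)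
      = (\<integral>\<^sup>+\<omega>. ennreal ((norm (integral {a..a + h n} (\<lambda>s. B (Y s \<omega>))))\<^sup>2) \<partial>M)"
      by (intro nn_integral_cong_AE) auto
    also have "\<dots> \<le> ennreal (K * (h n)\<^sup>2)"
    proof (rule nn_integral_integral_square_le[OF less_imp_le[OF h] _ _ K])
      fix t assume "t \<in> {a..a + h n}"
      then have t: "0 \<le> t" using a(1) by simp
      show "(\<lambda>\<omega>. B (Y t \<omega>)) \<in> borel_measurable M"
        by (rule borel_measurable_continuous_on[OF Bcont meas[OF t]])
      show "(\<integral>\<^sup>+\<omega>. ennreal ((norm (B (Y t \<omega>)))\<^sup>2) \<partial>M) \<le> ennreal K"
        unfolding K_def by (rule lipschitz_second_moment[OF L meas[OF t] prob_space_axioms C(1) C(2)[OF t]])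
    next
      fix \<omega> assume "\<omega> \<in> space M"
      then show "continuous_on {a..a + h n} (\<lambda>t. B (Y t \<omega>))"
        using a(1) by (intro continuous_on_subset[OF BYcont]) auto
    qed
    finally show "(\<integral>\<^sup>+\<omega>. ennreal ((norm (drift_part h S W Y n i \<omega>))\<^sup>2) \<partial>M) \<le> ennreal (K * (h n)\<^sup>2)" .
  qed
qed

lemma noise_part_second_moment:
  fixes W :: "real \<Rightarrow> 'a \<Rightarrow> real^'r" and S :: "real^'r^'d"
  assumes W: "standard_wiener M W" and h: "\<And>n. 0 < h n"
  obtains K where "0 \<le> K"
    "\<And>n i. (\<integral>\<^sup>+\<omega>. ennreal ((norm (S *v incr h W n i \<omega>))\<^sup>2) \<partial>M) \<le> ennreal (K * h n)"
proof (rule that)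
  let ?K = "(norm S)\<^sup>2 * real CARD('r)"
  show "0 \<le> ?K" by simp
  fix n i
  note D = wiener_incr_distributed[OF W h]
  note [measurable] = wiener_incr_measurable[OF W h]
  have norm: "(norm x)\<^sup>2 = (\<Sum>k\<in>UNIV. (x $ k)\<^sup>2)" for x :: "real^'r"
    unfolding power2_norm_eq_inner by (simp add: inner_vec_def power2_eq_square)
  have sq: "(\<integral>\<^sup>+\<omega>. ennreal ((incr h W n i \<omega> $ k)\<^sup>2) \<partial>M) = ennreal (h n)" for k
    using normal_moments(1)[OF D h, where k = 2] normal_moments(3)[OF D h]
    by (subst nn_integral_eq_integral) auto
  have "(\<integral>\<^sup>+\<omega>. ennreal ((norm (S *v incr h W n i \<omega>))\<^sup>2) \<partial>M)
     \<le> (\<integral>\<^sup>+\<omega>. ennreal ((norm S)\<^sup>2) * (\<Sum>k\<in>UNIV. ennreal ((incr h W n i \<omega> $ k)\<^sup>2)) \<partial>M)"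
  proof (rule nn_integral_mono)
    fix \<omega>
    have "(norm (S *v incr h W n i \<omega>))\<^sup>2 \<le> (norm S * norm (incr h W n i \<omega>))\<^sup>2"
      by (intro power_mono norm_matrix_vector_mult_le) simp
    then show "ennreal ((norm (S *v incr h W n i \<omega>))\<^sup>2)
        \<le> ennreal ((norm S)\<^sup>2) * (\<Sum>k\<in>UNIV. ennreal ((incr h W n i \<omega> $ k)\<^sup>2))"
      by (simp add: power_mult_distrib norm sum_nonneg flip: ennreal_mult)
  qed
  also have "\<dots> = ennreal ((norm S)\<^sup>2) * (\<Sum>k\<in>(UNIV :: 'r set). ennreal (h n))"
    by (simp add: nn_integral_cmult nn_integral_sum sq del: sum_ennreal sum_constant)
  also have "\<dots> = ennreal (?K * h n)"
    using h[of n] by (simp add: ennreal_mult[symmetric] ennreal_of_nat_eq_real_of_nat mult.assoc)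
  finally show "(\<integral>\<^sup>+\<omega>. ennreal ((norm (S *v incr h W n i \<omega>))\<^sup>2) \<partial>M) \<le> ennreal (?K * h n)" .
qed

lemma drift_part_measurable:
  assumes "sde_solution M W B S y0 Y" "standard_wiener M W" "\<And>n. 0 < h n"
  shows "drift_part h S W Y n i \<in> borel_measurable M"
proof -
  have "incr h Y n i \<in> borel_measurable M"
    by (intro borel_measurable_incr) (use assms in \<open>auto simp: sde_solution_def\<close>)
  then show ?thesis
    unfolding drift_part_def[abs_def]
    by (intro borel_measurable_diff borel_measurable_matrix_vector_mult
        wiener_incr_measurable[OF assms(2,3)])
qed

text \<open>Split both increments into drift part and Gaussian part. Three of the four products contain a
  drift part and are negligible; the fourth is a linear image of the covariation of the noises.\<close>

theorem L1_lim_realized_covariation: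
  fixes Y :: "real \<Rightarrow> 'a \<Rightarrow> real^'d" and W :: "real \<Rightarrow> 'a \<Rightarrow> real^'r"
    and Y' :: "real \<Rightarrow> 'a \<Rightarrow> real^'e" and W' :: "real \<Rightarrow> 'a \<Rightarrow> real^'s"
  assumes h: "\<And>n. 0 < h n" "h \<longlonglongrightarrow> 0"
    and W: "standard_wiener M W" and W': "standard_wiener M W'"
    and sde: "sde_solution M W B S y0 Y" and sde': "sde_solution M W' B' S' y0' Y'"
    and B: "regular_drift B" "regular_drift B'" and Y: "bounded_moments M Y" "bounded_moments M Y'"
    and G: "L1_lim M (mean_outer h (incr h W) (incr h W')) G"
  shows "L1_lim M (mean_outer h (incr h Y) (incr h Y')) (S ** G ** transpose S')"
proof -
  let ?A = "drift_part h S W Y" and ?A' = "drift_part h S' W' Y'"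
  let ?N = "\<lambda>n i \<omega>. S *v incr h W n i \<omega>" and ?N' = "\<lambda>n i \<omega>. S' *v incr h W' n i \<omega>"
  obtain K where K: "0 \<le> K" "\<And>n i. (\<integral>\<^sup>+\<omega>. ennreal ((norm (?A n i \<omega>))\<^sup>2) \<partial>M) \<le> ennreal (K * (h n)\<^sup>2)"
    by (rule drift_part_second_moment[OF sde B(1) Y(1) h(1)]) (rule that, assumption, assumption)
  obtain K' where K': "0 \<le> K'" "\<And>n i. (\<integral>\<^sup>+\<omega>. ennreal ((norm (?A' n i \<omega>))\<^sup>2) \<partial>M) \<le> ennreal (K' * (h n)\<^sup>2)"
    by (rule drift_part_second_moment[OF sde' B(2) Y(2) h(1)]) (rule that, assumption, assumption)
  obtain L where L: "0 \<le> L" "\<And>n i. (\<integral>\<^sup>+\<omega>. ennreal ((norm (?N n i \<omega>))\<^sup>2) \<partial>M) \<le> ennreal (L * h n)"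
    by (rule noise_part_second_moment[OF W h(1), of S]) (rule that, assumption, assumption)
  obtain L' where L': "0 \<le> L'" "\<And>n i. (\<integral>\<^sup>+\<omega>. ennreal ((norm (?N' n i \<omega>))\<^sup>2) \<partial>M) \<le> ennreal (L' * h n)"
    by (rule noise_part_second_moment[OF W' h(1), of S']) (rule that, assumption, assumption)
  have mA: "?A n i \<in> borel_measurable M" "?A' n i \<in> borel_measurable M" for n i
    by (rule drift_part_measurable[OF sde W h(1)], rule drift_part_measurable[OF sde' W' h(1)])
  have mN: "?N n i \<in> borel_measurable M" "?N' n i \<in> borel_measurable M" for n i
    by (intro borel_measurable_matrix_vector_mult wiener_incr_measurable W W' h)+
  obtain H where H: "\<And>n. h n \<le> H"
    using convergent_imp_bounded[OF h(2)] h(1) by (auto simp: bounded_iff abs_of_pos)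
  have H0: "0 \<le> H" using h(1)[of 0] H[of 0] by linarith
  have A'2: "(\<integral>\<^sup>+\<omega>. ennreal ((norm (?A' n i \<omega>))\<^sup>2) \<partial>M) \<le> ennreal (K' * H * h n)" for n i
  proof -
    have "K' * (h n)\<^sup>2 \<le> K' * H * h n"
      using K'(1) H[of n] h(1)[of n] by (simp add: power2_eq_square mult.assoc mult_left_mono mult_right_mono)
    then show ?thesis using K'(2)[of n i] by (meson ennreal_leI order_trans)
  qed
  have AA: "L1_lim M (mean_outer h ?A ?A') 0"
    by (rule L1_lim_mean_outer_negligible[OF h mA K _ A'2]) (use K'(1) H0 in simp)
  have AN: "L1_lim M (mean_outer h ?A ?N') 0"
    by (rule L1_lim_mean_outer_negligible[OF h mA(1) mN(2) K L'])
  have NA: "L1_lim M (mean_outer h ?N ?A') 0"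
    using L1_lim_mean_outer_swap[OF L1_lim_mean_outer_negligible[OF h mA(2) mN(1) K' L]]
    by (simp only: transpose_zero)
  have NN: "L1_lim M (mean_outer h ?N ?N') (S ** G ** transpose S')"
    by (intro L1_lim_mean_outer_mult_left L1_lim_mean_outer_mult_right G)
  have "L1_lim M (mean_outer h (\<lambda>n i \<omega>. ?A n i \<omega> + ?N n i \<omega>) (\<lambda>n i \<omega>. ?A' n i \<omega> + ?N' n i \<omega>))
      ((0 + 0) + (0 + S ** G ** transpose S'))"
    by (intro L1_lim_mean_outer_add_left L1_lim_mean_outer_add_right AA AN NA NN)
  then show ?thesis by (simp add: drift_part_def)
qed

end

section \<open>Realized covariance and consistency of the test\<close>

lemma (in prob_space) indep_sets_imp_indep_set:
  assumes ind: "indep_sets F I" and ij: "i \<in> I" "j \<in> I" "i \<noteq> j"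
  shows "indep_set (F i) (F j)"
proof (rule indep_setI)
  show "F i \<subseteq> events" "F j \<subseteq> events" using ind ij by (auto simp: indep_sets_def)
  fix a b assume ab: "a \<in> F i" "b \<in> F j"
  show "prob (a \<inter> b) = prob a * prob b"
    using indep_setsD[OF ind, of "{i, j}" "\<lambda>k. if k = i then a else b"] ij ab by (auto simp: Int_commute)
qed

lemma (in prob_space) indep_processes4_pairs:
  assumes "indep_processes4 M W1 W2 W3 W4"
  shows "indep_set (process_events M W1) (process_events M W2)"
    "indep_set (process_events M W1) (process_events M W3)"
    "indep_set (process_events M W1) (process_events M W4)"
    "indep_set (process_events M W2) (process_events M W3)"
    "indep_set (process_events M W2) (process_events M W4)"
    "indep_set (process_events M W3) (process_events M W4)"
proof -
  note pair = indep_sets_imp_indep_set[OF assms[unfolded indep_processes4_def]]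
  show "indep_set (process_events M W1) (process_events M W2)" using pair[of 0 1] by simp
  show "indep_set (process_events M W1) (process_events M W3)" using pair[of 0 2] by simp
  show "indep_set (process_events M W1) (process_events M W4)" using pair[of 0 3] by (simp add: numeral_3_eq_3)
  show "indep_set (process_events M W2) (process_events M W3)" using pair[of 1 2] by simp
  show "indep_set (process_events M W2) (process_events M W4)" using pair[of 1 3] by (simp add: numeral_3_eq_3)
  show "indep_set (process_events M W3) (process_events M W4)" using pair[of 2 3] by (simp add: numeral_3_eq_3)
qed

lemma L1_lim_mean_outer_combination_left:
  assumes "L1_lim M (mean_outer h u1 v) G1" "L1_lim M (mean_outer h u2 v) G2"
    "L1_lim M (mean_outer h u3 v) G3" "L1_lim M (mean_outer h u4 v) G4"
  shows "L1_lim M (mean_outer h (\<lambda>n i \<omega>. A1 *v u1 n i \<omega> + A2 *v u2 n i \<omega> + A3 *v u3 n i \<omega> + A4 *v u4 n i \<omega>) v)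
    (A1 ** G1 + A2 ** G2 + A3 ** G3 + A4 ** G4)"
  by (intro L1_lim_mean_outer_add_left L1_lim_mean_outer_mult_left assms)

lemma L1_lim_mean_outer_combination_right:
  assumes "L1_lim M (mean_outer h u v1) G1" "L1_lim M (mean_outer h u v2) G2"
    "L1_lim M (mean_outer h u v3) G3" "L1_lim M (mean_outer h u v4) G4"
  shows "L1_lim M (mean_outer h u (\<lambda>n i \<omega>. A1 *v v1 n i \<omega> + A2 *v v2 n i \<omega> + A3 *v v3 n i \<omega> + A4 *v v4 n i \<omega>))
    (G1 ** transpose A1 + G2 ** transpose A2 + G3 ** transpose A3 + G4 ** transpose A4)"
  by (intro L1_lim_mean_outer_add_right L1_lim_mean_outer_mult_right assms)

lemma realized_cov_eq_mean_outer:
  "realized_cov X h n \<omega> = mean_outer h (incr h X) (incr h X) n \<omega>"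
  by (simp add: realized_cov_def mean_outer_def incr_def sum.atLeast1_atMost_eq)

lemma L1_lim_cong:
  assumes Z: "L1_lim M Z c" and eq: "\<And>n \<omega>. \<omega> \<in> space M \<Longrightarrow> Z n \<omega> = Z' n \<omega>"
  shows "L1_lim M Z' c"
proof -
  have "Z n \<in> borel_measurable M \<longleftrightarrow> Z' n \<in> borel_measurable M" for n
    by (rule measurable_cong) (rule eq)
  moreover have "(\<integral>\<^sup>+\<omega>. ennreal (norm (Z n \<omega> - c)) \<partial>M) = (\<integral>\<^sup>+\<omega>. ennreal (norm (Z' n \<omega> - c)) \<partial>M)" for n
    by (rule nn_integral_cong) (simp add: eq)
  ultimately show ?thesis using Z by (simp add: L1_lim_def)
qed

text \<open>Solving the structural equation for \<open>\<eta>\<close>.\<close>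

lemma reduced_form:
  assumes inv: "invertible (Psi m \<theta>)"
    and struct: "\<eta> = B0 m \<theta> *v \<eta> + Gam m \<theta> *v \<xi> + \<zeta>"
    and X1: "\<And>i. X $ Inl i = (Lam1 m \<theta> *v \<xi> + \<delta>) $ i"
    and X2: "\<And>j. X $ Inr j = (Lam2 m \<theta> *v \<eta> + \<epsilon>) $ j"
  shows "X = load_xi m \<theta> *v \<xi> + load_delta *v \<delta> + load_eps *v \<epsilon> + load_zeta m \<theta> *v \<zeta>"
proof -
  have "Psi m \<theta> *v \<eta> = \<eta> - B0 m \<theta> *v \<eta>"
    by (simp add: Psi_def matrix_vector_mult_diff_rdistrib)
  also have "\<dots> = Gam m \<theta> *v \<xi> + \<zeta>"
    using struct by (metis add_diff_cancel_left' add.assoc)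
  finally have "matrix_inv (Psi m \<theta>) *v (Psi m \<theta> *v \<eta>) = matrix_inv (Psi m \<theta>) *v (Gam m \<theta> *v \<xi> + \<zeta>)"
    by simp
  then have "\<eta> = matrix_inv (Psi m \<theta>) *v (Gam m \<theta> *v \<xi>) + matrix_inv (Psi m \<theta>) *v \<zeta>"
    by (simp add: matrix_vector_mul_assoc matrix_inv_mult[OF inv] matrix_vector_right_distrib)
  then have L2: "Lam2 m \<theta> *v \<eta> = (Lam2 m \<theta> ** matrix_inv (Psi m \<theta>) ** Gam m \<theta>) *v \<xi>
      + (Lam2 m \<theta> ** matrix_inv (Psi m \<theta>)) *v \<zeta>"
    by (simp only: matrix_vector_right_distrib matrix_vector_mul_assoc matrix_mul_assoc)
  have "X $ a = (load_xi m \<theta> *v \<xi> + load_delta *v \<delta> + load_eps *v \<epsilon> + load_zeta m \<theta> *v \<zeta>) $ a" for a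
    by (cases a) (simp_all add: X1 X2 L2 load_xi_def load_delta_def load_eps_def load_zeta_def
        stack_vector_mult_nth)
  then show ?thesis by (simp add: vec_eq_iff)
qed

lemma psd_scaleR: "0 \<le> c \<Longrightarrow> psd A \<Longrightarrow> psd (c *\<^sub>R A)"
  by (simp add: psd_def transpose_scaleR scaleR_matrix_vector)

lemma psd_realized_cov:
  assumes "0 < h n"
  shows "psd (realized_cov X h n \<omega>)"
  unfolding realized_cov_eq_mean_outer mean_outer_def
  by (intro psd_scaleR is_diffusion_matrix_imp_psd)
    (use assms in \<open>auto simp: is_diffusion_matrix_def\<close>)

text \<open>A lower bound of a continuous function on a dense subset is a lower bound everywhere.\<close>

lemma INF_eq_INF_dense:
  fixes f :: "'a::metric_space \<Rightarrow> real"
  assumes f: "continuous_on P f" and P: "closed P" and D: "D \<subseteq> P" "P \<subseteq> closure D" "D \<noteq> {}"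
    and bdd: "bdd_below (f ` P)"
  shows "(INF x\<in>P. f x) = (INF x\<in>D. f x)"
proof (rule antisym)
  have cl: "closure D = P" using closure_minimal[OF D(1) P] D(2) by simp
  show "(INF x\<in>P. f x) \<le> (INF x\<in>D. f x)"
    using D bdd by (intro cINF_superset_mono) auto
  have bddD: "bdd_below (f ` D)" using bdd D(1) by (meson bdd_below_mono image_mono)
  show "(INF x\<in>D. f x) \<le> (INF x\<in>P. f x)"
  proof (rule cINF_greatest)
    show "P \<noteq> {}" using D by auto
    fix x assume "x \<in> P"
    show "(INF x\<in>D. f x) \<le> f x"
    proof (rule continuous_ge_on_closure[of D f x])
      show "continuous_on (closure D) f" "x \<in> closure D" using f cl \<open>x \<in> P\<close> by simp_all
      show "\<And>y. y \<in> D \<Longrightarrow> (INF x\<in>D. f x) \<le> f y" by (rule cINF_lower[OF bddD])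
    qed
  qed
qed

lemma borel_measurable_INF_contrast:
  fixes \<Sigma> :: "'b::euclidean_space \<Rightarrow> real^'p^'p" and Z :: "'a \<Rightarrow> real^'p^'p"
  assumes P: "compact P" "P \<noteq> {}" and \<Sigma>: "continuous_on P \<Sigma>" "\<And>\<theta>. \<theta> \<in> P \<Longrightarrow> pos_def (\<Sigma> \<theta>)"
    and Z: "Z \<in> borel_measurable M" "\<And>\<omega>. \<omega> \<in> space M \<Longrightarrow> psd (Z \<omega>)"
  shows "(\<lambda>\<omega>. INF \<theta>\<in>P. contrast (Z \<omega>) (\<Sigma> \<theta>)) \<in> borel_measurable M"
proof -
  obtain D where D: "countable D" "D \<subseteq> P" "P \<subseteq> closure D"
    using separable[of P] by blast
  have ne: "D \<noteq> {}" using D(3) P(2) by auto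
  have "(\<lambda>\<omega>. INF \<theta>\<in>D. contrast (Z \<omega>) (\<Sigma> \<theta>)) \<in> borel_measurable M"
  proof (rule borel_measurable_cINF_real[OF D(1)])
    fix \<theta> assume "\<theta> \<in> D"
    then show "(\<lambda>\<omega>. contrast (Z \<omega>) (\<Sigma> \<theta>)) \<in> borel_measurable M"
      using D(2) \<Sigma>(2) by (intro borel_measurable_contrast Z) auto
  qed
  moreover have "(INF \<theta>\<in>P. contrast (Z \<omega>) (\<Sigma> \<theta>)) = (INF \<theta>\<in>D. contrast (Z \<omega>) (\<Sigma> \<theta>))" if "\<omega> \<in> space M" for \<omega>
  proof (rule INF_eq_INF_dense[OF _ compact_imp_closed[OF P(1)] D(2,3) ne])
    show "continuous_on P (\<lambda>\<theta>. contrast (Z \<omega>) (\<Sigma> \<theta>))"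
      by (rule continuous_on_compose2[OF continuous_on_contrast[OF Z(2)[OF that]] \<Sigma>(1)])
        (use \<Sigma>(2) in auto)
    show "bdd_below ((\<lambda>\<theta>. contrast (Z \<omega>) (\<Sigma> \<theta>)) ` P)"
      using contrast_nonneg[OF Z(2)[OF that]] \<Sigma>(2) by (auto intro!: bdd_belowI2[where m = 0])
  qed
  ultimately show ?thesis by (subst measurable_cong) auto
qed

text \<open>If \<open>\<Sigma>0\<close> has distance \<open>d\<close> from \<open>K\<close> and \<open>Q\<close> distance at most \<open>d / 2\<close> from \<open>\<Sigma>0\<close>, then \<open>Q\<close> has distance at
  least \<open>d / 2\<close> from \<open>K\<close>, and the contrast dominates the squared distance.\<close>

lemma contrast_bounded_away:
  fixes K :: "(real^'p^'p) set"
  assumes K: "compact K" "\<And>S. S \<in> K \<Longrightarrow> pos_def S" and \<Sigma>0: "\<Sigma>0 \<notin> K"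
  obtains e c where "0 < e" "0 < c"
    "\<And>Q S. psd Q \<Longrightarrow> norm (Q - \<Sigma>0) \<le> e \<Longrightarrow> S \<in> K \<Longrightarrow> c \<le> contrast Q S"
proof -
  obtain d where d: "0 < d" "\<And>S. S \<in> K \<Longrightarrow> d \<le> dist \<Sigma>0 S"
    using separate_point_closed[OF compact_imp_closed[OF K(1)] \<Sigma>0] by blast
  obtain R1 where R1: "\<And>S. S \<in> K \<Longrightarrow> norm S \<le> R1"
    using compact_imp_bounded[OF K(1)] unfolding bounded_iff by blast
  define R where "R = \<bar>R1\<bar> + norm \<Sigma>0 + d"
  have R: "0 < R" using d(1) by (simp add: R_def add_nonneg_pos)
  obtain c where c: "0 < c" and ge: "\<And>Q S :: real^'p^'p. psd Q \<Longrightarrow> pos_def S \<Longrightarrow>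
      norm Q \<le> R \<Longrightarrow> norm S \<le> R \<Longrightarrow> c * (norm (Q - S))\<^sup>2 \<le> contrast Q S"
    by (rule contrast_ge[OF R]) (rule that, assumption, assumption)
  show thesis
  proof (rule that[of "d / 2" "c * (d / 2)\<^sup>2"])
    show "0 < d / 2" "0 < c * (d / 2)\<^sup>2" using d c by simp_all
    fix Q S assume Q: "psd Q" "norm (Q - \<Sigma>0) \<le> d / 2" and S: "S \<in> K"
    have "dist \<Sigma>0 S \<le> dist Q \<Sigma>0 + dist Q S" by (metis dist_commute dist_triangle)
    then have "d / 2 \<le> norm (Q - S)" using d(2)[OF S] Q(2) by (simp add: dist_norm)
    then have "c * (d / 2)\<^sup>2 \<le> c * (norm (Q - S))\<^sup>2"
      using c d(1) by (intro mult_left_mono power_mono) auto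
    also have "\<dots> \<le> contrast Q S"
    proof (rule ge[OF Q(1) K(2)[OF S]])
      show "norm Q \<le> R" using norm_triangle_sub[of Q \<Sigma>0] Q(2) d(1) by (simp add: R_def)
      show "norm S \<le> R" using R1[OF S] d(1) norm_ge_zero[of \<Sigma>0] unfolding R_def by linarith
    qed
    finally show "c * (d / 2)\<^sup>2 \<le> contrast Q S" .
  qed
qed

text \<open>By bilinearity the realized covariance is the sum of the sixteen realized covariations of pairs of
  latent processes, multiplied by the coefficient matrices. The four diagonal pairs converge to the
  diffusion matrices; the other twelve vanish because the driving noises are independent.\<close>

theorem (in prob_space) realized_cov_consistent:
  fixes m :: "('q::finite, 'k1::finite, 'k2::finite, 'p1::finite, 'p2::finite) sem_model"
    and W1 :: "real \<Rightarrow> 'a \<Rightarrow> real^'r1::finite"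
    and W2 :: "real \<Rightarrow> 'a \<Rightarrow> real^'r2::finite"
    and W3 :: "real \<Rightarrow> 'a \<Rightarrow> real^'r3::finite"
    and W4 :: "real \<Rightarrow> 'a \<Rightarrow> real^'r4::finite"
    and X :: "real \<Rightarrow> 'a \<Rightarrow> real^('p1 + 'p2)"
  assumes sym: "transpose (Sxi m \<theta>0) = Sxi m \<theta>0" and inv: "invertible (Psi m \<theta>0)"
    and S: "S1 ** transpose S1 = Sxi m \<theta>0" "S2 ** transpose S2 = Sdel m \<theta>0"
      "S3 ** transpose S3 = Seps m \<theta>0" "S4 ** transpose S4 = Szeta m \<theta>0"
    and W: "standard_wiener M W1" "standard_wiener M W2" "standard_wiener M W3" "standard_wiener M W4"
    and ind: "indep_processes4 M W1 W2 W3 W4"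
    and sde: "sde_solution M W1 B1 S1 \<xi>0 \<xi>" "sde_solution M W2 B2 S2 \<delta>0 \<delta>"
      "sde_solution M W3 B3 S3 \<epsilon>0 \<epsilon>" "sde_solution M W4 B4 S4 \<zeta>0 \<zeta>"
    and structural:
      "\<And>t \<omega>. 0 \<le> t \<Longrightarrow> \<omega> \<in> space M \<Longrightarrow>
         \<eta> t \<omega> = B0 m \<theta>0 *v \<eta> t \<omega> + Gam m \<theta>0 *v \<xi> t \<omega> + \<zeta> t \<omega>"
    and observable:
      "\<And>t \<omega> i. 0 \<le> t \<Longrightarrow> \<omega> \<in> space M \<Longrightarrow>
         X t \<omega> $ Inl i = (Lam1 m \<theta>0 *v \<xi> t \<omega> + \<delta> t \<omega>) $ i"
      "\<And>t \<omega> j. 0 \<le> t \<Longrightarrow> \<omega> \<in> space M \<Longrightarrow>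
         X t \<omega> $ Inr j = (Lam2 m \<theta>0 *v \<eta> t \<omega> + \<epsilon> t \<omega>) $ j"
    and B: "regular_drift B1" "regular_drift B2" "regular_drift B3" "regular_drift B4"
    and mom: "bounded_moments M \<xi>" "bounded_moments M \<delta>" "bounded_moments M \<epsilon>" "bounded_moments M \<zeta>"
    and h: "\<And>n. 0 < h n" "h \<longlonglongrightarrow> 0"
  shows "L1_lim M (realized_cov X h) (Sigma_cov m \<theta>0)"
proof -
  let ?Q = "\<lambda>U V. mean_outer h (incr h U) (incr h V)"
  note RC = L1_lim_realized_covariation[OF h]
  note self = L1_lim_wiener_self[OF _ h(1)] and cross = L1_lim_wiener_cross[OF _ _ _ h(1)]
  note zero = matrix_mult_zero_left matrix_mult_zero_right
  note ip = indep_processes4_pairs[OF ind]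
  have diag: "L1_lim M (?Q \<xi> \<xi>) (Sxi m \<theta>0)" "L1_lim M (?Q \<delta> \<delta>) (Sdel m \<theta>0)"
      "L1_lim M (?Q \<epsilon> \<epsilon>) (Seps m \<theta>0)" "L1_lim M (?Q \<zeta> \<zeta>) (Szeta m \<theta>0)"
    using RC[OF W(1) W(1) sde(1) sde(1) B(1) B(1) mom(1) mom(1) self[OF W(1)]]
      RC[OF W(2) W(2) sde(2) sde(2) B(2) B(2) mom(2) mom(2) self[OF W(2)]]
      RC[OF W(3) W(3) sde(3) sde(3) B(3) B(3) mom(3) mom(3) self[OF W(3)]]
      RC[OF W(4) W(4) sde(4) sde(4) B(4) B(4) mom(4) mom(4) self[OF W(4)]]
    by (simp_all only: S matrix_mul_rid)
  have off: "L1_lim M (?Q \<xi> \<delta>) 0" "L1_lim M (?Q \<xi> \<epsilon>) 0" "L1_lim M (?Q \<xi> \<zeta>) 0"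
      "L1_lim M (?Q \<delta> \<epsilon>) 0" "L1_lim M (?Q \<delta> \<zeta>) 0" "L1_lim M (?Q \<epsilon> \<zeta>) 0"
    using RC[OF W(1) W(2) sde(1) sde(2) B(1) B(2) mom(1) mom(2) cross[OF W(1) W(2) ip(1)]]
      RC[OF W(1) W(3) sde(1) sde(3) B(1) B(3) mom(1) mom(3) cross[OF W(1) W(3) ip(2)]]
      RC[OF W(1) W(4) sde(1) sde(4) B(1) B(4) mom(1) mom(4) cross[OF W(1) W(4) ip(3)]]
      RC[OF W(2) W(3) sde(2) sde(3) B(2) B(3) mom(2) mom(3) cross[OF W(2) W(3) ip(4)]]
      RC[OF W(2) W(4) sde(2) sde(4) B(2) B(4) mom(2) mom(4) cross[OF W(2) W(4) ip(5)]]
      RC[OF W(3) W(4) sde(3) sde(4) B(3) B(4) mom(3) mom(4) cross[OF W(3) W(4) ip(6)]]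
    by (simp_all only: zero)
  have off': "L1_lim M (?Q \<delta> \<xi>) 0" "L1_lim M (?Q \<epsilon> \<xi>) 0" "L1_lim M (?Q \<zeta> \<xi>) 0"
      "L1_lim M (?Q \<epsilon> \<delta>) 0" "L1_lim M (?Q \<zeta> \<delta>) 0" "L1_lim M (?Q \<zeta> \<epsilon>) 0"
    using off[THEN L1_lim_mean_outer_swap] by (simp_all only: transpose_zero)
  let ?A1 = "load_xi m \<theta>0" and ?A2 = "load_delta :: real^'p1^('p1 + 'p2)"
    and ?A3 = "load_eps :: real^'p2^('p1 + 'p2)" and ?A4 = "load_zeta m \<theta>0"
  let ?Z = "\<lambda>n i \<omega>. ?A1 *v incr h \<xi> n i \<omega> + ?A2 *v incr h \<delta> n i \<omega> + ?A3 *v incr h \<epsilon> n i \<omega> + ?A4 *v incr h \<zeta> n i \<omega>"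
  have "L1_lim M (mean_outer h (incr h \<xi>) ?Z) (Sxi m \<theta>0 ** transpose ?A1)"
    "L1_lim M (mean_outer h (incr h \<delta>) ?Z) (Sdel m \<theta>0 ** transpose ?A2)"
    "L1_lim M (mean_outer h (incr h \<epsilon>) ?Z) (Seps m \<theta>0 ** transpose ?A3)"
    "L1_lim M (mean_outer h (incr h \<zeta>) ?Z) (Szeta m \<theta>0 ** transpose ?A4)"
    using L1_lim_mean_outer_combination_right[OF diag(1) off(1,2,3), of ?A1 ?A2 ?A3 ?A4]
      L1_lim_mean_outer_combination_right[OF off'(1) diag(2) off(4,5), of ?A1 ?A2 ?A3 ?A4]
      L1_lim_mean_outer_combination_right[OF off'(2,4) diag(3) off(6), of ?A1 ?A2 ?A3 ?A4]
      L1_lim_mean_outer_combination_right[OF off'(3,5,6) diag(4), of ?A1 ?A2 ?A3 ?A4]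
    by (simp_all only: zero add_0_left add_0_right)
  from L1_lim_mean_outer_combination_left[OF this, of ?A1 ?A2 ?A3 ?A4]
  have "L1_lim M (mean_outer h ?Z ?Z) (Sigma_cov m \<theta>0)"
    by (simp only: Sigma_cov_decomposition[OF sym] matrix_mul_assoc)
  then show ?thesis
  proof (rule L1_lim_cong)
    fix n \<omega> assume \<omega>: "\<omega> \<in> space M"
    have X: "X t \<omega> = ?A1 *v \<xi> t \<omega> + ?A2 *v \<delta> t \<omega> + ?A3 *v \<epsilon> t \<omega> + ?A4 *v \<zeta> t \<omega>" if "0 \<le> t" for t
      by (rule reduced_form[OF inv structural[OF that \<omega>] observable(1)[OF that \<omega>] observable(2)[OF that \<omega>]])
    have "incr h X n i \<omega> = ?Z n i \<omega>" for i
      using h(1)[of n] by (simp add: incr_def X less_imp_le matrix_vector_mult_diff_distrib)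
    then show "mean_outer h ?Z ?Z n \<omega> = realized_cov X h n \<omega>"
      by (simp add: realized_cov_eq_mean_outer mean_outer_def)
  qed
qed

theorem theorem4:
  fixes M :: "'a measure"
    and m :: "('q::finite, 'k1::finite, 'k2::finite, 'p1::finite, 'p2::finite) sem_model"
    and ms :: "('qs::finite, 'k1s::finite, 'k2s::finite, 'p1, 'p2) sem_model"
    and \<alpha> :: real
    and \<theta>0 :: "real^'q"
    and \<theta>bar :: "real^'qs"
    and W1 :: "real \<Rightarrow> 'a \<Rightarrow> real^'r1::finite"
    and W2 :: "real \<Rightarrow> 'a \<Rightarrow> real^'r2::finite"
    and W3 :: "real \<Rightarrow> 'a \<Rightarrow> real^'r3::finite"
    and W4 :: "real \<Rightarrow> 'a \<Rightarrow> real^'r4::finite"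
    and S1 :: "real^'r1^'k1" and S2 :: "real^'r2^'p1"
    and S3 :: "real^'r3^'p2" and S4 :: "real^'r4^'k2"
    and B1 :: "real^'k1 \<Rightarrow> real^'k1" and B2 :: "real^'p1 \<Rightarrow> real^'p1"
    and B3 :: "real^'p2 \<Rightarrow> real^'p2" and B4 :: "real^'k2 \<Rightarrow> real^'k2"
    and \<xi>0 :: "real^'k1" and \<delta>0 :: "real^'p1" and \<epsilon>0 :: "real^'p2" and \<zeta>0 :: "real^'k2"
    and \<xi> :: "real \<Rightarrow> 'a \<Rightarrow> real^'k1" and \<delta> :: "real \<Rightarrow> 'a \<Rightarrow> real^'p1"
    and \<epsilon> :: "real \<Rightarrow> 'a \<Rightarrow> real^'p2" and \<zeta> :: "real \<Rightarrow> 'a \<Rightarrow> real^'k2"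
    and \<eta> :: "real \<Rightarrow> 'a \<Rightarrow> real^'k2"
    and X :: "real \<Rightarrow> 'a \<Rightarrow> real^('p1 + 'p2)"
    and h :: "nat \<Rightarrow> real"
    and \<theta>hat :: "nat \<Rightarrow> 'a \<Rightarrow> real^'qs"
  assumes "prob_space M"
    and \<alpha>: "0 < \<alpha>" "\<alpha> < 1"
    and models: "wf_model m" "wf_model ms"
    and true_param: "\<theta>0 \<in> Params m"
    and diffusion_coeffs:
      "S1 ** transpose S1 = Sxi m \<theta>0" "S2 ** transpose S2 = Sdel m \<theta>0"
      "S3 ** transpose S3 = Seps m \<theta>0" "S4 ** transpose S4 = Szeta m \<theta>0"
    and noise:
      "standard_wiener M W1" "standard_wiener M W2" "standard_wiener M W3" "standard_wiener M W4"
      "indep_processes4 M W1 W2 W3 W4"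
    and latent:
      "sde_solution M W1 B1 S1 \<xi>0 \<xi>" "sde_solution M W2 B2 S2 \<delta>0 \<delta>"
      "sde_solution M W3 B3 S3 \<epsilon>0 \<epsilon>" "sde_solution M W4 B4 S4 \<zeta>0 \<zeta>"
    and structural:
      "\<And>t \<omega>. 0 \<le> t \<Longrightarrow> \<omega> \<in> space M \<Longrightarrow>
         \<eta> t \<omega> = B0 m \<theta>0 *v \<eta> t \<omega> + Gam m \<theta>0 *v \<xi> t \<omega> + \<zeta> t \<omega>"
    and observable:
      "\<And>t \<omega> i. 0 \<le> t \<Longrightarrow> \<omega> \<in> space M \<Longrightarrow>
         X t \<omega> $ Inl i = (Lam1 m \<theta>0 *v \<xi> t \<omega> + \<delta> t \<omega>) $ i"
      "\<And>t \<omega> j. 0 \<le> t \<Longrightarrow> \<omega> \<in> space M \<Longrightarrow>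
         X t \<omega> $ Inr j = (Lam2 m \<theta>0 *v \<eta> t \<omega> + \<epsilon> t \<omega>) $ j"
    and a_drifts: "regular_drift B1" "regular_drift B2" "regular_drift B3" "regular_drift B4"
    and a_moments:
      "bounded_moments M \<xi>" "bounded_moments M \<delta>" "bounded_moments M \<epsilon>" "bounded_moments M \<zeta>"
    and b_ergodic:
      "ergodic_solution M W1 B1 S1 \<xi>" "ergodic_solution M W2 B2 S2 \<delta>"
      "ergodic_solution M W3 B3 S3 \<epsilon>" "ergodic_solution M W4 B4 S4 \<zeta>"
    and c_nondegenerate: "sem_nondegenerate m" "sem_nondegenerate ms"
    and \<theta>bar_minimizer:
      "\<theta>bar \<in> Params ms"
      "F_disc (Sigma_cov m \<theta>0) (Sigma_cov ms \<theta>bar)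
         = (INF \<theta>\<in>Params ms. F_disc (Sigma_cov m \<theta>0) (Sigma_cov ms \<theta>))"
    and d_unique:
      "\<And>\<theta>. \<theta> \<in> Params ms \<Longrightarrow>
         F_disc (Sigma_cov m \<theta>0) (Sigma_cov ms \<theta>) = F_disc (Sigma_cov m \<theta>0) (Sigma_cov ms \<theta>bar) \<Longrightarrow>
         \<theta> = \<theta>bar"
    and e_alternative: "\<And>\<theta>. \<theta> \<in> Params ms \<Longrightarrow> Sigma_cov m \<theta>0 \<noteq> Sigma_cov ms \<theta>"
    and sampling: "\<And>n. 0 < h n" "h \<longlonglongrightarrow> 0" "filterlim (\<lambda>n. real n * h n) at_top sequentially"
    and estimator:
      "\<And>n \<omega>. 0 < n \<Longrightarrow> \<omega> \<in> space M \<Longrightarrow> \<theta>hat n \<omega> \<in> Params ms"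
      "\<And>n \<omega>. 0 < n \<Longrightarrow> \<omega> \<in> space M \<Longrightarrow>
         contrast (realized_cov X h n \<omega>) (Sigma_cov ms (\<theta>hat n \<omega>))
           = (INF \<theta>\<in>Params ms. contrast (realized_cov X h n \<omega>) (Sigma_cov ms \<theta>))"
  shows "(\<lambda>n. measure M {\<omega>\<in>space M.
            real n * contrast (realized_cov X h n \<omega>) (Sigma_cov ms (\<theta>hat n \<omega>))
              > chi2_upper (CARD('p1 + 'p2) * (CARD('p1 + 'p2) + 1) div 2 - CARD('qs)) \<alpha>})
         \<longlonglongrightarrow> 1"
proof -
  interpret prob_space M by fact
  have nd: "invertible (Psi m \<theta>0)" and sym: "transpose (Sxi m \<theta>0) = Sxi m \<theta>0"
    using c_nondegenerate(1) true_param wf_model_diffusion_psd(1)[OF models(1) true_param]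
    by (auto simp: sem_nondegenerate_def psd_def)
  let ?Q = "realized_cov X h" and ?P = "Params ms" and ?S = "Sigma_cov ms"
  let ?c = "chi2_upper (CARD('p1 + 'p2) * (CARD('p1 + 'p2) + 1) div 2 - CARD('qs)) \<alpha>"
  have lim: "L1_lim M ?Q (Sigma_cov m \<theta>0)"
    by (rule realized_cov_consistent[OF sym nd diffusion_coeffs noise latent structural observable
          a_drifts a_moments sampling(1,2)])
  have P: "compact ?P" "?P \<noteq> {}"
    using models(2) \<theta>bar_minimizer(1) by (auto simp: wf_model_def)
  have S: "continuous_on ?P ?S" "\<And>\<theta>. \<theta> \<in> ?P \<Longrightarrow> pos_def (?S \<theta>)"
    using continuous_on_Sigma_cov pos_def_Sigma_cov models(2) c_nondegenerate(2) by blast+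
  obtain e c where e: "0 < e" and c: "0 < c"
    and away: "\<And>Q S. psd Q \<Longrightarrow> norm (Q - Sigma_cov m \<theta>0) \<le> e \<Longrightarrow> S \<in> ?S ` ?P \<Longrightarrow> c \<le> contrast Q S"
  proof (rule contrast_bounded_away[of "?S ` ?P" "Sigma_cov m \<theta>0"])
    show "compact (?S ` ?P)" by (rule compact_continuous_image[OF S(1) P(1)])
    show "Sigma_cov m \<theta>0 \<notin> ?S ` ?P" using e_alternative by blast
  qed (use S(2) that in blast)+
  \<comment> \<open>The estimator may fail to be measurable, but its contrast is an infimum over the parameters.\<close>
  let ?E = "\<lambda>n. {\<omega>\<in>space M. real n * contrast (?Q n \<omega>) (?S (\<theta>hat n \<omega>)) > ?c}"
  have meas: "?E n \<in> events" if "0 < n" for n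
  proof -
    have "(\<lambda>\<omega>. INF \<theta>\<in>?P. contrast (?Q n \<omega>) (?S \<theta>)) \<in> borel_measurable M"
      using lim by (intro borel_measurable_INF_contrast P S psd_realized_cov sampling(1)) (auto simp: L1_lim_def)
    then have "{\<omega>\<in>space M. real n * (INF \<theta>\<in>?P. contrast (?Q n \<omega>) (?S \<theta>)) > ?c} \<in> events"
      by measurable
    also have "{\<omega>\<in>space M. real n * (INF \<theta>\<in>?P. contrast (?Q n \<omega>) (?S \<theta>)) > ?c} = ?E n"
      using estimator(2)[OF that] by auto
    finally show ?thesis .
  qed
  \<comment> \<open>From \<open>N\<close> on, \<open>n\<close> times the lower bound \<open>c\<close> for the contrast exceeds the critical value.\<close>
  obtain N :: nat where N: "?c / c < real N" using reals_Archimedean2 by blast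
  have ge: "measure M {\<omega>\<in>space M. norm (?Q n \<omega> - Sigma_cov m \<theta>0) \<le> e} \<le> measure M (?E n)"
    if n: "max 1 N \<le> n" for n
  proof (rule finite_measure_mono)
    have pos: "0 < n" using n by auto
    show "?E n \<in> events" by (rule meas[OF pos])
    have "?c / c < real n" using N n by linarith
    then have large: "?c < real n * c" using c by (simp add: field_simps)
    show "{\<omega>\<in>space M. norm (?Q n \<omega> - Sigma_cov m \<theta>0) \<le> e} \<subseteq> ?E n"
    proof safe
      fix \<omega> assume \<omega>: "\<omega> \<in> space M" and close: "norm (?Q n \<omega> - Sigma_cov m \<theta>0) \<le> e"
      have "c \<le> contrast (?Q n \<omega>) (?S (\<theta>hat n \<omega>))"
        using estimator(1)[OF pos \<omega>] by (intro away psd_realized_cov sampling(1) close) auto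
      then have "real n * c \<le> real n * contrast (?Q n \<omega>) (?S (\<theta>hat n \<omega>))"
        by (intro mult_left_mono) auto
      then show "?c < real n * contrast (?Q n \<omega>) (?S (\<theta>hat n \<omega>))" using large by linarith
    qed
  qed
  show ?thesis
  proof (rule tendsto_sandwich[OF _ _ L1_lim_imp_prob[OF lim e prob_space_axioms] tendsto_const])
    show "\<forall>\<^sub>F n in sequentially.
        measure M {\<omega>\<in>space M. norm (?Q n \<omega> - Sigma_cov m \<theta>0) \<le> e} \<le> measure M (?E n)"
      using ge by (rule eventually_sequentiallyI)
    show "\<forall>\<^sub>F n in sequentially. measure M (?E n) \<le> 1" by simp
  qed
qed

end
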